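(* Let $n\ge1$, $0<\alpha<1$, $1<p<1/\alpha$ and $q=\frac{p}{1-\alpha p}$. There is a constant $c>0$ depending only on $n$, $p$ and $\alpha$ such that for every weight $w\in A_{p,q}^{(s)}(\mathbb{R}^n)$ and every $f\in L^p_{w^p}(\mathbb{R}^n)$, $$\|wI^{(n)}_{\alpha}f\|_{L^{q}(\mathbb{R}^n)}\le c\Big(\prod_{i=1}^{n}\|w\|_{A_{p,q}(x_{i})}\Big)^{\max\{1,\frac{p'}{q}\}(1-\alpha)}\|wf\|_{L^{p}(\mathbb{R}^n)}.$$ Further, the power $\beta=\max\{1,\frac{p'}{q}\}(1-\alpha)$ is sharp: there is no positive non-decreasing function $\psi$ on $[1,\infty)$ with $\psi(t)/t^{\beta}\to0$ as $t\to\infty$ such that $\|wI_{\alpha}^{(n)}f\|_{L^{q}(\mathbb{R}^n)}\le\psi\big(\prod_{i=1}^n\|w\|_{A_{p,q}(x_i)}\big)\|wf\|_{L^{p}(\mathbb{R}^n)}$ for all $w\in A_{p,q}^{(s)}(\mathbb{R}^n)$ and all $f\in L^p_{w^p}(\mathbb{R}^n)$.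
   Context: A weight is an a.e. positive locally integrable function. $p'=p/(p-1)$; $f\in L^p_{w^p}(\mathbb{R}^n)$ means $\|wf\|_{L^p(\mathbb{R}^n)}<\infty$. The Riesz potential with product kernel is $$I_{\alpha}^{(n)}f(x)=\int_{\mathbb{R}^{n}}\frac{f(t_1,\dots,t_n)}{\prod_{i=1}^{n}|x_{i}-t_{i}|^{1-\alpha}}\,dt_{1}\cdots dt_n,\qquad x=(x_1,\dots,x_n)\in\mathbb{R}^n.$$ The weight $w$ belongs to $A_{p,q}^{(s)}(\mathbb{R}^n)$ if $$\sup_P\Big(\frac1{|P|}\int_P w^q\,dx\Big)^{1/q}\Big(\frac1{|P|}\int_P w^{-p'}dx\Big)^{1/p'}<\infty,$$ the supremum being over all bounded parallelepipeds $P\subset\mathbb{R}^n$ with sides parallel to the coordinate axes. The $A_{p,q}$ characteristic in the variable $x_i$, uniform with respect to the other variables, is $$\|w\|_{A_{p,q}(x_i)}=\operatorname*{ess\,sup}_{(x_1,\dots,x_{i-1},x_{i+1},\dots,x_n)\in\mathbb{R}^{n-1}}\ \sup_I\Big(\frac1{|I|}\int_I w^q(x_1,\dots,x_n)\,dx_i\Big)\Big(\frac1{|I|}\int_I w^{-p'}(x_1,\dots,x_n)\,dx_i\Big)^{q/p'},$$ where $I$ runs over bounded intervals of $\mathbb{R}$. One has $w\in A_{p,q}^{(s)}(\mathbb{R}^n)$ if and only if $\|w\|_{A_{p,q}(x_i)}<\infty$ for all $i=1,\dots,n$. *)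

theory Defs
  imports "HOL-Analysis.Analysis" "HOL-Probability.Essential_Supremum"
begin

text \<open>Real powers of extended nonnegative numbers; only used with a positive exponent,
  so that the value at \<open>\<infinity>\<close> is \<open>\<infinity>\<close> and the value at \<open>0\<close> is \<open>0\<close>.\<close>

definition ennreal_powr :: "ennreal \<Rightarrow> real \<Rightarrow> ennreal" where
  "ennreal_powr x a = (if x = \<infinity> then \<infinity> else ennreal (enn2real x powr a))"

definition Lp_norm :: "real \<Rightarrow> ('a::euclidean_space \<Rightarrow> real) \<Rightarrow> ennreal" where
  "Lp_norm p g = ennreal_powr (\<integral>\<^sup>+x. ennreal (\<bar>g x\<bar> powr p) \<partial>lebesgue) (1 / p)"

text \<open>Lebesgue measurability of a weight is implied by integrability over all compact sets.\<close>

definition weight :: "('a::euclidean_space \<Rightarrow> real) \<Rightarrow> bool" where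
  "weight w \<longleftrightarrow> (AE x in lebesgue. 0 < w x) \<and> (\<forall>K. compact K \<longrightarrow> w absolutely_integrable_on K)"

definition weighted_Lp :: "real \<Rightarrow> ('a::euclidean_space \<Rightarrow> real) \<Rightarrow> ('a \<Rightarrow> real) set" where
  "weighted_Lp p w =
     {f. f \<in> borel_measurable lebesgue \<and> Lp_norm p (\<lambda>x. w x * f x) < \<infinity>}"

text \<open>The hyperplanes \<open>t $ i = x $ i\<close>, on which the kernel is singular, are null sets in \<open>t\<close>,
  so the convention \<open>y / 0 = 0\<close> does not affect the integral.  The Bochner integral is
  \<open>0\<close> where the integrand fails to be integrable.\<close>

definition riesz_integrand ::
    "real \<Rightarrow> (real^'n \<Rightarrow> real) \<Rightarrow> real^'n \<Rightarrow> real^'n \<Rightarrow> real" where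
  "riesz_integrand \<alpha> f x t = f t / (\<Prod>i\<in>UNIV. \<bar>x $ i - t $ i\<bar> powr (1 - \<alpha>))"

definition riesz_potential :: "real \<Rightarrow> (real^'n \<Rightarrow> real) \<Rightarrow> real^'n \<Rightarrow> real" where
  "riesz_potential \<alpha> f x = (\<integral>t. riesz_integrand \<alpha> f x t \<partial>lebesgue)"

definition average :: "'a::euclidean_space set \<Rightarrow> ('a \<Rightarrow> real) \<Rightarrow> ennreal" where
  "average S g = (\<integral>\<^sup>+x\<in>S. ennreal (g x) \<partial>lebesgue) / emeasure lebesgue S"

definition A_strong :: "real \<Rightarrow> real \<Rightarrow> (real^'n \<Rightarrow> real) set" where
  "A_strong p q = {w. weight w \<and>
     (SUP P \<in> {cbox a b | a b. \<forall>i. a $ i < b $ i}.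
        ennreal_powr (average P (\<lambda>x. w x powr q)) (1 / q) *
        ennreal_powr (average P (\<lambda>x. w x powr (- (p / (p - 1))))) (1 / (p / (p - 1)))) < \<infinity>}"

definition A_slice_sup :: "real \<Rightarrow> real \<Rightarrow> (real \<Rightarrow> real) \<Rightarrow> ennreal" where
  "A_slice_sup p q v =
     (SUP I \<in> {{a..b} | a b. a < b}.
        average I (\<lambda>s. v s powr q) *
        ennreal_powr (average I (\<lambda>s. v s powr (- (p / (p - 1))))) (q / (p / (p - 1))))"

text \<open>The remaining variables range over the copy of \<open>\<real>\<^sup>n\<^sup>-\<^sup>1\<close> indexed by \<open>- {i}\<close>, with
  (completed) Lebesgue measure; for \<open>n = 1\<close> this is a one-point space of mass \<open>1\<close>.
  The completion matters because \<open>esssup\<close> is \<open>top\<close> on non-measurable functions.\<close>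

definition A_char_var :: "real \<Rightarrow> real \<Rightarrow> 'n::finite \<Rightarrow> (real^'n \<Rightarrow> real) \<Rightarrow> ennreal" where
  "A_char_var p q i w =
     esssup (completion (\<Pi>\<^sub>M j\<in>- {i}. (lborel :: real measure)))
       (\<lambda>y. A_slice_sup p q (\<lambda>s. w (\<chi> j. if j = i then s else y j)))"

text \<open>For \<open>w \<in> A_strong p q\<close> every factor is finite and at least \<open>1\<close>, so \<open>enn2real\<close> loses
  nothing when applied to this product.\<close>

definition A_char_prod :: "real \<Rightarrow> real \<Rightarrow> (real^'n \<Rightarrow> real) \<Rightarrow> ennreal" where
  "A_char_prod p q w = (\<Prod>i\<in>UNIV. A_char_var p q i w)"

end

theory Submission
  imports Defs
begin

text \<open>
  With \<open>u = w\<^sup>q\<close> and \<open>\<sigma> = w powr - p'\<close>, the one-dimensional potential is dominated by dyadic sums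
  over two adjacent grids. By duality one bounds \<open>\<Sum>\<^sub>Q |Q| powr (\<alpha> - 1) (\<integral>\<^sub>Q f d\<sigma>) (\<integral>\<^sub>Q g du)\<close>. The cubes are
  sorted by the dyadic level \<open>B\<close> of \<open>\<sigma>(Q) powr (1/p') u(Q) powr (1/q) / |Q| powr (1 - \<alpha>)\<close>, which lies in
  \<open>[1, A powr (1/q)]\<close>. At a fixed level, summation by parts along the tree in the running maxima of
  the averages of \<open>f\<close> and \<open>g\<close>, Doob's inequality and the gap \<open>p < q\<close> give the bound
  \<open>B powr (1 + q/p') + B powr (1 + p'/q)\<close>, and the levels add up geometrically to \<open>A powr \<beta>\<close>.

  In several variables the one-dimensional bound is applied in one variable at a time, from
  \<open>L\<^sup>p\<close> to \<open>L\<^sup>q\<close>; Minkowski's inequality (\<open>p < q\<close>) restores the order of the mixed norms.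
  A density argument on boxes shows that slices of a strong weight are uniformly
  Muckenhoupt, which gives the almost everywhere integrability.

  Sharpness is tested on products of \<open>|s| powr ((1 - \<delta>) / p')\<close> if \<open>q \<le> p'\<close> and of
  \<open>|s| powr ((\<delta> - 1) / q)\<close> otherwise, as \<open>\<delta>\<close> tends to 0.
\<close>

text \<open>The level range starts at 1 by Hoelder's inequality. The same inequality on
  \<open>R - A\<close>, where \<open>A\<close> is at most half of a cube \<open>R\<close> of level
  \<open>B\<close>, shows that \<open>R - A\<close> keeps a proportion
  \<open>(4 * B) powr - q\<close> of \<open>u\<close> and \<open>(4 * B) powr - p'\<close> of
  \<open>\<sigma>\<close>. The sums over subcubes therefore converge with constants
  \<open>B powr q\<close> and \<open>B powr p'\<close>, of which the roots of order
  \<open>p'\<close> and \<open>q\<close> remain. With the factor \<open>B\<close> that replaces the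
  kernel they give the two powers of \<open>B\<close>; since
  \<open>(1 + q / p') / q = 1 - \<alpha>\<close> and
  \<open>(1 + p' / q) / q = p' / q * (1 - \<alpha>)\<close>, these become the two entries of the
  maximum in \<open>\<beta>\<close>. A geometric sum is comparable to its last term, so no logarithm
  is lost.

  The Muckenhoupt condition is used on intervals with rational endpoints only, so that countably
  many null sets are discarded when slices are considered. Almost everywhere integrability is drawn
  from the strong condition itself and not from the characteristics, which are essential suprema and
  infinite on non-measurable functions.\<close>

locale exponents =
  fixes \<alpha> p q p' q' :: real
  assumes alpha_pos: "0 < \<alpha>" and p_gt_1: "1 < p" and q_gt_1: "1 < q"
    and conj_p: "1 / p + 1 / p' = 1" and conj_q: "1 / q + 1 / q' = 1"
    and gap: "1 / p - 1 / q = \<alpha>"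
begin

lemma p_less_q: "p < q"
proof -
  have "1 / q < 1 / p" using gap alpha_pos by simp
  then show ?thesis using p_gt_1 q_gt_1 by (simp add: field_simps)
qed

lemma p'_gt_1: "1 < p'"
proof -
  have "0 < 1 / p" "1 / p < 1" using p_gt_1 by auto
  then have "0 < 1 / p'" "1 / p' < 1" using conj_p by linarith+
  then show ?thesis by (simp add: divide_less_eq split: if_splits)
qed

lemma q'_gt_1: "1 < q'"
proof -
  have "0 < 1 / q" "1 / q < 1" using q_gt_1 by auto
  then have "0 < 1 / q'" "1 / q' < 1" using conj_q by linarith+
  then show ?thesis by (simp add: divide_less_eq split: if_splits)
qed

lemma inv_q_p': "1 / q + 1 / p' = 1 - \<alpha>"
  using gap conj_p by linarith

lemma inv_p_q': "1 / p + 1 / q' = 1 + \<alpha>"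
  using gap conj_q by linarith

lemma alpha_less_1: "\<alpha> < 1"
  using inv_q_p' q_gt_1 p'_gt_1 by (smt (verit) divide_pos_pos)

text \<open>The hypotheses survive the exchange of \<open>p\<close> with \<open>q'\<close> and of
  \<open>p'\<close> with \<open>q\<close>. An estimate for the half of the bilinear form that
  contains increments of \<open>F\<close> thus yields the half with increments of \<open>G\<close>,
  with \<open>S\<close> and \<open>U\<close> exchanged.\<close>

lemma dual: "exponents \<alpha> q' p' q p"
  using alpha_pos q'_gt_1 p'_gt_1 conj_p conj_q gap by unfold_locales auto

lemma p'_eq: "p' = p / (p - 1)"
  using conj_p p_gt_1 p'_gt_1 by (simp add: field_simps)

end

text \<open>Positive upper bounds \<open>A\<close> and \<open>B\<close> take the place of the sums
  themselves, so the normalisation in Young's inequality never divides by a vanishing sum.\<close>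

lemma sum_Holder_le:
  fixes a b :: "'i \<Rightarrow> real"
  assumes "finite I" and pq: "1 < p" "1 < p'" "1 / p + 1 / p' = 1"
    and nn: "\<And>i. i \<in> I \<Longrightarrow> 0 \<le> a i" "\<And>i. i \<in> I \<Longrightarrow> 0 \<le> b i"
    and A: "(\<Sum>i\<in>I. a i powr p) \<le> A" "0 < A"
    and B: "(\<Sum>i\<in>I. b i powr p') \<le> B" "0 < B"
  shows "(\<Sum>i\<in>I. a i * b i) \<le> A powr (1 / p) * B powr (1 / p')"
proof -
  let ?A = "A powr (1 / p)" and ?B = "B powr (1 / p')"
  have pos: "0 < ?A" "0 < ?B" using A B by auto
  have pw: "?A powr p = A" "?B powr p' = B" using A B pq by (simp_all add: powr_powr)
  have "(\<Sum>i\<in>I. (a i / ?A) * (b i / ?B))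
      \<le> (\<Sum>i\<in>I. (a i / ?A) powr p / p + (b i / ?B) powr p' / p')"
    using nn pos pq by (intro sum_mono Youngs_inequality) auto
  also have "\<dots> = (\<Sum>i\<in>I. a i powr p) / (A * p) + (\<Sum>i\<in>I. b i powr p') / (B * p')"
    by (simp add: sum.distrib powr_divide pw sum_divide_distrib)
  also have "\<dots> \<le> A / (A * p) + B / (B * p')"
    using A B pq by (intro add_mono divide_right_mono) auto
  also have "\<dots> = 1" using A B pq by simp
  finally have "(\<Sum>i\<in>I. a i * b i) / (?A * ?B) \<le> 1"
    by (simp add: sum_divide_distrib)
  then show ?thesis using pos by (simp add: divide_le_eq)
qed

text \<open>Each \<open>x i / X\<close> and \<open>y i / Y\<close> is at most 1, so the exponents
  may be lowered to \<open>b / (b + c)\<close> and \<open>c / (b + c)\<close>; the weighted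
  arithmetic-geometric means then add up to at most 1. This makes a product of powers of two
  superadditive set functions superadditive.\<close>

lemma sum_powr_mult_le:
  fixes x y :: "'i \<Rightarrow> real"
  assumes "finite I" and bc: "0 \<le> b" "0 \<le> c" "1 \<le> b + c"
    and pos: "\<And>i. i \<in> I \<Longrightarrow> 0 < x i" "\<And>i. i \<in> I \<Longrightarrow> 0 < y i"
    and X: "(\<Sum>i\<in>I. x i) \<le> X" "0 < X"
    and Y: "(\<Sum>i\<in>I. y i) \<le> Y" "0 < Y"
  shows "(\<Sum>i\<in>I. x i powr b * y i powr c) \<le> X powr b * Y powr c"
proof -
  let ?s = "b + c"
  have "(x i / X) powr b * (y i / Y) powr c \<le> (b / ?s) * (x i / X) + (c / ?s) * (y i / Y)"
    if i: "i \<in> I" for i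
  proof -
    have xX: "x i \<le> X" using member_le_sum[of i I x] i pos \<open>finite I\<close> X by (smt (verit) DiffD1)
    have yY: "y i \<le> Y" using member_le_sum[of i I y] i pos \<open>finite I\<close> Y by (smt (verit) DiffD1)
    have x1: "0 < x i / X" "x i / X \<le> 1" using xX pos i X by auto
    have y1: "0 < y i / Y" "y i / Y \<le> 1" using yY pos i Y by auto
    have "(x i / X) powr b * (y i / Y) powr c
        \<le> (x i / X) powr (b / ?s) * (y i / Y) powr (c / ?s)"
      using x1 y1 bc by (intro mult_mono powr_mono') (auto simp: divide_le_eq mult_le_cancel_left1)
    also have "\<dots> \<le> (b / ?s) * (x i / X) + (c / ?s) * (y i / Y)"
      using x1 y1 bc by (intro Youngs_inequality_0) (auto simp: add_divide_distrib[symmetric])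
    finally show ?thesis .
  qed
  then have "(\<Sum>i\<in>I. (x i / X) powr b * (y i / Y) powr c)
      \<le> (\<Sum>i\<in>I. (b / ?s) * (x i / X) + (c / ?s) * (y i / Y))"
    by (rule sum_mono)
  also have "\<dots> = (b / ?s) * ((\<Sum>i\<in>I. x i) / X) + (c / ?s) * ((\<Sum>i\<in>I. y i) / Y)"
    by (simp add: sum.distrib sum_distrib_left sum_divide_distrib)
  also have "\<dots> \<le> (b / ?s) * 1 + (c / ?s) * 1"
    using X Y bc by (intro add_mono mult_left_mono) auto
  also have "\<dots> = 1" using bc by (simp add: add_divide_distrib[symmetric])
  finally have "(\<Sum>i\<in>I. x i powr b * y i powr c) / (X powr b * Y powr c) \<le> 1"
    by (simp add: sum_divide_distrib powr_divide)
  then show ?thesis using X Y by (simp add: divide_le_eq)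
qed

section \<open>Laminar families\<close>

definition laminar :: "'a set set \<Rightarrow> bool" where
  "laminar \<Q> \<longleftrightarrow> finite \<Q> \<and> {} \<notin> \<Q> \<and> (\<forall>A\<in>\<Q>. \<forall>B\<in>\<Q>. A \<subseteq> B \<or> B \<subseteq> A \<or> A \<inter> B = {})"

lemma laminarD:
  assumes "laminar \<Q>"
  shows "finite \<Q>" "{} \<notin> \<Q>" "\<And>A B. A \<in> \<Q> \<Longrightarrow> B \<in> \<Q> \<Longrightarrow> A \<subseteq> B \<or> B \<subseteq> A \<or> A \<inter> B = {}"
  using assms by (auto simp: laminar_def)

lemma laminar_subset: "laminar \<Q> \<Longrightarrow> \<P> \<subseteq> \<Q> \<Longrightarrow> laminar \<P>"
  by (auto simp: laminar_def finite_subset)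

definition above :: "'a set set \<Rightarrow> 'a set \<Rightarrow> 'a set set" where
  "above \<Q> A = {S \<in> \<Q>. A \<subseteq> S}"

text \<open>\<open>\<Phi>\<close> depends on a whole family of ancestors, so the increment at
  \<open>A\<close> is what \<open>A\<close> itself contributes beyond its strict ancestors. Allowing
  any \<open>\<Phi>\<close> covers powers of running maxima as well as the product of two of
  them.\<close>

definition increment :: "('a set set \<Rightarrow> real) \<Rightarrow> 'a set set \<Rightarrow> 'a set \<Rightarrow> real" where
  "increment \<Phi> \<Q> A = \<Phi> {S \<in> \<Q>. A \<subseteq> S} - \<Phi> {S \<in> \<Q>. A \<subset> S}"

text \<open>Removing the smallest member \<open>A\<close> changes the ancestors of no other member,
  and the increment at \<open>A\<close> is exactly
  \<open>\<Phi> C - \<Phi> (C - {A})\<close>.\<close>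

lemma chain_telescope:
  fixes \<Phi> :: "'a set set \<Rightarrow> real"
  assumes "finite C" "\<And>A B. A \<in> C \<Longrightarrow> B \<in> C \<Longrightarrow> A \<subseteq> B \<or> B \<subseteq> A"
  shows "(\<Sum>R\<in>C. increment \<Phi> C R) = \<Phi> C - \<Phi> {}"
  using assms
proof (induction "card C" arbitrary: C)
  case 0
  then show ?case by simp
next
  case (Suc n)
  then have "C \<noteq> {}" by auto
  then obtain A where A: "A \<in> C" "\<And>B. B \<in> C \<Longrightarrow> B \<subseteq> A \<Longrightarrow> A = B"
    using finite_has_minimal[OF Suc.prems(1)] by auto
  have min: "A \<subseteq> B" if "B \<in> C" for B using A Suc.prems(2)[OF A(1) that] that by blast
  let ?C = "C - {A}"
  have inc: "increment \<Phi> C R = increment \<Phi> ?C R" if "R \<in> ?C" for R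
  proof -
    have "{S \<in> C. R \<subseteq> S} = {S \<in> ?C. R \<subseteq> S}" "{S \<in> C. R \<subset> S} = {S \<in> ?C. R \<subset> S}"
      using that min by blast+
    then show ?thesis by (simp add: increment_def)
  qed
  have "(\<Sum>R\<in>C. increment \<Phi> C R) = increment \<Phi> C A + (\<Sum>R\<in>?C. increment \<Phi> ?C R)"
    unfolding sum.remove[OF Suc.prems(1) A(1)] by (intro arg_cong2[where f="(+)"] refl sum.cong inc)
  also have "(\<Sum>R\<in>?C. increment \<Phi> ?C R) = \<Phi> ?C - \<Phi> {}"
    using Suc.prems Suc.hyps(2) A by (intro Suc.hyps(1)) auto
  also have "increment \<Phi> C A = \<Phi> C - \<Phi> ?C"
  proof -
    have "{S \<in> C. A \<subseteq> S} = C" "{S \<in> C. A \<subset> S} = ?C" using min by blast+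
    then show ?thesis by (simp add: increment_def)
  qed
  finally show ?case by simp
qed

text \<open>An upward closed chain contains all ancestors of its members, so increments formed in
  the chain and in the whole family agree. The two instances needed are the ancestors of a cube and
  the cubes through a point.\<close>

lemma upper_telescope:
  fixes \<Phi> :: "'a set set \<Rightarrow> real"
  assumes "finite \<Q>" "C \<subseteq> \<Q>" "\<And>A B. A \<in> C \<Longrightarrow> B \<in> C \<Longrightarrow> A \<subseteq> B \<or> B \<subseteq> A"
    and up: "\<And>A B. A \<in> C \<Longrightarrow> B \<in> \<Q> \<Longrightarrow> A \<subseteq> B \<Longrightarrow> B \<in> C"
  shows "(\<Sum>R\<in>C. increment \<Phi> \<Q> R) = \<Phi> C - \<Phi> {}"
proof -
  have "increment \<Phi> \<Q> R = increment \<Phi> C R" if "R \<in> C" for R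
  proof -
    have "{S \<in> \<Q>. R \<subseteq> S} = {S \<in> C. R \<subseteq> S}" "{S \<in> \<Q>. R \<subset> S} = {S \<in> C. R \<subset> S}"
      using that up \<open>C \<subseteq> \<Q>\<close> by auto
    then show ?thesis by (simp add: increment_def)
  qed
  then have "(\<Sum>R\<in>C. increment \<Phi> \<Q> R) = (\<Sum>R\<in>C. increment \<Phi> C R)" by simp
  also have "\<dots> = \<Phi> C - \<Phi> {}"
    using assms by (intro chain_telescope) (auto intro: finite_subset)
  finally show ?thesis .
qed

lemma above_telescope:
  assumes "laminar \<Q>" "A \<in> \<Q>"
  shows "(\<Sum>R\<in>above \<Q> A. increment \<Phi> \<Q> R) = \<Phi> (above \<Q> A) - \<Phi> {}"
proof (rule upper_telescope)
  show "finite \<Q>" using assms laminarD by blast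
  show "B \<subseteq> B' \<or> B' \<subseteq> B" if "B \<in> above \<Q> A" "B' \<in> above \<Q> A" for B B'
  proof -
    have "A \<noteq> {}" using assms laminarD(2) by blast
    then have "B \<inter> B' \<noteq> {}" using that by (auto simp: above_def)
    then show ?thesis
      using that laminarD(3)[OF assms(1), of B B'] by (auto simp: above_def)
  qed
qed (auto simp: above_def)

lemma point_telescope:
  assumes "laminar \<Q>"
  shows "(\<Sum>R\<in>{Q \<in> \<Q>. x \<in> Q}. increment \<Phi> \<Q> R) = \<Phi> {Q \<in> \<Q>. x \<in> Q} - \<Phi> {}"
proof (rule upper_telescope)
  show "finite \<Q>" using assms laminarD by blast
  show "B \<subseteq> B' \<or> B' \<subseteq> B" if "B \<in> {Q \<in> \<Q>. x \<in> Q}" "B' \<in> {Q \<in> \<Q>. x \<in> Q}" for B B'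
    using that laminarD(3)[OF assms(1), of B B'] by auto
qed auto

text \<open>Summation by parts. When \<open>g\<close> is an increment, the inner sum on the left
  telescopes, and on the right only the sums of \<open>f\<close> over subcubes remain to be
  estimated.\<close>

lemma sum_above_swap:
  fixes f g :: "'a set \<Rightarrow> real"
  assumes "finite \<Q>"
  shows "(\<Sum>Q\<in>\<Q>. f Q * (\<Sum>R\<in>above \<Q> Q. g R)) = (\<Sum>R\<in>\<Q>. g R * (\<Sum>Q\<in>{Q \<in> \<Q>. Q \<subseteq> R}. f Q))"
proof -
  have "(\<Sum>Q\<in>\<Q>. f Q * (\<Sum>R\<in>above \<Q> Q. g R)) = (\<Sum>Q\<in>\<Q>. \<Sum>R\<in>{R \<in> \<Q>. Q \<subseteq> R}. f Q * g R)"
    by (simp add: above_def sum_distrib_left)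
  also have "\<dots> = (\<Sum>R\<in>\<Q>. \<Sum>Q\<in>{Q \<in> \<Q>. Q \<subseteq> R}. f Q * g R)"
    using assms by (rule sum.swap_restrict[OF _ assms])
  finally show ?thesis by (simp add: sum_distrib_left mult.commute)
qed

text \<open>A geometric series along the tree: the children of \<open>R\<close> carry at most
  \<open>h R\<close> together, and \<open>l\<close> shrinks by \<open>\<rho>\<close>, so the
  induction leaves \<open>1 + \<rho> / (1 - \<rho>) = 1 / (1 - \<rho>)\<close>. It is applied once
  with a power of the length for \<open>l\<close> and once with a power of the mass.\<close>

lemma laminar_sum_le:
  fixes h l :: "'a set \<Rightarrow> real"
  assumes lam: "laminar \<Q>"
    and h0: "\<And>A. A \<in> \<Q> \<Longrightarrow> 0 \<le> h A" and l0: "\<And>A. A \<in> \<Q> \<Longrightarrow> 0 \<le> l A"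
    and super: "\<And>R \<P>. R \<in> \<Q> \<Longrightarrow> \<P> \<subseteq> \<Q> \<Longrightarrow> disjoint \<P> \<Longrightarrow> (\<And>A. A \<in> \<P> \<Longrightarrow> A \<subseteq> R) \<Longrightarrow> sum h \<P> \<le> h R"
    and decay: "\<And>A R. A \<in> \<Q> \<Longrightarrow> R \<in> \<Q> \<Longrightarrow> A \<subset> R \<Longrightarrow> l A \<le> \<rho> * l R"
    and rho: "0 \<le> \<rho>" "\<rho> < 1"
    and R: "R \<in> \<Q>"
  shows "(\<Sum>A\<in>{A \<in> \<Q>. A \<subseteq> R}. l A * h A) \<le> l R * h R / (1 - \<rho>)"
  using R
proof (induction "card {A \<in> \<Q>. A \<subseteq> R}" arbitrary: R rule: less_induct)
  case (less R)
  note fin = laminarD(1)[OF lam]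
  \<comment> \<open>The children of \<open>R\<close>: by maximality and laminarity they are
    disjoint, and every strict subcube of \<open>R\<close> lies below one of them.\<close>
  define \<P> where "\<P> = {A \<in> \<Q>. A \<subset> R \<and> (\<forall>B\<in>\<Q>. A \<subset> B \<longrightarrow> \<not> B \<subset> R)}"
  have P: "\<P> \<subseteq> \<Q>" "finite \<P>" "R \<notin> \<P>" using fin by (auto simp: \<P>_def)
  have disj: "disjoint \<P>"
  proof (rule disjointI)
    fix A B assume AB: "A \<in> \<P>" "B \<in> \<P>" "A \<noteq> B"
    then show "A \<inter> B = {}"
      using laminarD(3)[OF lam, of A B] unfolding \<P>_def by blast
  qed
  have maximal: "\<exists>A\<in>\<P>. B \<subseteq> A" if "B \<in> \<Q>" "B \<subset> R" for B
  proof -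
    have "finite {A \<in> \<Q>. A \<subset> R}" "B \<in> {A \<in> \<Q>. A \<subset> R}" using that fin by auto
    from finite_has_maximal2[OF this] obtain m where m: "m \<in> {A \<in> \<Q>. A \<subset> R}" "B \<subseteq> m"
      "\<forall>b\<in>{A \<in> \<Q>. A \<subset> R}. m \<subseteq> b \<longrightarrow> m = b" by auto
    have "m \<in> \<P>" unfolding \<P>_def
    proof (intro CollectI conjI ballI impI notI)
      fix C assume "C \<in> \<Q>" "m \<subset> C" "C \<subset> R"
      then show False using m(3) by auto
    qed (use m(1) in auto)
    then show ?thesis using m(2) by auto
  qed
  have eq: "{A \<in> \<Q>. A \<subseteq> R} = insert R (\<Union>B\<in>\<P>. {A \<in> \<Q>. A \<subseteq> B})"
  proof (intro equalityI subsetI)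
    fix A assume A: "A \<in> {A \<in> \<Q>. A \<subseteq> R}"
    show "A \<in> insert R (\<Union>B\<in>\<P>. {A \<in> \<Q>. A \<subseteq> B})"
    proof (cases "A = R")
      case False
      then have "A \<in> \<Q>" "A \<subset> R" using A by auto
      from maximal[OF this] this show ?thesis by auto
    qed simp
  next
    fix A assume "A \<in> insert R (\<Union>B\<in>\<P>. {A \<in> \<Q>. A \<subseteq> B})"
    then show "A \<in> {A \<in> \<Q>. A \<subseteq> R}"
      using less.prems by (auto simp: \<P>_def)
  qed
  have notin: "R \<notin> (\<Union>B\<in>\<P>. {A \<in> \<Q>. A \<subseteq> B})" by (auto simp: \<P>_def)
  have card: "card {A \<in> \<Q>. A \<subseteq> B} < card {A \<in> \<Q>. A \<subseteq> R}" if "B \<in> \<P>" for B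
    using that less.prems fin by (intro psubset_card_mono) (auto simp: \<P>_def)
  have "(\<Sum>A\<in>{A \<in> \<Q>. A \<subseteq> R}. l A * h A)
      = l R * h R + (\<Sum>A\<in>(\<Union>B\<in>\<P>. {A \<in> \<Q>. A \<subseteq> B}). l A * h A)"
  proof -
    have "finite (\<Union>B\<in>\<P>. {A \<in> \<Q>. A \<subseteq> B})" using fin P by auto
    then show ?thesis unfolding eq using notin by (rule sum.insert)
  qed
  also have "(\<Sum>A\<in>(\<Union>B\<in>\<P>. {A \<in> \<Q>. A \<subseteq> B}). l A * h A) = (\<Sum>B\<in>\<P>. \<Sum>A\<in>{A \<in> \<Q>. A \<subseteq> B}. l A * h A)"
  proof (rule sum.UNION_disjoint)
    show "\<forall>i\<in>\<P>. \<forall>j\<in>\<P>. i \<noteq> j \<longrightarrow> {A \<in> \<Q>. A \<subseteq> i} \<inter> {A \<in> \<Q>. A \<subseteq> j} = {}"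
    proof (intro ballI impI)
      fix i j assume ij: "i \<in> \<P>" "j \<in> \<P>" "i \<noteq> j"
      have "i \<inter> j = {}" using disj ij by (auto simp: disjoint_def)
      then have "A = {}" if "A \<subseteq> i" "A \<subseteq> j" for A using that by blast
      then show "{A \<in> \<Q>. A \<subseteq> i} \<inter> {A \<in> \<Q>. A \<subseteq> j} = {}"
        using laminarD(2)[OF lam] by auto
    qed
  qed (use P fin in auto)
  also have "\<dots> \<le> (\<Sum>B\<in>\<P>. l B * h B / (1 - \<rho>))"
    using P card by (intro sum_mono less.hyps) auto
  also have "\<dots> \<le> (\<Sum>B\<in>\<P>. \<rho> * l R * h B / (1 - \<rho>))"
    using P rho less.prems h0 decay[OF _ less.prems]
    by (intro sum_mono divide_right_mono mult_right_mono) (auto simp: \<P>_def)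
  also have "\<dots> = \<rho> * l R / (1 - \<rho>) * sum h \<P>"
    by (simp add: sum_distrib_left)
  also have "\<dots> \<le> \<rho> * l R / (1 - \<rho>) * h R"
    using less.prems P disj rho l0 by (intro mult_left_mono super) (auto simp: \<P>_def)
  also have "l R * h R + \<rho> * l R / (1 - \<rho>) * h R = l R * h R / (1 - \<rho>)"
    using rho by (simp add: field_simps)
  finally show ?case by simp
qed

section \<open>Running maxima and Doob's inequality on a laminar family\<close>

text \<open>The inserted 0 gives the empty family the value 0, so telescoped sums have no boundary
  term. With averages for \<open>F\<close>, the peak over the cubes through a point is the maximal
  function of the family.\<close>

definition peak :: "('a set \<Rightarrow> real) \<Rightarrow> 'a set set \<Rightarrow> real" where
  "peak F A = Max (insert 0 (F ` A))"

lemma peak_empty [simp]: "peak F {} = 0" by (simp add: peak_def)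

lemma peak_nonneg: "finite A \<Longrightarrow> 0 \<le> peak F A"
  by (simp add: peak_def)

lemma peak_mono: "finite B \<Longrightarrow> A \<subseteq> B \<Longrightarrow> peak F A \<le> peak F B"
  unfolding peak_def by (intro Max_mono) auto

lemma peak_upper: "finite A \<Longrightarrow> Q \<in> A \<Longrightarrow> F Q \<le> peak F A"
  unfolding peak_def by (intro Max_ge) auto

lemma peak_step:
  assumes "finite \<Q>" "Q \<in> \<Q>"
  shows "peak F {S \<in> \<Q>. Q \<subseteq> S} = max (F Q) (peak F {S \<in> \<Q>. Q \<subset> S})"
proof -
  have eq: "insert 0 (F ` {S \<in> \<Q>. Q \<subseteq> S}) = insert (F Q) (insert 0 (F ` {S \<in> \<Q>. Q \<subset> S}))"
    using assms by auto
  show ?thesis unfolding peak_def eq using assms by (subst Max_insert) auto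
qed

lemma increment_peak_nonneg:
  assumes "finite \<Q>" "0 \<le> a"
  shows "0 \<le> increment (\<lambda>A. peak F A powr a) \<Q> Q"
  unfolding increment_def using assms
  by (auto intro!: powr_mono2 peak_mono peak_nonneg)

lemma powr_diff_le:
  fixes a b :: real
  assumes "0 \<le> a" "a \<le> b" "1 \<le> s"
  shows "(b - a) powr s \<le> b powr s - a powr s"
proof (cases "b = 0 \<or> s = 1")
  case True
  then show ?thesis using assms by auto
next
  case False
  then have b: "0 < b" using assms by auto
  have "b - a = b * (1 - a / b)" "a = b * (a / b)" using b by (simp_all add: field_simps)
  then have "(b - a) powr s + a powr s = b powr s * ((1 - a / b) powr s + (a / b) powr s)"
    by (metis powr_mult distrib_left)
  also have "(1 - a / b) powr s \<le> (1 - a / b) powr 1" using assms b by (intro powr_mono') auto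
  also have "(a / b) powr s \<le> (a / b) powr 1" using assms b by (intro powr_mono') auto
  also have "b powr s * ((1 - a / b) powr 1 + (a / b) powr 1) = b powr s" using assms b by simp
  finally show ?thesis by (simp add: mult_left_mono)
qed

text \<open>Young's inequality for \<open>a powr (p - 1) * b\<close>. In the application
  \<open>b\<close> is a new maximum, hence an average, so that \<open>b\<close> times the mass of
  the cube is an integral of \<open>f\<close>.\<close>

lemma conj_powr_increment:
  fixes a b :: real
  assumes "0 \<le> a" "0 \<le> b" "1 < p" "1 < p'" "1 / p + 1 / p' = 1"
  shows "b powr p - a powr p \<le> p' * (b powr (p - 1) - a powr (p - 1)) * b"
proof -
  have "a powr (p - 1) * b \<le> (a powr (p - 1)) powr p' / p' + b powr p / p"
    using assms Youngs_inequality[of p' p "a powr (p - 1)" b] by (simp add: add.commute)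
  moreover have "(p - 1) * p' = p" using assms by (simp add: field_simps)
  ultimately have "p' * (a powr (p - 1) * b) \<le> a powr p + p' / p * b powr p"
    using assms by (simp add: powr_powr field_simps)
  also have "p' / p = p' - 1" using assms by (simp add: field_simps)
  finally have "p' * (a powr (p - 1) * b) \<le> a powr p + (p' - 1) * b powr p" .
  moreover have "b powr (p - 1) * b = b powr p"
    using assms powr_mult_base[of b "p - 1"] by (simp add: mult.commute)
  ultimately show ?thesis by (simp add: left_diff_distrib right_diff_distrib mult.assoc)
qed

lemma powr_increment_le:
  fixes a b :: real
  assumes "0 \<le> a" "a \<le> b" "1 < s"
  shows "b powr s - a powr s \<le> s * b powr (s - 1) * (b - a)"
proof -
  define s' where "s' = s / (s - 1)"
  have s': "1 < s'" "1 / s + 1 / s' = 1" using assms by (auto simp: s'_def field_simps)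
  have "b powr (s - 1) * a \<le> (b powr (s - 1)) powr s' / s' + a powr s / s"
    using assms s' Youngs_inequality[of s' s "b powr (s - 1)" a] by (simp add: add.commute)
  moreover have "(s - 1) * s' = s" using assms by (simp add: s'_def)
  ultimately have "s * (b powr (s - 1) * a) \<le> s / s' * b powr s + a powr s"
    using assms s' by (simp add: powr_powr field_simps)
  also have "s / s' = s - 1" using assms by (simp add: s'_def field_simps)
  finally have "s * (b powr (s - 1) * a) \<le> (s - 1) * b powr s + a powr s" .
  moreover have "b powr (s - 1) * b = b powr s"
    using assms powr_mult_base[of b "s - 1"] by (simp add: mult.commute)
  ultimately show ?thesis by (simp add: left_diff_distrib right_diff_distrib mult_ac)
qed

lemma indicator_times_integrable:
  fixes f :: "'a \<Rightarrow> real"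
  assumes p: "1 < p" and Q: "Q \<in> sets N" "emeasure N Q < \<infinity>"
    and f: "f \<in> borel_measurable N" "\<And>x. 0 \<le> f x" "integrable N (\<lambda>x. f x powr p)"
  shows "integrable N (\<lambda>x. indicator Q x * f x)"
proof (rule Bochner_Integration.integrable_bound)
  show "integrable N (\<lambda>x. indicator Q x + f x powr p)" using Q f by auto
  show "AE x in N. norm (indicator Q x * f x) \<le> norm (indicator Q x + f x powr p)"
  proof (intro AE_I2)
    fix x
    have "f x \<le> 1 + f x powr p"
      using p powr_mono[of 1 p "f x"] f(2)[of x] by (cases "f x \<le> 1") (auto intro: add_increasing2)
    then show "norm (indicator Q x * f x) \<le> norm (indicator Q x + f x powr p)"
      using f(2)[of x] by (auto simp: indicator_def)
  qed
qed (use Q f in auto)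

text \<open>Telescoping at each point shows that the left side is the integral of the
  \<open>p\<close>-th power of the maximal function; it stays a sum of increments because summation
  by parts produces it in this form. The maximum can rise at \<open>Q\<close> only to the average
  \<open>F Q\<close>, so every increment is paid for by the integral of \<open>f\<close> over
  \<open>Q\<close>.\<close>

lemma Doob_laminar:
  fixes f :: "'a \<Rightarrow> real"
  assumes lam: "laminar \<Q>" and pp: "1 < p" "1 < p'" "1 / p + 1 / p' = 1"
    and Q: "\<And>Q. Q \<in> \<Q> \<Longrightarrow> Q \<in> sets N" "\<And>Q. Q \<in> \<Q> \<Longrightarrow> emeasure N Q < \<infinity>"
      "\<And>Q. Q \<in> \<Q> \<Longrightarrow> 0 < measure N Q"
    and f: "f \<in> borel_measurable N" "\<And>x. 0 \<le> f x" "integrable N (\<lambda>x. f x powr p)"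
  defines "F \<equiv> \<lambda>Q. (\<integral>x. indicator Q x * f x \<partial>N) / measure N Q"
  shows "(\<Sum>Q\<in>\<Q>. increment (\<lambda>A. peak F A powr p) \<Q> Q * measure N Q)
    \<le> 2 * (p' * (2 * p') powr (p - 1)) * (\<integral>x. f x powr p \<partial>N)"
proof -
  note fin = laminarD(1)[OF lam]
  let ?i1 = "increment (\<lambda>A. peak F A powr (p - 1)) \<Q>"
  let ?ip = "increment (\<lambda>A. peak F A powr p) \<Q>"
  let ?C = "p' * (2 * p') powr (p - 1)"
  define Z where "Z = (\<Sum>Q\<in>\<Q>. ?ip Q * measure N Q)"
  define m where "m x = peak F {Q \<in> \<Q>. x \<in> Q}" for x
  have m0: "0 \<le> m x" for x unfolding m_def using fin by (intro peak_nonneg) auto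
  have int_ind: "integrable N (indicator Q :: 'a \<Rightarrow> real)" if "Q \<in> \<Q>" for Q
    using Q that by simp
  have int_f: "integrable N (\<lambda>x. indicator Q x * f x)" if "Q \<in> \<Q>" for Q
    using pp(1) Q(1,2)[OF that] f by (rule indicator_times_integrable)
  have step: "?ip Q * measure N Q \<le> p' * ?i1 Q * (\<integral>x. indicator Q x * f x \<partial>N)" if "Q \<in> \<Q>" for Q
  proof -
    define a b where "a = peak F {S \<in> \<Q>. Q \<subset> S}" and "b = peak F {S \<in> \<Q>. Q \<subseteq> S}"
    have ab: "b = max (F Q) a" unfolding a_def b_def by (rule peak_step[OF fin that])
    have a0: "0 \<le> a" unfolding a_def using fin by (intro peak_nonneg) auto
    show ?thesis
    proof (cases "F Q \<le> a")
      case True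
      then have "b = a" using ab by simp
      then show ?thesis by (simp add: increment_def flip: a_def b_def)
    next
      case False
      then have b: "b = F Q" using ab by simp
      have "(b powr p - a powr p) * measure N Q
          \<le> p' * (b powr (p - 1) - a powr (p - 1)) * b * measure N Q"
        using a0 ab pp by (intro mult_right_mono conj_powr_increment) auto
      also have "\<dots> = p' * (b powr (p - 1) - a powr (p - 1)) * (\<integral>x. indicator Q x * f x \<partial>N)"
        using Q(3)[OF that] by (simp add: b F_def)
      finally show ?thesis by (simp add: increment_def flip: a_def b_def)
    qed
  qed
  have tele: "(\<Sum>Q\<in>\<Q>. increment (\<lambda>A. peak F A powr e) \<Q> Q * indicator Q x) = m x powr e" for x e
  proof -
    have "(\<Sum>Q\<in>\<Q>. increment (\<lambda>A. peak F A powr e) \<Q> Q * indicator Q x)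
        = (\<Sum>Q\<in>\<Q>. if x \<in> Q then increment (\<lambda>A. peak F A powr e) \<Q> Q else 0)"
      by (intro sum.cong) (auto simp: indicator_def)
    also have "\<dots> = (\<Sum>Q\<in>{Q \<in> \<Q>. x \<in> Q}. increment (\<lambda>A. peak F A powr e) \<Q> Q)"
      using fin by (simp add: sum.inter_filter)
    also have "\<dots> = m x powr e" by (simp add: point_telescope[OF lam] m_def)
    finally show ?thesis .
  qed
  \<comment> \<open>Beyond the threshold \<open>2 * p' * f x\<close> the term is at most half of
    \<open>m x powr p\<close>, which can be absorbed; up to the threshold, \<open>m x\<close> is
    replaced by it and \<open>(2 * p') powr (p - 1)\<close> enters the constant.\<close>
  have young: "p' * m x powr (p - 1) * f x \<le> ?C * f x powr p + m x powr p / 2" for x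
  proof (cases "m x \<le> 2 * p' * f x")
    case True
    have "p' * m x powr (p - 1) * f x \<le> p' * (2 * p' * f x) powr (p - 1) * f x"
      using True m0 pp f(2) by (intro mult_right_mono mult_left_mono powr_mono2) auto
    also have "\<dots> = ?C * (f x * f x powr (p - 1))" by (simp add: powr_mult)
    also have "f x * f x powr (p - 1) = f x powr p" using f(2) by (simp add: powr_mult_base)
    finally show ?thesis using m0[of x] by (simp add: add_increasing2)
  next
    case False
    then have "m x powr (p - 1) * (p' * f x) \<le> m x powr (p - 1) * (m x / 2)"
      by (intro mult_left_mono) auto
    also have "\<dots> = m x * m x powr (p - 1) / 2" by simp
    also have "\<dots> = m x powr p / 2" using m0 by (simp add: powr_mult_base)
    finally have "p' * m x powr (p - 1) * f x \<le> m x powr p / 2" by (simp add: mult_ac)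
    moreover have "0 \<le> ?C * f x powr p" using pp f(2) by simp
    ultimately show ?thesis by linarith
  qed
  have "Z \<le> (\<Sum>Q\<in>\<Q>. p' * ?i1 Q * (\<integral>x. indicator Q x * f x \<partial>N))"
    unfolding Z_def by (intro sum_mono step)
  also have "\<dots> = (\<integral>x. (\<Sum>Q\<in>\<Q>. p' * ?i1 Q * (indicator Q x * f x)) \<partial>N)"
    using int_f by (subst Bochner_Integration.integral_sum) auto
  also have "\<dots> \<le> (\<integral>x. ?C * f x powr p + (\<Sum>Q\<in>\<Q>. ?ip Q * indicator Q x) / 2 \<partial>N)"
  proof (rule integral_mono)
    show "integrable N (\<lambda>x. \<Sum>Q\<in>\<Q>. p' * ?i1 Q * (indicator Q x * f x))" using int_f by auto
    show "integrable N (\<lambda>x. ?C * f x powr p + (\<Sum>Q\<in>\<Q>. ?ip Q * indicator Q x) / 2)"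
      using int_ind f by (intro Bochner_Integration.integrable_add integrable_mult_right
          integrable_divide Bochner_Integration.integrable_sum) auto
    fix x
    have "(\<Sum>Q\<in>\<Q>. p' * ?i1 Q * (indicator Q x * f x)) = p' * (\<Sum>Q\<in>\<Q>. ?i1 Q * indicator Q x) * f x"
      by (simp add: sum_distrib_left sum_distrib_right mult_ac)
    then show "(\<Sum>Q\<in>\<Q>. p' * ?i1 Q * (indicator Q x * f x))
        \<le> ?C * f x powr p + (\<Sum>Q\<in>\<Q>. ?ip Q * indicator Q x) / 2"
      using young[of x] by (simp add: tele)
  qed
  also have "\<dots> = ?C * (\<integral>x. f x powr p \<partial>N) + (\<Sum>Q\<in>\<Q>. ?ip Q * measure N Q) / 2"
  proof -
    have "(\<integral>x. (\<Sum>Q\<in>\<Q>. ?ip Q * indicator Q x) / 2 \<partial>N) = (\<Sum>Q\<in>\<Q>. ?ip Q * measure N Q) / 2"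
      using int_ind Q by (simp add: Bochner_Integration.integral_sum)
    then show ?thesis
      using int_ind f by (subst Bochner_Integration.integral_add) auto
  qed
  \<comment> \<open>\<open>Z\<close> is a finite sum of real numbers, so half of it may be
    subtracted. This doubles the constant.\<close>
  finally have "Z \<le> ?C * (\<integral>x. f x powr p \<partial>N) + Z / 2" by (simp add: Z_def)
  then show ?thesis by (simp add: Z_def)
qed

section \<open>The bilinear form at a fixed level\<close>

text \<open>A geometric series of ratio \<open>(1 - \<tau>) powr e\<close> thus costs only the first
  power of \<open>1 / \<tau>\<close>, whatever \<open>e\<close> is. With \<open>\<tau>\<close> a
  power of \<open>1 / B\<close>, this fixes the power of \<open>B\<close> in the final
  bound.\<close>

lemma one_minus_powr_ge:
  fixes \<tau> e :: real
  assumes "0 < \<tau>" "\<tau> < 1" "0 < e"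
  shows "min 1 e * \<tau> \<le> 1 - (1 - \<tau>) powr e"
proof (cases "1 \<le> e")
  case True
  have "(1 - \<tau>) powr e \<le> (1 - \<tau>) powr 1" using assms True by (intro powr_mono') auto
  then show ?thesis using assms True by (simp add: min_def)
next
  case False
  have "(1 - \<tau>) powr e * 1 powr (1 - e) \<le> e * (1 - \<tau>) + (1 - e) * 1"
    using assms False by (intro Youngs_inequality_0) auto
  then show ?thesis using False by (simp add: min_def algebra_simps)
qed

text \<open>Off the diagonal (\<open>q' < p'\<close>) the Carleson sum \<open>\<Sum> U\<^sup>s\<close> with \<open>s = p' / q' > 1\<close> converges for
  all cubes of the family, with no sparseness, as soon as \<open>U\<close> loses a fixed proportion at each
  strict inclusion.\<close>

lemma (in exponents) half_bilinear:
  fixes S U F G :: "'a set \<Rightarrow> real"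
  assumes lam: "laminar \<Q>"
    and pos: "\<And>A. A \<in> \<Q> \<Longrightarrow> 0 < S A" "\<And>A. A \<in> \<Q> \<Longrightarrow> 0 < U A"
    and super: "\<And>R \<P>. R \<in> \<Q> \<Longrightarrow> \<P> \<subseteq> \<Q> \<Longrightarrow> disjoint \<P> \<Longrightarrow> (\<And>A. A \<in> \<P> \<Longrightarrow> A \<subseteq> R) \<Longrightarrow> sum U \<P> \<le> U R"
    and decay: "\<And>A R. A \<in> \<Q> \<Longrightarrow> R \<in> \<Q> \<Longrightarrow> A \<subset> R \<Longrightarrow> U A \<le> (1 - \<tau>) * U R"
    and tau: "0 < \<tau>" "\<tau> < 1" and K: "0 < K"
    and dF: "(\<Sum>Q\<in>\<Q>. increment (\<lambda>A. peak F A powr p) \<Q> Q * S Q) \<le> K"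
    and dG: "(\<Sum>Q\<in>\<Q>. increment (\<lambda>A. peak G A powr q') \<Q> Q * U Q) \<le> K"
  shows "(\<Sum>Q\<in>\<Q>. (increment (peak F) \<Q> Q * S Q powr (1 / p)) * (U Q powr (1 / q') * peak G (above \<Q> Q)))
    \<le> K powr (1 / p) * (p' / q' * K powr (p' / q') / (min 1 (p' / q' - 1) * \<tau>)) powr (1 / p')"
proof (rule sum_Holder_le)
  note fin = laminarD(1)[OF lam]
  define s where "s = p' / q'"
  have s1: "1 < s" using exponents.p_less_q[OF dual] q'_gt_1 by (simp add: s_def)
  have inc0: "0 \<le> increment (peak H) \<Q> Q" for H Q
    using fin by (auto simp: increment_def intro!: peak_mono)
  have pk0: "0 \<le> peak H (above \<Q> Q)" for H Q
    using fin by (auto simp: above_def intro!: peak_nonneg)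
  show "finite \<Q>" by (rule fin)
  show "1 < p" "1 < p'" "1 / p + 1 / p' = 1" using p_gt_1 p'_gt_1 conj_p by auto
  show "0 < K" by (rule K)
  show "0 \<le> increment (peak F) \<Q> Q * S Q powr (1 / p)" for Q using inc0 by simp
  show "0 \<le> U Q powr (1 / q') * peak G (above \<Q> Q)" for Q using pk0 by simp
  show "0 < p' / q' * K powr (p' / q') / (min 1 (p' / q' - 1) * \<tau>)"
    using s1 tau K by (simp add: s_def[symmetric])
  have "(\<Sum>Q\<in>\<Q>. (increment (peak F) \<Q> Q * S Q powr (1 / p)) powr p)
      \<le> (\<Sum>Q\<in>\<Q>. increment (\<lambda>A. peak F A powr p) \<Q> Q * S Q)"
  proof (rule sum_mono)
    fix Q assume Q: "Q \<in> \<Q>"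
    have "(increment (peak F) \<Q> Q) powr p \<le> increment (\<lambda>A. peak F A powr p) \<Q> Q"
      unfolding increment_def using fin p_gt_1
      by (intro powr_diff_le peak_nonneg peak_mono) auto
    then have "(increment (peak F) \<Q> Q) powr p * S Q \<le> increment (\<lambda>A. peak F A powr p) \<Q> Q * S Q"
      using pos(1)[OF Q] by (intro mult_right_mono) auto
    then show "(increment (peak F) \<Q> Q * S Q powr (1 / p)) powr p
        \<le> increment (\<lambda>A. peak F A powr p) \<Q> Q * S Q"
      using pos(1)[OF Q] p_gt_1 by (simp add: powr_mult powr_powr)
  qed
  then show "(\<Sum>Q\<in>\<Q>. (increment (peak F) \<Q> Q * S Q powr (1 / p)) powr p) \<le> K"
    using dF by linarith
  let ?\<rho> = "(1 - \<tau>) powr (s - 1)"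
  let ?iq = "increment (\<lambda>A. peak G A powr q') \<Q>"
  let ?ip = "increment (\<lambda>A. peak G A powr p') \<Q>"
  have iq0: "0 \<le> ?iq Q" and ip0: "0 \<le> ?ip Q" for Q
    using fin q'_gt_1 p'_gt_1 by (auto intro!: increment_peak_nonneg)
  have rho: "min 1 (s - 1) * \<tau> \<le> 1 - ?\<rho>" using tau s1 by (intro one_minus_powr_ge) auto
  have rho0: "0 < min 1 (s - 1) * \<tau>" using tau s1 by auto
  have mono: "U A \<le> U R" if "A \<in> \<Q>" "R \<in> \<Q>" "A \<subseteq> R" for A R
    using super[of R "{A}"] that by (auto simp: disjoint_def)
  have Us: "U Q powr (s - 1) * U Q = U Q powr s" if "Q \<in> \<Q>" for Q
    using pos(2)[OF that] by (simp add: powr_mult_base mult.commute)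
  \<comment> \<open>Here \<open>U powr s\<close> is split into \<open>U powr (s - 1)\<close>, which
    decays by a fixed ratio at each inclusion, and \<open>U\<close>, which is superadditive.\<close>
  have carl: "(\<Sum>Q\<in>{Q \<in> \<Q>. Q \<subseteq> R}. U Q powr s) \<le> U R powr s / (min 1 (s - 1) * \<tau>)" if R: "R \<in> \<Q>" for R
  proof -
    have "(\<Sum>Q\<in>{Q \<in> \<Q>. Q \<subseteq> R}. U Q powr s) = (\<Sum>Q\<in>{Q \<in> \<Q>. Q \<subseteq> R}. U Q powr (s - 1) * U Q)"
      by (intro sum.cong) (auto simp: Us)
    also have "\<dots> \<le> U R powr (s - 1) * U R / (1 - ?\<rho>)"
    proof (rule laminar_sum_le[OF lam _ _ super _ _ _ R])
      fix A R assume "A \<in> \<Q>" "R \<in> \<Q>" "A \<subset> R"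
      then have "U A powr (s - 1) \<le> ((1 - \<tau>) * U R) powr (s - 1)"
        using decay pos s1 by (intro powr_mono2) (auto simp: less_imp_le)
      then show "U A powr (s - 1) \<le> ?\<rho> * U R powr (s - 1)" by (simp add: powr_mult)
    qed (use pos rho rho0 in \<open>auto simp: less_imp_le\<close>)
    also have "\<dots> \<le> U R powr (s - 1) * U R / (min 1 (s - 1) * \<tau>)"
      using rho less_le_trans[OF rho0 rho] rho0 pos(2)[OF R] by (intro divide_left_mono mult_pos_pos[of "min 1 (s - 1) * \<tau>"]) auto
    finally show ?thesis by (simp add: Us[OF R])
  qed
  \<comment> \<open>A weak-type bound: the ancestors of \<open>R\<close> have at least the mass of
    \<open>R\<close>, so each increment above \<open>R\<close> may be weighted with its own mass,
    and the sum is part of \<open>dG\<close>.\<close>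
  have bU: "peak G {S \<in> \<Q>. R \<subseteq> S} powr q' * U R \<le> K" if R: "R \<in> \<Q>" for R
  proof -
    have "peak G {S \<in> \<Q>. R \<subseteq> S} powr q' * U R = (\<Sum>Q\<in>above \<Q> R. ?iq Q * U R)"
      using above_telescope[OF lam R, of "\<lambda>A. peak G A powr q'"]
      by (simp add: sum_distrib_right[symmetric] above_def)
    also have "\<dots> \<le> (\<Sum>Q\<in>above \<Q> R. ?iq Q * U Q)"
      using iq0 mono R by (intro sum_mono mult_left_mono) (auto simp: above_def)
    also have "\<dots> \<le> (\<Sum>Q\<in>\<Q>. ?iq Q * U Q)"
      using iq0 pos fin by (intro sum_mono2) (auto simp: above_def less_imp_le)
    finally show ?thesis using dG by simp
  qed
  \<comment> \<open>The exponent is raised from \<open>q'\<close> to \<open>p' = s * q'\<close>; the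
    surplus power is controlled by the weak-type bound, at the price of
    \<open>K powr (s - 1)\<close>.\<close>
  have incs: "?ip R * U R powr s \<le> s * K powr (s - 1) * (?iq R * U R)" if R: "R \<in> \<Q>" for R
  proof -
    define a b where "a = peak G {S \<in> \<Q>. R \<subset> S} powr q'" and "b = peak G {S \<in> \<Q>. R \<subseteq> S} powr q'"
    have ab: "0 \<le> a" "a \<le> b" unfolding a_def b_def using fin q'_gt_1
      by (auto intro!: powr_mono2 peak_mono peak_nonneg)
    have "?ip R = b powr s - a powr s"
      using q'_gt_1 by (simp add: increment_def a_def b_def powr_powr s_def)
    also have "\<dots> \<le> s * b powr (s - 1) * (b - a)" by (rule powr_increment_le[OF ab s1])
    finally have "?ip R * U R powr s \<le> s * b powr (s - 1) * (b - a) * U R powr s"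
      by (rule mult_right_mono) simp
    also have "\<dots> = s * (b * U R) powr (s - 1) * ((b - a) * U R)"
      unfolding Us[OF R, symmetric] by (simp add: powr_mult mult_ac)
    also have "\<dots> \<le> s * K powr (s - 1) * ((b - a) * U R)"
      using bU[OF R] ab s1 pos(2)[OF R]
      by (intro mult_right_mono mult_left_mono powr_mono2) (auto simp: b_def)
    also have "b - a = ?iq R" by (simp add: a_def b_def increment_def)
    finally show ?thesis .
  qed
  have "(\<Sum>Q\<in>\<Q>. (U Q powr (1 / q') * peak G (above \<Q> Q)) powr p')
      = (\<Sum>Q\<in>\<Q>. U Q powr s * (\<Sum>R\<in>above \<Q> Q. ?ip R))"
    using above_telescope[OF lam, of _ "\<lambda>A. peak G A powr p'"]
    by (intro sum.cong) (auto simp: powr_mult powr_powr s_def)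
  also have "\<dots> = (\<Sum>R\<in>\<Q>. ?ip R * (\<Sum>Q\<in>{Q \<in> \<Q>. Q \<subseteq> R}. U Q powr s))"
    by (rule sum_above_swap[OF fin])
  also have "\<dots> \<le> (\<Sum>R\<in>\<Q>. ?ip R * (U R powr s / (min 1 (s - 1) * \<tau>)))"
    using carl ip0 by (intro sum_mono mult_left_mono) auto
  also have "\<dots> \<le> (\<Sum>R\<in>\<Q>. s * K powr (s - 1) * (?iq R * U R) / (min 1 (s - 1) * \<tau>))"
    using incs rho0 by (intro sum_mono) (simp add: divide_right_mono)
  also have "\<dots> = s * K powr (s - 1) / (min 1 (s - 1) * \<tau>) * (\<Sum>R\<in>\<Q>. ?iq R * U R)"
    by (simp add: sum_distrib_left)
  also have "\<dots> \<le> s * K powr (s - 1) / (min 1 (s - 1) * \<tau>) * K"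
    using dG rho0 s1 by (intro mult_left_mono) auto
  also have "\<dots> = s * (K * K powr (s - 1)) / (min 1 (s - 1) * \<tau>)" by simp
  also have "K * K powr (s - 1) = K powr s" using K by (simp add: powr_mult_base)
  finally show "(\<Sum>Q\<in>\<Q>. (U Q powr (1 / q') * peak G (above \<Q> Q)) powr p')
      \<le> p' / q' * K powr (p' / q') / (min 1 (p' / q' - 1) * \<tau>)" by (simp add: s_def)
qed

text \<open>A subset of half the length carries a proportion \<open>B powr - q\<close> of \<open>U\<close>: this is where cubes
  at a common level \<open>B\<close> of the Muckenhoupt quotient are needed.\<close>

lemma (in exponents) level_decay:
  fixes len S U :: "'a set \<Rightarrow> real"
  assumes "0 < U A" "U A \<le> U R" "0 < S A" "S A \<le> S R" "0 < len A" "len A \<le> len R / 2" "1 \<le> B"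
    and up: "S R powr (1 / p') * U R powr (1 / q) \<le> 2 * B * len R powr (1 - \<alpha>)"
    and comp: "(len R - len A) powr (1 - \<alpha>) \<le> (U R - U A) powr (1 / q) * (S R - S A) powr (1 / p')"
  shows "U A \<le> (1 - (4 * B) powr - q) * U R"
proof -
  have pos: "0 < U R" "0 < S R" "0 < len R" using assms by auto
  have q0: "0 < q" "0 < p'" using q_gt_1 p'_gt_1 by auto
  have "U R powr (1 / q) * S R powr (1 / p') \<le> 2 * B * len R powr (1 - \<alpha>)"
    using up by (simp add: mult.commute)
  \<comment> \<open>At most half of \<open>R\<close> is removed, so \<open>len R / 2\<close> is at
    most the length that remains, and \<open>2 powr (1 - \<alpha>) \<le> 2\<close> turns
    \<open>2 * B\<close> into \<open>4 * B\<close>.\<close>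
  also have "len R powr (1 - \<alpha>) = 2 powr (1 - \<alpha>) * (len R / 2) powr (1 - \<alpha>)"
    by (simp add: powr_divide)
  also have "2 * B * (2 powr (1 - \<alpha>) * (len R / 2) powr (1 - \<alpha>)) \<le> 2 * B * (2 powr 1 * (len R - len A) powr (1 - \<alpha>))"
    using assms alpha_pos alpha_less_1 pos by (intro mult_left_mono mult_mono powr_mono powr_mono2) auto
  also have "\<dots> = 4 * B * (len R - len A) powr (1 - \<alpha>)" by simp
  also have "\<dots> \<le> 4 * B * ((U R - U A) powr (1 / q) * S R powr (1 / p'))"
  proof -
    have "(S R - S A) powr (1 / p') \<le> S R powr (1 / p')"
      using assms q0 by (intro powr_mono2) auto
    then have "(U R - U A) powr (1 / q) * (S R - S A) powr (1 / p') \<le> (U R - U A) powr (1 / q) * S R powr (1 / p')"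
      by (intro mult_left_mono) auto
    then show ?thesis using comp assms by (intro mult_left_mono) auto
  qed
  finally have "U R powr (1 / q) * S R powr (1 / p') \<le> (4 * B * (U R - U A) powr (1 / q)) * S R powr (1 / p')"
    by (simp add: mult_ac)
  then have "U R powr (1 / q) \<le> 4 * B * (U R - U A) powr (1 / q)"
    using pos by simp
  then have "(U R powr (1 / q)) powr q \<le> (4 * B * (U R - U A) powr (1 / q)) powr q"
    using q0 by (intro powr_mono2) auto
  then have "U R \<le> (4 * B) powr q * (U R - U A)"
    using pos q0 assms unfolding powr_mult powr_powr by (simp add: powr_mult)
  then have "(4 * B) powr - q * U R \<le> (4 * B) powr - q * ((4 * B) powr q * (U R - U A))"
    by (intro mult_left_mono) auto
  also have "\<dots> = U R - U A" using assms by (simp add: mult.assoc[symmetric] powr_add[symmetric])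
  finally show ?thesis by (simp add: algebra_simps)
qed

text \<open>The quotient containing \<open>\<eta>\<close> is the geometric constant of the sums over
  subcubes. The two summands belong to the two halves of the product rule; the powers of 4 come from
  the \<open>4 * B\<close> of the mass decay once the power of \<open>B\<close> has been split
  off.\<close>

definition (in exponents) level_const :: "real \<Rightarrow> real" where
  "level_const K =
    (let \<eta> = min (\<alpha> / (1 - \<alpha>)) (min (p' / p) (q - 1)) in
     2 * (2 powr \<eta> / (1 - (1 / 2) powr ((1 - \<alpha>) * \<eta>))) *
     (K powr (1 / p) * (p' / q' * K powr (p' / q') / min 1 (p' / q' - 1)) powr (1 / p') * 4 powr (q / p') +
      K powr (1 / q') * (q / p * K powr (q / p) / min 1 (q / p - 1)) powr (1 / q) * 4 powr (p' / q)))"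

text \<open>At level \<open>B\<close> the kernel is at most \<open>2 * B\<close> divided by
  \<open>S powr (1 / p') * U powr (1 / q)\<close>, which leaves the weight
  \<open>\<mu> = S powr (1 / p) * U powr (1 / q')\<close>. With averages replaced by running maxima,
  summation by parts collects \<open>\<mu>\<close> over the subcubes of each \<open>R\<close>, where
  it is comparable to \<open>\<mu> R\<close>. The product rule then separates increments of
  \<open>F\<close> from increments of \<open>G\<close>.\<close>

lemma (in exponents) level_bilinear:
  fixes len S U F G :: "'a set \<Rightarrow> real"
  assumes lam: "laminar \<Q>"
    and pos: "\<And>A. A \<in> \<Q> \<Longrightarrow> 0 < S A" "\<And>A. A \<in> \<Q> \<Longrightarrow> 0 < U A" "\<And>A. A \<in> \<Q> \<Longrightarrow> 0 < len A"
    and superS: "\<And>R \<P>. R \<in> \<Q> \<Longrightarrow> \<P> \<subseteq> \<Q> \<Longrightarrow> disjoint \<P> \<Longrightarrow> (\<And>A. A \<in> \<P> \<Longrightarrow> A \<subseteq> R) \<Longrightarrow> sum S \<P> \<le> S R"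
    and superU: "\<And>R \<P>. R \<in> \<Q> \<Longrightarrow> \<P> \<subseteq> \<Q> \<Longrightarrow> disjoint \<P> \<Longrightarrow> (\<And>A. A \<in> \<P> \<Longrightarrow> A \<subseteq> R) \<Longrightarrow> sum U \<P> \<le> U R"
    and half: "\<And>A R. A \<in> \<Q> \<Longrightarrow> R \<in> \<Q> \<Longrightarrow> A \<subset> R \<Longrightarrow> len A \<le> len R / 2"
    and comp: "\<And>A R. A \<in> \<Q> \<Longrightarrow> R \<in> \<Q> \<Longrightarrow> A \<subset> R \<Longrightarrow>
      (len R - len A) powr (1 - \<alpha>) \<le> (U R - U A) powr (1 / q) * (S R - S A) powr (1 / p')"
    and B: "1 \<le> B"
    and low: "\<And>A. A \<in> \<Q> \<Longrightarrow> B * len A powr (1 - \<alpha>) \<le> S A powr (1 / p') * U A powr (1 / q)"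
    and up: "\<And>A. A \<in> \<Q> \<Longrightarrow> S A powr (1 / p') * U A powr (1 / q) \<le> 2 * B * len A powr (1 - \<alpha>)"
    and K: "0 < K"
    and dF: "(\<Sum>Q\<in>\<Q>. increment (\<lambda>A. peak F A powr p) \<Q> Q * S Q) \<le> K"
    and dG: "(\<Sum>Q\<in>\<Q>. increment (\<lambda>A. peak G A powr q') \<Q> Q * U Q) \<le> K"
    and FG: "\<And>A. A \<in> \<Q> \<Longrightarrow> 0 \<le> F A" "\<And>A. A \<in> \<Q> \<Longrightarrow> 0 \<le> G A"
  shows "(\<Sum>A\<in>\<Q>. len A powr (\<alpha> - 1) * (S A * F A) * (U A * G A))
    \<le> level_const K * (B powr (1 + q / p') + B powr (1 + p' / q))"
proof -
  note fin = laminarD(1)[OF lam]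
  note basic = p_gt_1 q_gt_1 p'_gt_1 q'_gt_1 alpha_pos alpha_less_1 p_less_q
  have monoS: "S A \<le> S R" if "A \<in> \<Q>" "R \<in> \<Q>" "A \<subseteq> R" for A R
    using superS[of R "{A}"] that by (auto simp: disjoint_def)
  have monoU: "U A \<le> U R" if "A \<in> \<Q>" "R \<in> \<Q>" "A \<subseteq> R" for A R
    using superU[of R "{A}"] that by (auto simp: disjoint_def)
  \<comment> \<open>The bounds \<open>p' / p\<close> and \<open>q - 1\<close> keep \<open>b\<close>
    and \<open>c\<close> below nonnegative. The bound \<open>\<alpha> / (1 - \<alpha>)\<close> gives
    \<open>b + c = 1 + \<alpha> - \<eta> * (1 - \<alpha>) \<ge> 1\<close>, as superadditivity
    requires; the gap between \<open>p\<close> and \<open>q\<close> is what leaves room for a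
    positive \<open>\<eta>\<close>.\<close>
  define \<eta> where "\<eta> = min (\<alpha> / (1 - \<alpha>)) (min (p' / p) (q - 1))"
  define b c where "b = 1 / p - \<eta> / p'" and "c = 1 / q' - \<eta> / q"
  have eta: "0 < \<eta>" "\<eta> \<le> \<alpha> / (1 - \<alpha>)" "\<eta> \<le> p' / p" "\<eta> \<le> q - 1"
    unfolding \<eta>_def using basic by auto
  have b0: "0 \<le> b" using divide_right_mono[OF eta(3), of p'] basic by (simp add: b_def)
  have c0: "0 \<le> c"
    using divide_right_mono[OF eta(4), of q] basic conj_q by (simp add: c_def diff_divide_distrib)
  have "\<eta> * (1 - \<alpha>) \<le> \<alpha> / (1 - \<alpha>) * (1 - \<alpha>)"
    using eta(2) alpha_less_1 by (intro mult_right_mono) auto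
  then have "\<eta> * (1 / q + 1 / p') \<le> \<alpha>" using alpha_less_1 by (simp add: inv_q_p')
  then have bc: "1 \<le> b + c" using inv_p_q' by (simp add: b_def c_def algebra_simps)
  let ?T = "2 powr \<eta> / (1 - (1 / 2) powr ((1 - \<alpha>) * \<eta>))"
  have rho: "(1 / 2) powr ((1 - \<alpha>) * \<eta>) < (1::real)"
    using eta alpha_less_1 powr_less_mono2[of "(1 - \<alpha>) * \<eta>" "1 / 2" 1] by simp
  have T0: "0 \<le> ?T" using rho by simp
  define \<mu> where "\<mu> A = S A powr (1 / p) * U A powr (1 / q')" for A
  have mu0: "0 \<le> \<mu> A" for A by (simp add: \<mu>_def)
  have mu_eq: "\<mu> A = (S A powr (1 / p') * U A powr (1 / q)) powr \<eta> * (S A powr b * U A powr c)" for A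
    by (simp add: \<mu>_def b_def c_def powr_mult powr_powr mult_ac powr_add[symmetric])
  \<comment> \<open>trading a small power of \<open>\<mu>\<close> for the length makes the sum over subcubes geometric\<close>
  have testing: "(\<Sum>A\<in>{A \<in> \<Q>. A \<subseteq> R}. \<mu> A) \<le> ?T * \<mu> R" if R: "R \<in> \<Q>" for R
  proof -
    define l h where "l A = (2 * B * len A powr (1 - \<alpha>)) powr \<eta>" and "h A = S A powr b * U A powr c" for A
    have "(\<Sum>A\<in>{A \<in> \<Q>. A \<subseteq> R}. \<mu> A) \<le> (\<Sum>A\<in>{A \<in> \<Q>. A \<subseteq> R}. l A * h A)"
      unfolding mu_eq l_def h_def using up eta
      by (intro sum_mono mult_right_mono powr_mono2) auto
    also have "\<dots> \<le> l R * h R / (1 - (1 / 2) powr ((1 - \<alpha>) * \<eta>))"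
    proof (rule laminar_sum_le[OF lam])
      show "sum h \<P> \<le> h R" if "R \<in> \<Q>" "\<P> \<subseteq> \<Q>" "disjoint \<P>" "\<And>A. A \<in> \<P> \<Longrightarrow> A \<subseteq> R" for R \<P>
        unfolding h_def
      proof (rule sum_powr_mult_le)
        show "sum S \<P> \<le> S R" "sum U \<P> \<le> U R" using that superS superU by auto
      qed (use that pos b0 c0 bc fin in \<open>auto intro: finite_subset\<close>)
      fix A R assume AR: "A \<in> \<Q>" "R \<in> \<Q>" "A \<subset> R"
      have "l A \<le> (2 * B * (len R / 2) powr (1 - \<alpha>)) powr \<eta>"
        unfolding l_def using half[OF AR] pos AR B eta alpha_less_1
        by (intro powr_mono2 mult_left_mono) (auto simp: less_imp_le)
      also have "\<dots> = (1 / 2) powr ((1 - \<alpha>) * \<eta>) * l R"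
        by (simp add: l_def powr_mult powr_divide powr_powr)
      finally show "l A \<le> (1 / 2) powr ((1 - \<alpha>) * \<eta>) * l R" .
    qed (use rho R in \<open>auto simp: l_def h_def\<close>)
    also have "\<dots> \<le> (2 powr \<eta> * (S R powr (1 / p') * U R powr (1 / q)) powr \<eta>) * h R / (1 - (1 / 2) powr ((1 - \<alpha>) * \<eta>))"
    proof -
      have "l R \<le> (2 * (S R powr (1 / p') * U R powr (1 / q))) powr \<eta>"
        unfolding l_def using low[OF R] eta B pos(3)[OF R] by (intro powr_mono2) auto
      then have "l R \<le> 2 powr \<eta> * (S R powr (1 / p') * U R powr (1 / q)) powr \<eta>"
        by (simp add: powr_mult)
      then show ?thesis using rho by (intro divide_right_mono mult_right_mono) (auto simp: h_def)
    qed
    also have "\<dots> = ?T * \<mu> R" by (simp add: mu_eq h_def mult_ac)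
    finally show ?thesis .
  qed
  have pk0: "0 \<le> peak H (above \<Q> Q)" for H Q
    using fin by (auto simp: above_def intro!: peak_nonneg)
  have "(\<Sum>A\<in>\<Q>. len A powr (\<alpha> - 1) * (S A * F A) * (U A * G A))
      \<le> (\<Sum>A\<in>\<Q>. 2 * B * (\<mu> A * (peak F (above \<Q> A) * peak G (above \<Q> A))))"
  proof (rule sum_mono)
    fix A assume A: "A \<in> \<Q>"
    note posA = pos(1)[OF A] pos(2)[OF A] pos(3)[OF A]
    have "S A * U A = (S A powr (1 / p') * U A powr (1 / q)) * \<mu> A"
      using posA conj_p conj_q by (simp add: \<mu>_def mult_ac powr_add[symmetric])
    also have "\<dots> \<le> (2 * B * len A powr (1 - \<alpha>)) * \<mu> A"
      using up[OF A] mu0 by (intro mult_right_mono) auto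
    finally have "len A powr (\<alpha> - 1) * (S A * U A) \<le> len A powr (\<alpha> - 1) * (2 * B * len A powr (1 - \<alpha>) * \<mu> A)"
      by (intro mult_left_mono) auto
    also have "\<dots> = 2 * B * \<mu> A * (len A powr (\<alpha> - 1) * len A powr (1 - \<alpha>))" by simp
    also have "len A powr (\<alpha> - 1) * len A powr (1 - \<alpha>) = 1" using posA by (simp add: powr_add[symmetric])
    finally have 1: "len A powr (\<alpha> - 1) * (S A * U A) \<le> 2 * B * \<mu> A" by simp
    have "F A * G A \<le> peak F (above \<Q> A) * peak G (above \<Q> A)"
      using A fin FG pk0 by (intro mult_mono peak_upper) (auto simp: above_def)
    then have "(len A powr (\<alpha> - 1) * (S A * U A)) * (F A * G A) \<le> (2 * B * \<mu> A) * (peak F (above \<Q> A) * peak G (above \<Q> A))"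
      using FG A B mu0 by (intro mult_mono[OF 1]) auto
    then show "len A powr (\<alpha> - 1) * (S A * F A) * (U A * G A) \<le> 2 * B * (\<mu> A * (peak F (above \<Q> A) * peak G (above \<Q> A)))"
      by (simp add: mult_ac)
  qed
  also have "\<dots> = 2 * B * (\<Sum>A\<in>\<Q>. \<mu> A * (\<Sum>R\<in>above \<Q> A. increment (\<lambda>A. peak F A * peak G A) \<Q> R))"
    using above_telescope[OF lam, of _ "\<lambda>A. peak F A * peak G A"]
    by (simp add: sum_distrib_left)
  also have "(\<Sum>A\<in>\<Q>. \<mu> A * (\<Sum>R\<in>above \<Q> A. increment (\<lambda>A. peak F A * peak G A) \<Q> R))
      = (\<Sum>R\<in>\<Q>. increment (\<lambda>A. peak F A * peak G A) \<Q> R * (\<Sum>A\<in>{A \<in> \<Q>. A \<subseteq> R}. \<mu> A))"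
    by (rule sum_above_swap[OF fin])
  also have "\<dots> \<le> (\<Sum>R\<in>\<Q>. ?T * ((increment (peak F) \<Q> R * S R powr (1 / p)) * (U R powr (1 / q') * peak G (above \<Q> R))
      + (increment (peak G) \<Q> R * U R powr (1 / q')) * (S R powr (1 / p) * peak F (above \<Q> R))))"
  proof (rule sum_mono)
    fix R assume R: "R \<in> \<Q>"
    define f0 f1 g0 g1 where "f0 = peak F {S \<in> \<Q>. R \<subset> S}" and "f1 = peak F {S \<in> \<Q>. R \<subseteq> S}"
      and "g0 = peak G {S \<in> \<Q>. R \<subset> S}" and "g1 = peak G {S \<in> \<Q>. R \<subseteq> S}"
    have ord: "0 \<le> f0" "f0 \<le> f1" "0 \<le> g0" "g0 \<le> g1"
      unfolding f0_def f1_def g0_def g1_def using fin by (auto intro!: peak_mono peak_nonneg)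
    have "(f1 * g1 - f0 * g0) * (\<Sum>A\<in>{A \<in> \<Q>. A \<subseteq> R}. \<mu> A) \<le> (f1 * g1 - f0 * g0) * (?T * \<mu> R)"
      using testing[OF R] ord by (intro mult_left_mono) (auto simp: mult_mono)
    \<comment> \<open>The product rule, weakened so that both increments are multiplied by new
      values: each half then has one increment and one running maximum that includes
      \<open>R\<close>.\<close>
    also have "\<dots> \<le> ((f1 - f0) * g1 + (g1 - g0) * f1) * (?T * \<mu> R)"
    proof (rule mult_right_mono)
      have "f0 * (g1 - g0) \<le> f1 * (g1 - g0)" using ord by (intro mult_right_mono) auto
      then show "f1 * g1 - f0 * g0 \<le> (f1 - f0) * g1 + (g1 - g0) * f1" by (simp add: algebra_simps)
    qed (use mult_nonneg_nonneg[OF T0 mu0] in simp)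
    also have "\<dots> = ?T * (((f1 - f0) * S R powr (1 / p)) * (U R powr (1 / q') * g1)
        + ((g1 - g0) * U R powr (1 / q')) * (S R powr (1 / p) * f1))"
      by (simp only: \<mu>_def distrib_left distrib_right mult_ac)
    finally show "increment (\<lambda>A. peak F A * peak G A) \<Q> R * (\<Sum>A\<in>{A \<in> \<Q>. A \<subseteq> R}. \<mu> A)
      \<le> ?T * ((increment (peak F) \<Q> R * S R powr (1 / p)) * (U R powr (1 / q') * peak G (above \<Q> R))
      + (increment (peak G) \<Q> R * U R powr (1 / q')) * (S R powr (1 / p) * peak F (above \<Q> R)))"
      by (simp only: increment_def above_def f0_def f1_def g0_def g1_def)
  qed
  also have "\<dots> = ?T * ((\<Sum>R\<in>\<Q>. (increment (peak F) \<Q> R * S R powr (1 / p)) * (U R powr (1 / q') * peak G (above \<Q> R)))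
      + (\<Sum>R\<in>\<Q>. (increment (peak G) \<Q> R * U R powr (1 / q')) * (S R powr (1 / p) * peak F (above \<Q> R))))"
    by (simp only: sum_distrib_left[symmetric] sum.distrib)
  also have "\<dots> \<le> ?T * (K powr (1 / p) * (p' / q' * K powr (p' / q') / (min 1 (p' / q' - 1) * (4 * B) powr - q)) powr (1 / p')
      + K powr (1 / q') * (q / p * K powr (q / p) / (min 1 (q / p - 1) * (4 * B) powr - p')) powr (1 / q))"
  proof (intro mult_left_mono[OF _ T0] add_mono)
    have small: "0 < (4 * B) powr - e" "(4 * B) powr - e < 1" if "0 < e" for e
      using B that by (auto simp: powr_minus_divide intro!: gr_one_powr)
    have smallq: "0 < (4 * B) powr - q" "(4 * B) powr - q < 1" and smallp: "0 < (4 * B) powr - p'" "(4 * B) powr - p' < 1"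
      using small basic by auto
    show "(\<Sum>R\<in>\<Q>. (increment (peak F) \<Q> R * S R powr (1 / p)) * (U R powr (1 / q') * peak G (above \<Q> R)))
        \<le> K powr (1 / p) * (p' / q' * K powr (p' / q') / (min 1 (p' / q' - 1) * (4 * B) powr - q)) powr (1 / p')"
    proof (rule half_bilinear[OF lam pos(1,2) superU _ smallq K dF dG])
      fix A R assume AR: "A \<in> \<Q>" "R \<in> \<Q>" "A \<subset> R"
      show "U A \<le> (1 - (4 * B) powr - q) * U R"
        by (rule level_decay[where S=S and len=len])
          (use AR pos monoS monoU half comp up B in \<open>auto simp: psubset_imp_subset\<close>)
    qed auto
    \<comment> \<open>The dual half, with \<open>p\<close>, \<open>S\<close>, \<open>F\<close> and
      \<open>q'\<close>, \<open>U\<close>, \<open>G\<close> exchanged. The decay needed is now that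
      of \<open>S\<close>, with the exponent \<open>p'\<close> in place of \<open>q\<close>.\<close>
    show "(\<Sum>R\<in>\<Q>. (increment (peak G) \<Q> R * U R powr (1 / q')) * (S R powr (1 / p) * peak F (above \<Q> R)))
        \<le> K powr (1 / q') * (q / p * K powr (q / p) / (min 1 (q / p - 1) * (4 * B) powr - p')) powr (1 / q)"
    proof (rule exponents.half_bilinear[OF dual lam pos(2,1) superS _ smallp K dG dF])
      fix A R assume AR: "A \<in> \<Q>" "R \<in> \<Q>" "A \<subset> R"
      show "S A \<le> (1 - (4 * B) powr - p') * S R"
        by (rule exponents.level_decay[OF dual, where S=U and len=len])
          (use AR pos monoS monoU half comp up B in \<open>auto simp: psubset_imp_subset mult.commute\<close>)
    qed auto
  qed
  also have "(p' / q' * K powr (p' / q') / (min 1 (p' / q' - 1) * (4 * B) powr - q)) powr (1 / p')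
      = (p' / q' * K powr (p' / q') / min 1 (p' / q' - 1)) powr (1 / p') * 4 powr (q / p') * B powr (q / p')"
  proof -
    have "p' / q' * K powr (p' / q') / (min 1 (p' / q' - 1) * (4 * B) powr - q)
        = (p' / q' * K powr (p' / q') / min 1 (p' / q' - 1)) * (4 * B) powr q"
      by (simp add: powr_minus field_simps)
    then show ?thesis using B by (simp only: powr_mult[where a="1/p'"]) (simp add: powr_powr powr_mult)
  qed
  also have "(q / p * K powr (q / p) / (min 1 (q / p - 1) * (4 * B) powr - p')) powr (1 / q)
      = (q / p * K powr (q / p) / min 1 (q / p - 1)) powr (1 / q) * 4 powr (p' / q) * B powr (p' / q)"
  proof -
    have "q / p * K powr (q / p) / (min 1 (q / p - 1) * (4 * B) powr - p')
        = (q / p * K powr (q / p) / min 1 (q / p - 1)) * (4 * B) powr p'"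
      by (simp add: powr_minus field_simps)
    then show ?thesis using B by (simp only: powr_mult[where a="1/q"]) (simp add: powr_powr powr_mult)
  qed
  finally have fin1: "(\<Sum>A\<in>\<Q>. len A powr (\<alpha> - 1) * (S A * F A) * (U A * G A))
      \<le> 2 * B * (?T * (K powr (1 / p) * ((p' / q' * K powr (p' / q') / min 1 (p' / q' - 1)) powr (1 / p') * 4 powr (q / p') * B powr (q / p'))
      + K powr (1 / q') * ((q / p * K powr (q / p) / min 1 (q / p - 1)) powr (1 / q) * 4 powr (p' / q) * B powr (p' / q))))"
    using B by (simp add: mult_left_mono)
  define X Y where "X = K powr (1 / p) * (p' / q' * K powr (p' / q') / min 1 (p' / q' - 1)) powr (1 / p') * 4 powr (q / p')"
    and "Y = K powr (1 / q') * (q / p * K powr (q / p) / min 1 (q / p - 1)) powr (1 / q) * 4 powr (p' / q)"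
  have XY: "0 \<le> X" "0 \<le> Y" by (simp_all add: X_def Y_def)
  note fin1
  also have "2 * B * (?T * (K powr (1 / p) * ((p' / q' * K powr (p' / q') / min 1 (p' / q' - 1)) powr (1 / p') * 4 powr (q / p') * B powr (q / p'))
      + K powr (1 / q') * ((q / p * K powr (q / p) / min 1 (q / p - 1)) powr (1 / q) * 4 powr (p' / q) * B powr (p' / q))))
      = 2 * ?T * (X * (B * B powr (q / p')) + Y * (B * B powr (p' / q)))"
    by (simp only: X_def Y_def ring_distribs mult_ac)
  also have "\<dots> \<le> 2 * ?T * ((X + Y) * (B * B powr (q / p') + B * B powr (p' / q)))"
  proof (rule mult_left_mono)
    have "0 \<le> X * (B * B powr (p' / q))" "0 \<le> Y * (B * B powr (q / p'))" using XY B by auto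
    then show "X * (B * B powr (q / p')) + Y * (B * B powr (p' / q)) \<le> (X + Y) * (B * B powr (q / p') + B * B powr (p' / q))"
      by (simp add: distrib_left distrib_right)
  qed (use T0 in simp)
  also have "\<dots> = level_const K * (B powr (1 + q / p') + B powr (1 + p' / q))"
    using B by (simp add: level_const_def Let_def X_def Y_def \<eta>_def[symmetric] powr_mult_base)
  finally show ?thesis .
qed

section \<open>Powers of extended nonnegative numbers\<close>

lemma ennreal_powr_ennreal: "0 \<le> x \<Longrightarrow> ennreal_powr (ennreal x) a = ennreal (x powr a)"
  by (simp add: ennreal_powr_def)

lemma ennreal_powr_top [simp]: "ennreal_powr top a = top"
  by (simp add: ennreal_powr_def)

lemma ennreal_powr_0 [simp]: "ennreal_powr 0 a = 0"
  by (simp add: ennreal_powr_def)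

lemma ennreal_powr_1 [simp]: "ennreal_powr 1 a = 1"
  by (simp add: ennreal_powr_def)

lemma ennreal_powr_one [simp]: "ennreal_powr x 1 = x"
  by (cases x) (auto simp: ennreal_powr_ennreal)

lemma ennreal_powr_mono: "0 \<le> a \<Longrightarrow> x \<le> y \<Longrightarrow> ennreal_powr x a \<le> ennreal_powr y a"
  by (cases x; cases y) (auto simp: ennreal_powr_ennreal powr_mono2 top_unique)

lemma ennreal_powr_powr: "ennreal_powr (ennreal_powr x a) b = ennreal_powr x (a * b)"
  by (cases x) (auto simp: ennreal_powr_ennreal powr_powr)

lemma ennreal_powr_eq_0_iff [simp]: "ennreal_powr x a = 0 \<longleftrightarrow> x = 0"
  by (cases x) (auto simp: ennreal_powr_ennreal)

lemma ennreal_powr_eq_top_iff [simp]: "ennreal_powr x a = top \<longleftrightarrow> x = top"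
  by (cases x) (auto simp: ennreal_powr_ennreal)

lemma ennreal_powr_less_top_iff [simp]: "ennreal_powr x a < top \<longleftrightarrow> x < top"
  by (cases x) (auto simp: ennreal_powr_ennreal)

lemma ennreal_powr_mult: "ennreal_powr (x * y) a = ennreal_powr x a * ennreal_powr y a"
proof (cases "x = 0 \<or> y = 0 \<or> x = top \<or> y = top")
  case True
  then show ?thesis by (auto simp: ennreal_mult_top ennreal_top_mult)
next
  case False
  then obtain a' b' where "x = ennreal a'" "y = ennreal b'" "0 \<le> a'" "0 \<le> b'"
    by (metis ennreal_cases)
  then show ?thesis by (simp add: ennreal_powr_ennreal powr_mult flip: ennreal_mult)
qed

lemma ennreal_powr_add: "0 < a \<Longrightarrow> 0 < b \<Longrightarrow> ennreal_powr x (a + b) = ennreal_powr x a * ennreal_powr x b"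
  by (cases x) (auto simp: ennreal_powr_ennreal powr_add ennreal_top_mult simp flip: ennreal_mult)

lemma ennreal_powr_le_iff:
  assumes "0 < a"
  shows "ennreal_powr x a \<le> ennreal_powr y a \<longleftrightarrow> x \<le> y"
proof
  assume "ennreal_powr x a \<le> ennreal_powr y a"
  then have "ennreal_powr (ennreal_powr x a) (1 / a) \<le> ennreal_powr (ennreal_powr y a) (1 / a)"
    using assms by (intro ennreal_powr_mono[of "1 / a"]) auto
  then show "x \<le> y" using assms by (simp add: ennreal_powr_powr)
qed (use assms ennreal_powr_mono in auto)

text \<open>A power and its inverse form a Galois connection, which is why powers commute with
  suprema.\<close>

lemma ennreal_powr_le_swap:
  assumes "0 < a"
  shows "ennreal_powr x a \<le> y \<longleftrightarrow> x \<le> ennreal_powr y (1 / a)"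
  using ennreal_powr_le_iff[of "1 / a" "ennreal_powr x a" y] assms by (simp add: ennreal_powr_powr)

lemma ennreal_powr_SUP:
  assumes "0 < a"
  shows "ennreal_powr (SUP i\<in>I. f i) a = (SUP i\<in>I. ennreal_powr (f i) a)"
proof (rule antisym)
  show "ennreal_powr (SUP i\<in>I. f i) a \<le> (SUP i\<in>I. ennreal_powr (f i) a)"
    unfolding ennreal_powr_le_swap[OF assms]
    by (rule SUP_least) (auto simp: ennreal_powr_le_swap[OF assms, symmetric] intro: SUP_upper)
  show "(SUP i\<in>I. ennreal_powr (f i) a) \<le> ennreal_powr (SUP i\<in>I. f i) a"
    using assms by (intro SUP_least ennreal_powr_mono SUP_upper) auto
qed

lemma borel_measurable_ennreal_powr [measurable (raw)]:
  assumes [measurable]: "f \<in> borel_measurable M"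
  shows "(\<lambda>x. ennreal_powr (f x) a) \<in> borel_measurable M"
  unfolding ennreal_powr_def by measurable

section \<open>Summation over the levels\<close>

lemma geometric_sum_le_double:
  fixes x :: real
  assumes "2 \<le> x"
  shows "(\<Sum>m\<le>M. x ^ m) \<le> 2 * x ^ M"
proof (induction M)
  case (Suc M)
  have "2 * x ^ M \<le> x * x ^ M" using assms by (intro mult_right_mono) auto
  then show ?case using Suc by simp
qed simp

text \<open>The assumptions \<open>low\<close> and \<open>up\<close> confine the quotient
  \<open>r\<close> to the range from 1 to \<open>X powr (1 / q)\<close>, and the level of a cube is
  the integer part of its binary logarithm. The bounds \<open>dF\<close> and \<open>dG\<close> are
  required for every subfamily because the running maxima are formed inside one level, where most
  ancestors may be missing.\<close>

lemma (in exponents) all_levels_bilinear: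
  fixes len S U F G :: "'a set \<Rightarrow> real"
  assumes lam: "laminar \<Q>"
    and pos: "\<And>A. A \<in> \<Q> \<Longrightarrow> 0 < S A" "\<And>A. A \<in> \<Q> \<Longrightarrow> 0 < U A" "\<And>A. A \<in> \<Q> \<Longrightarrow> 0 < len A"
    and superS: "\<And>R \<P>. R \<in> \<Q> \<Longrightarrow> \<P> \<subseteq> \<Q> \<Longrightarrow> disjoint \<P> \<Longrightarrow> (\<And>A. A \<in> \<P> \<Longrightarrow> A \<subseteq> R) \<Longrightarrow> sum S \<P> \<le> S R"
    and superU: "\<And>R \<P>. R \<in> \<Q> \<Longrightarrow> \<P> \<subseteq> \<Q> \<Longrightarrow> disjoint \<P> \<Longrightarrow> (\<And>A. A \<in> \<P> \<Longrightarrow> A \<subseteq> R) \<Longrightarrow> sum U \<P> \<le> U R"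
    and half: "\<And>A R. A \<in> \<Q> \<Longrightarrow> R \<in> \<Q> \<Longrightarrow> A \<subset> R \<Longrightarrow> len A \<le> len R / 2"
    and comp: "\<And>A R. A \<in> \<Q> \<Longrightarrow> R \<in> \<Q> \<Longrightarrow> A \<subset> R \<Longrightarrow>
      (len R - len A) powr (1 - \<alpha>) \<le> (U R - U A) powr (1 / q) * (S R - S A) powr (1 / p')"
    and low: "\<And>A. A \<in> \<Q> \<Longrightarrow> len A powr (1 - \<alpha>) \<le> S A powr (1 / p') * U A powr (1 / q)"
    and up: "\<And>A. A \<in> \<Q> \<Longrightarrow> S A powr (1 / p') * U A powr (1 / q) \<le> X powr (1 / q) * len A powr (1 - \<alpha>)"
    and X: "1 \<le> X" and K: "0 < K"
    and dF: "\<And>\<P>. \<P> \<subseteq> \<Q> \<Longrightarrow> (\<Sum>Q\<in>\<P>. increment (\<lambda>A. peak F A powr p) \<P> Q * S Q) \<le> K"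
    and dG: "\<And>\<P>. \<P> \<subseteq> \<Q> \<Longrightarrow> (\<Sum>Q\<in>\<P>. increment (\<lambda>A. peak G A powr q') \<P> Q * U Q) \<le> K"
    and FG: "\<And>A. A \<in> \<Q> \<Longrightarrow> 0 \<le> F A" "\<And>A. A \<in> \<Q> \<Longrightarrow> 0 \<le> G A"
  shows "(\<Sum>A\<in>\<Q>. len A powr (\<alpha> - 1) * (S A * F A) * (U A * G A))
    \<le> 4 * \<bar>level_const K\<bar> * X powr (max 1 (p' / q) * (1 - \<alpha>))"
proof -
  note fin = laminarD(1)[OF lam]
  note basic = p_gt_1 q_gt_1 p'_gt_1 q'_gt_1 alpha_pos alpha_less_1 p_less_q
  define r where "r A = S A powr (1 / p') * U A powr (1 / q) / len A powr (1 - \<alpha>)" for A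
  define lev where "lev A = nat \<lfloor>log 2 (r A)\<rfloor>" for A
  \<comment> \<open>The inserted 0 covers the empty family.\<close>
  define M where "M = Max (insert 0 (lev ` \<Q>))"
  have r1: "1 \<le> r A" if "A \<in> \<Q>" for A using low[OF that] pos(3)[OF that] by (simp add: r_def)
  have rX: "r A \<le> X powr (1 / q)" if "A \<in> \<Q>" for A
    using up[OF that] pos(3)[OF that] by (simp add: r_def divide_le_eq)
  have lev: "2 ^ lev A \<le> r A" "r A \<le> 2 * 2 ^ lev A" if "A \<in> \<Q>" for A
  proof -
    have "0 \<le> log 2 (r A)" using r1[OF that] by simp
    then have l: "real (lev A) \<le> log 2 (r A)" "log 2 (r A) \<le> real (Suc (lev A))"
      unfolding lev_def by linarith+
    show "2 ^ lev A \<le> r A" using l(1) r1[OF that] by (simp add: le_log_iff powr_realpow)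
    have "r A \<le> 2 powr real (Suc (lev A))"
      using l(2) r1[OF that] by (simp add: log_le_iff del: of_nat_Suc)
    then show "r A \<le> 2 * 2 ^ lev A" by (subst (asm) powr_realpow) auto
  qed
  have MX: "2 ^ M \<le> X powr (1 / q)"
  proof -
    have "M \<in> insert 0 (lev ` \<Q>)" unfolding M_def using fin by (intro Max_in) auto
    then consider "M = 0" | A where "A \<in> \<Q>" "M = lev A" by auto
    then show ?thesis
    proof cases
      case 1
      then show ?thesis using X basic by (simp add: ge_one_powr_ge_zero)
    next
      case 2
      then show ?thesis using lev(1)[of A] rX[of A] by simp
    qed
  qed
  have levM: "lev ` \<Q> \<subseteq> {..M}" using fin by (auto simp: M_def)
  let ?t = "\<lambda>A. len A powr (\<alpha> - 1) * (S A * F A) * (U A * G A)"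
  define e1 e2 where "e1 = 1 + q / p'" and "e2 = 1 + p' / q"
  have e: "1 \<le> e1" "1 \<le> e2" using basic by (auto simp: e1_def e2_def)
  have "(\<Sum>A\<in>\<Q>. ?t A) = (\<Sum>m\<le>M. \<Sum>A\<in>{A \<in> \<Q>. lev A = m}. ?t A)"
    using fin levM by (intro sum.group[symmetric]) auto
  also have "\<dots> \<le> (\<Sum>m\<le>M. level_const K * ((2 ^ m) powr e1 + (2 ^ m) powr e2))"
  proof (rule sum_mono)
    fix m
    let ?P = "{A \<in> \<Q>. lev A = m}"
    have sub: "?P \<subseteq> \<Q>" by auto
    show "(\<Sum>A\<in>?P. ?t A) \<le> level_const K * ((2 ^ m) powr e1 + (2 ^ m) powr e2)"
      unfolding e1_def e2_def
    proof (rule level_bilinear)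
      show "laminar ?P" by (rule laminar_subset[OF lam sub])
      show "sum S \<P> \<le> S R" if "R \<in> ?P" "\<P> \<subseteq> ?P" "disjoint \<P>" "\<And>A. A \<in> \<P> \<Longrightarrow> A \<subseteq> R" for R \<P>
        using that by (intro superS) auto
      show "sum U \<P> \<le> U R" if "R \<in> ?P" "\<P> \<subseteq> ?P" "disjoint \<P>" "\<And>A. A \<in> \<P> \<Longrightarrow> A \<subseteq> R" for R \<P>
        using that by (intro superU) auto
      show "2 ^ m * len A powr (1 - \<alpha>) \<le> S A powr (1 / p') * U A powr (1 / q)" if "A \<in> ?P" for A
        using lev(1)[of A] that pos(3)[of A] by (auto simp: r_def le_divide_eq)
      show "S A powr (1 / p') * U A powr (1 / q) \<le> 2 * 2 ^ m * len A powr (1 - \<alpha>)" if "A \<in> ?P" for A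
        using lev(2)[of A] that pos(3)[of A] by (auto simp: r_def divide_le_eq)
    qed (use pos half comp K dF[OF sub] dG[OF sub] FG in auto)
  qed
  also have "\<dots> \<le> (\<Sum>m\<le>M. \<bar>level_const K\<bar> * ((2 ^ m) powr e1 + (2 ^ m) powr e2))"
    by (intro sum_mono mult_right_mono) auto
  also have "\<dots> = \<bar>level_const K\<bar> * ((\<Sum>m\<le>M. (2 powr e1) ^ m) + (\<Sum>m\<le>M. (2 powr e2) ^ m))"
    by (simp add: sum_distrib_left sum.distrib distrib_left powr_power powr_realpow[symmetric] powr_powr mult.commute)
  also have "\<dots> \<le> \<bar>level_const K\<bar> * (2 * (2 powr e1) ^ M + 2 * (2 powr e2) ^ M)"
    using e powr_mono[of 1 e1 2] powr_mono[of 1 e2 2]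
    by (intro mult_left_mono add_mono geometric_sum_le_double) auto
  also have "\<dots> = \<bar>level_const K\<bar> * (2 * (2 ^ M) powr e1 + 2 * (2 ^ M) powr e2)"
    by (simp add: powr_power powr_realpow[symmetric] powr_powr mult.commute)
  also have "\<dots> \<le> \<bar>level_const K\<bar> * (2 * X powr (max 1 (p' / q) * (1 - \<alpha>)) + 2 * X powr (max 1 (p' / q) * (1 - \<alpha>)))"
  proof (intro mult_left_mono add_mono)
    have "(2 ^ M) powr e1 \<le> (X powr (1 / q)) powr e1" using MX e by (intro powr_mono2) auto
    also have "\<dots> = X powr (1 * (1 - \<alpha>))"
      using basic by (simp add: powr_powr e1_def distrib_left inv_q_p'[symmetric])
    also have "\<dots> \<le> X powr (max 1 (p' / q) * (1 - \<alpha>))"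
      using X alpha_less_1 by (intro powr_mono mult_right_mono) auto
    finally show "(2 ^ M) powr e1 \<le> X powr (max 1 (p' / q) * (1 - \<alpha>))" .
    have "(2 ^ M) powr e2 \<le> (X powr (1 / q)) powr e2" using MX e by (intro powr_mono2) auto
    also have "\<dots> = X powr (p' / q * (1 - \<alpha>))"
      using basic by (simp add: powr_powr e2_def distrib_left inv_q_p'[symmetric] add.commute)
    also have "\<dots> \<le> X powr (max 1 (p' / q) * (1 - \<alpha>))"
      using X alpha_less_1 by (intro powr_mono mult_right_mono) auto
    finally show "(2 ^ M) powr e2 \<le> X powr (max 1 (p' / q) * (1 - \<alpha>))" .
  qed auto
  finally show ?thesis by (simp add: mult_ac)
qed

section \<open>Finite families of cubes for a weight on the line\<close>

lemma emeasure_density_pos: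
  assumes [measurable]: "f \<in> borel_measurable borel" "E \<in> sets borel"
    and f: "\<And>x. 0 < f x" and E: "0 < emeasure lborel E"
  shows "0 < emeasure (density lborel (\<lambda>x. ennreal (f x))) E"
proof (rule ccontr)
  assume "\<not> ?thesis"
  then have "(\<integral>\<^sup>+x. ennreal (f x) * indicator E x \<partial>lborel) = 0"
    by (simp add: emeasure_density)
  then have "AE x in lborel. ennreal (f x) * indicator E x = 0"
    by (subst (asm) nn_integral_0_iff_AE) auto
  then have "AE x in lborel. x \<notin> E"
    by eventually_elim (use f in \<open>auto simp: indicator_def less_le\<close>)
  then have "emeasure lborel E = 0"
    using AE_iff_null_sets[of E lborel] by auto
  then show False using E by simp
qed

text \<open>Hoelder's inequality for the constant 1 written as a product of powers of
  \<open>v powr q\<close> and \<open>v powr - p'\<close>, obtained by integrating a weighted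
  arithmetic-geometric mean. The set is not restricted to intervals: differences of nested cubes are
  needed for the mass decay.\<close>

lemma (in exponents) weight_Holder:
  fixes v :: "real \<Rightarrow> real"
  assumes [measurable]: "v \<in> borel_measurable borel" "E \<in> sets borel"
    and v: "\<And>x. 0 < v x"
    and U: "emeasure (density lborel (\<lambda>x. ennreal (v x powr q))) E = ennreal U" "0 < U"
    and S: "emeasure (density lborel (\<lambda>x. ennreal (v x powr - p'))) E = ennreal S" "0 < S"
    and L: "emeasure lborel E = ennreal L" "0 \<le> L"
  shows "L powr (1 - \<alpha>) \<le> U powr (1 / q) * S powr (1 / p')"
proof -
  note basic = p_gt_1 q_gt_1 p'_gt_1 q'_gt_1 alpha_pos alpha_less_1 p_less_q
  \<comment> \<open>This solves \<open>q * \<theta> = p' * (1 - \<theta>)\<close>, so the weight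
    cancels; the solution has this form because
    \<open>1 / q + 1 / p' = 1 - \<alpha>\<close>.\<close>
  define \<theta> where "\<theta> = 1 / (q * (1 - \<alpha>))"
  have th: "0 \<le> \<theta>" "0 \<le> 1 - \<theta>" "1 - \<theta> = 1 / (p' * (1 - \<alpha>))"
  proof -
    have "(1 / q + 1 / p') / (1 - \<alpha>) = 1" using alpha_less_1 by (simp add: inv_q_p')
    then show *: "1 - \<theta> = 1 / (p' * (1 - \<alpha>))"
      using alpha_less_1 basic by (simp add: \<theta>_def add_divide_distrib)
    show "0 \<le> \<theta>" "0 \<le> 1 - \<theta>" unfolding * using basic by (auto simp: \<theta>_def)
  qed
  define c where "c = U powr \<theta> * S powr (1 - \<theta>)"
  have pt: "1 \<le> c * (\<theta> / U) * (v x powr q) + c * ((1 - \<theta>) / S) * (v x powr - p')" for x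
  proof -
    have e: "q * \<theta> + - p' * (1 - \<theta>) = 0" unfolding th(3) using basic by (simp add: \<theta>_def)
    have "(v x powr q / U) powr \<theta> * (v x powr - p' / S) powr (1 - \<theta>)
        \<le> \<theta> * (v x powr q / U) + (1 - \<theta>) * (v x powr - p' / S)"
      using U S v[of x] th by (intro Youngs_inequality_0) auto
    moreover have "(v x powr q / U) powr \<theta> * (v x powr - p' / S) powr (1 - \<theta>)
        = v x powr (q * \<theta>) * v x powr (- p' * (1 - \<theta>)) / c"
      by (simp add: c_def powr_divide powr_powr)
    moreover have "v x powr (q * \<theta>) * v x powr (- p' * (1 - \<theta>)) = 1"
      using v[of x] unfolding powr_add[symmetric] e by simp
    ultimately have "1 / c \<le> \<theta> * (v x powr q / U) + (1 - \<theta>) * (v x powr - p' / S)"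
      by simp
    then have "c * (1 / c) \<le> c * (\<theta> * (v x powr q / U) + (1 - \<theta>) * (v x powr - p' / S))"
      by (intro mult_left_mono) (auto simp: c_def)
    moreover have "0 < c" using U S by (simp add: c_def)
    ultimately show ?thesis by (simp add: algebra_simps)
  qed
  have nn: "0 \<le> c * (\<theta> / U)" "0 \<le> c * ((1 - \<theta>) / S)"
    using U S th(1,2) by (auto simp: c_def)
  have "ennreal L = (\<integral>\<^sup>+x. indicator E x \<partial>lborel)" using L by simp
  also have "\<dots> \<le> (\<integral>\<^sup>+x. ennreal (c * (\<theta> / U)) * (ennreal (v x powr q) * indicator E x)
      + ennreal (c * ((1 - \<theta>) / S)) * (ennreal (v x powr - p') * indicator E x) \<partial>lborel)"
  proof (rule nn_integral_mono)
    fix x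
    have "(1::ennreal) \<le> ennreal (c * (\<theta> / U) * (v x powr q) + c * ((1 - \<theta>) / S) * (v x powr - p'))"
      using pt[of x] by simp
    also have "\<dots> = ennreal (c * (\<theta> / U)) * ennreal (v x powr q) + ennreal (c * ((1 - \<theta>) / S)) * ennreal (v x powr - p')"
      using nn by (simp only: ennreal_plus ennreal_mult mult_nonneg_nonneg powr_ge_zero)
    finally show "indicator E x \<le> ennreal (c * (\<theta> / U)) * (ennreal (v x powr q) * indicator E x)
      + ennreal (c * ((1 - \<theta>) / S)) * (ennreal (v x powr - p') * indicator E x)"
      by (auto simp: indicator_def)
  qed
  also have "\<dots> = ennreal (c * (\<theta> / U)) * ennreal U + ennreal (c * ((1 - \<theta>) / S)) * ennreal S"
    using U S by (simp add: nn_integral_add nn_integral_cmult emeasure_density)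
  also have "\<dots> = ennreal c"
  proof -
    have "c * (\<theta> / U) * U + c * ((1 - \<theta>) / S) * S = c"
      using U S by (simp add: field_simps)
    then show ?thesis using nn U S by (metis ennreal_mult ennreal_plus less_imp_le mult_nonneg_nonneg)
  qed
  finally have "L \<le> c" using U S by (simp add: c_def)
  then have "L powr (1 - \<alpha>) \<le> c powr (1 - \<alpha>)" using L alpha_less_1 by (intro powr_mono2) auto
  also have "\<dots> = U powr (1 / q) * S powr (1 / p')"
    unfolding c_def th(3) using basic by (simp add: \<theta>_def powr_mult powr_powr)
  finally show ?thesis .
qed

lemma measure_sum_disjoint_le:
  assumes "finite \<P>" "disjoint \<P>" "\<And>A. A \<in> \<P> \<Longrightarrow> A \<subseteq> R" "\<And>A. A \<in> \<P> \<Longrightarrow> A \<in> fmeasurable N" "R \<in> fmeasurable N"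
  shows "sum (measure N) \<P> \<le> measure N R"
proof -
  have "sum (measure N) \<P> = measure N (\<Union>\<P>)"
    using assms by (intro measure_Union'[symmetric]) (auto simp: disjoint_def pairwise_def disjnt_def)
  also have "\<dots> \<le> measure N R"
    using assms by (intro measure_mono_fmeasurable) (auto simp: fmeasurable_def)
  finally show ?thesis .
qed

text \<open>The maximum serves as a common \<open>K\<close> for the two Doob constants, one for the
  exponent \<open>p\<close> and one for the exponent \<open>q'\<close>.\<close>

definition (in exponents) family_const :: real where
  "family_const = 4 * \<bar>level_const (max (2 * (p' * (2 * p') powr (p - 1))) (2 * (q * (2 * q) powr (q' - 1))))\<bar>"

text \<open>The measures \<open>N1\<close> and \<open>N2\<close> supply the masses \<open>S\<close>
  and \<open>U\<close>. Testing \<open>T\<close> against a normalised \<open>T powr (q - 1)\<close>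
  turns its norm into the bilinear form, where \<open>F\<close> and \<open>G\<close> are averages
  with respect to two different measures. The constant does not depend on the family, which permits
  the later limit over growing families.\<close>

lemma (in exponents) finite_family_bound:
  fixes v f :: "real \<Rightarrow> real"
  assumes [measurable]: "v \<in> borel_measurable borel" "f \<in> borel_measurable borel"
    and v: "\<And>x. 0 < v x" and X: "1 \<le> X"
    and lam: "laminar \<Q>"
    and Qb: "\<And>Q. Q \<in> \<Q> \<Longrightarrow> Q \<in> sets borel"
    and lenQ: "\<And>Q. Q \<in> \<Q> \<Longrightarrow> emeasure lborel Q < \<infinity>" "\<And>Q. Q \<in> \<Q> \<Longrightarrow> 0 < measure lborel Q"
    and half: "\<And>A R. A \<in> \<Q> \<Longrightarrow> R \<in> \<Q> \<Longrightarrow> A \<subset> R \<Longrightarrow> measure lborel A \<le> measure lborel R / 2"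
  defines "N1 \<equiv> density lborel (\<lambda>x. ennreal (v x powr - p'))"
    and "N2 \<equiv> density lborel (\<lambda>x. ennreal (v x powr q))"
  assumes finN: "\<And>Q. Q \<in> \<Q> \<Longrightarrow> emeasure N1 Q < \<infinity>" "\<And>Q. Q \<in> \<Q> \<Longrightarrow> emeasure N2 Q < \<infinity>"
    and up: "\<And>Q. Q \<in> \<Q> \<Longrightarrow> measure N1 Q powr (1 / p') * measure N2 Q powr (1 / q)
      \<le> X powr (1 / q) * measure lborel Q powr (1 - \<alpha>)"
    and f: "\<And>x. 0 \<le> f x" "integrable N1 (\<lambda>x. f x powr p)" "(\<integral>x. f x powr p \<partial>N1) \<le> 1"
  defines "T \<equiv> \<lambda>x. \<Sum>Q\<in>\<Q>. measure lborel Q powr (\<alpha> - 1) * (\<integral>t. indicator Q t * f t \<partial>N1) * indicator Q x"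
  shows "(\<integral>\<^sup>+x. ennreal (T x powr q) \<partial>N2)
    \<le> ennreal ((family_const * X powr (max 1 (p' / q) * (1 - \<alpha>))) powr q)"
proof -
  note fin = laminarD(1)[OF lam]
  note basic = p_gt_1 q_gt_1 p'_gt_1 q'_gt_1 alpha_pos alpha_less_1 p_less_q
  let ?\<beta> = "max 1 (p' / q) * (1 - \<alpha>)"
  have setsN [simp]: "sets N1 = sets borel" "sets N2 = sets borel"
    by (simp_all add: N1_def N2_def)
  have fm: "Q \<in> fmeasurable N1" "Q \<in> fmeasurable N2" "Q \<in> fmeasurable lborel" if "Q \<in> \<Q>" for Q
    using that Qb finN lenQ by (auto simp: fmeasurable_def)
  have vpow: "0 < v x powr e" for x e using v[of x] by simp
  have posE: "0 < emeasure N1 E" "0 < emeasure N2 E" if "E \<in> sets borel" "0 < emeasure lborel E" for E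
    unfolding N1_def N2_def using that vpow by (auto intro!: emeasure_density_pos)
  have mpos: "0 < measure N1 E" "0 < measure N2 E"
    if "E \<in> fmeasurable N1" "E \<in> fmeasurable N2" "E \<in> sets borel" "0 < measure lborel E" for E
  proof -
    have "emeasure lborel E \<noteq> 0" using that(4) by (auto simp: measure_def)
    then have "0 < emeasure N1 E" "0 < emeasure N2 E" using posE[OF that(3)] by (auto simp: zero_less_iff_neq_zero)
    moreover have "emeasure N1 E = ennreal (measure N1 E)" "emeasure N2 E = ennreal (measure N2 E)"
      using that by (auto intro!: emeasure_eq_ennreal_measure simp: fmeasurable_def)
    ultimately show "0 < measure N1 E" "0 < measure N2 E" by simp_all
  qed
  have pos: "0 < measure N1 Q" "0 < measure N2 Q" if "Q \<in> \<Q>" for Q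
    using mpos[of Q] fm that Qb lenQ by auto
  have holder: "measure lborel E powr (1 - \<alpha>) \<le> measure N2 E powr (1 / q) * measure N1 E powr (1 / p')"
    if E: "E \<in> fmeasurable N1" "E \<in> fmeasurable N2" "E \<in> fmeasurable lborel" "0 < measure lborel E" for E
  proof (rule weight_Holder)
    show "emeasure (density lborel (\<lambda>x. ennreal (v x powr q))) E = ennreal (measure N2 E)"
      "emeasure (density lborel (\<lambda>x. ennreal (v x powr - p'))) E = ennreal (measure N1 E)"
      "emeasure lborel E = ennreal (measure lborel E)"
      unfolding N1_def[symmetric] N2_def[symmetric]
      using E by (auto intro!: emeasure_eq_ennreal_measure simp: fmeasurable_def)
    show "E \<in> sets borel" using E by (auto simp: fmeasurable_def)
    then show "0 < measure N2 E" "0 < measure N1 E" using E mpos by auto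
  qed (use v in auto)
  define c where "c Q = measure lborel Q powr (\<alpha> - 1) * (\<integral>t. indicator Q t * f t \<partial>N1)" for Q
  have c0: "0 \<le> c Q" for Q unfolding c_def using f(1) by (auto intro!: mult_nonneg_nonneg integral_nonneg_AE)
  have T_eq: "T x = (\<Sum>Q\<in>\<Q>. c Q * indicator Q x)" for x by (simp add: T_def c_def)
  have T0: "0 \<le> T x" for x unfolding T_eq using c0 by (auto intro!: sum_nonneg)
  have [measurable]: "T \<in> borel_measurable borel" unfolding T_def using Qb by measurable
  define B where "B = sum c \<Q>"
  have TB: "T x \<le> B" for x
    unfolding T_eq B_def using c0 by (intro sum_mono) (auto simp: indicator_def)
  have Tout: "T x = 0" if "x \<notin> \<Union>\<Q>" for x
    unfolding T_eq using that by (auto simp: indicator_def intro!: sum.neutral)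
  \<comment> \<open>\<open>T\<close> is bounded and vanishes outside finitely many cubes of finite
    mass. Its powers are thus integrable beforehand and \<open>Z\<close> below is finite, so
    dividing by a power of it is legitimate.\<close>
  have Tpow_le: "T x powr e \<le> B powr e * (\<Sum>Q\<in>\<Q>. indicator Q x)" if e: "0 \<le> e" for x e
  proof (cases "x \<in> \<Union>\<Q>")
    case True
    then obtain R where R: "R \<in> \<Q>" "x \<in> R" by auto
    have "indicator R x \<le> (\<Sum>Q\<in>\<Q>. indicator Q x :: real)"
      using fin R by (intro member_le_sum) auto
    then have "B powr e * 1 \<le> B powr e * (\<Sum>Q\<in>\<Q>. indicator Q x)"
      using R by (intro mult_left_mono) auto
    moreover have "T x powr e \<le> B powr e" using TB T0 e by (intro powr_mono2) auto
    ultimately show ?thesis by simp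
  next
    case False
    then show ?thesis using Tout[OF False] by (auto intro!: mult_nonneg_nonneg sum_nonneg)
  qed
  have intT: "integrable N2 (\<lambda>x. T x powr e)" if e: "0 \<le> e" for e
  proof (rule Bochner_Integration.integrable_bound)
    show "integrable N2 (\<lambda>x. B powr e * (\<Sum>Q\<in>\<Q>. indicator Q x))"
      using fm by (auto simp: fmeasurable_def less_top)
    show "AE x in N2. norm (T x powr e) \<le> norm (B powr e * (\<Sum>Q\<in>\<Q>. indicator Q x))"
    proof (intro AE_I2)
      fix x
      have "0 \<le> B powr e * (\<Sum>Q\<in>\<Q>. indicator Q x)" by (auto intro!: mult_nonneg_nonneg sum_nonneg)
      then show "norm (T x powr e) \<le> norm (B powr e * (\<Sum>Q\<in>\<Q>. indicator Q x))"
        using Tpow_le[OF e, of x] by simp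
    qed
  qed (simp add: N2_def)
  define Z where "Z = (\<integral>x. T x powr q \<partial>N2)"
  have Z0: "0 \<le> Z" unfolding Z_def by (auto intro!: integral_nonneg_AE)
  have nnZ: "(\<integral>\<^sup>+x. ennreal (T x powr q) \<partial>N2) = ennreal Z"
    unfolding Z_def using intT[of q] basic by (intro nn_integral_eq_integral) auto
  show ?thesis
  proof (cases "Z = 0")
    case True
    then show ?thesis by (simp add: nnZ)
  next
    case False
    with Z0 have Zp: "0 < Z" by simp
    \<comment> \<open>the extremal function in the duality between \<open>L\<^sup>q\<close> and its dual\<close>
    define g where "g x = T x powr (q - 1) / Z powr (1 / q')" for x
    have [measurable]: "g \<in> borel_measurable borel" unfolding g_def by measurable
    have g0: "0 \<le> g x" for x by (simp add: g_def)
    have q1: "(q - 1) * q' = q" using conj_q basic by (simp add: field_simps)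
    have gq: "g x powr q' = T x powr q / Z" for x
      using basic Zp q1 by (simp add: g_def powr_divide powr_powr)
    have gint: "integrable N2 (\<lambda>x. g x powr q')" unfolding gq using intT[of q] basic by simp
    have gint1: "(\<integral>x. g x powr q' \<partial>N2) = 1"
      unfolding gq using Zp by (simp add: Z_def)
    define K where "K = max (2 * (p' * (2 * p') powr (p - 1))) (2 * (q * (2 * q) powr (q' - 1)))"
    define F where "F Q = (\<integral>x. indicator Q x * f x \<partial>N1) / measure N1 Q" for Q
    define G where "G Q = (\<integral>x. indicator Q x * g x \<partial>N2) / measure N2 Q" for Q
    have K0: "0 < K" unfolding K_def using basic by (auto simp: less_max_iff_disj)
    have dF: "(\<Sum>Q\<in>\<P>. increment (\<lambda>A. peak F A powr p) \<P> Q * measure N1 Q) \<le> K" if P: "\<P> \<subseteq> \<Q>" for \<P>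
    proof -
      have "(\<Sum>Q\<in>\<P>. increment (\<lambda>A. peak F A powr p) \<P> Q * measure N1 Q)
          \<le> 2 * (p' * (2 * p') powr (p - 1)) * (\<integral>x. f x powr p \<partial>N1)"
        unfolding F_def
      proof (rule Doob_laminar)
        show "laminar \<P>" using lam P by (rule laminar_subset)
        show "1 < p" "1 < p'" "1 / p + 1 / p' = 1" using basic conj_p by auto
        show "f \<in> borel_measurable N1" by (simp add: N1_def)
      qed (use P Qb finN pos f in auto)
      also have "\<dots> \<le> 2 * (p' * (2 * p') powr (p - 1)) * 1"
        using f(3) basic by (intro mult_left_mono) auto
      finally show ?thesis by (simp add: K_def)
    qed
    have dG: "(\<Sum>Q\<in>\<P>. increment (\<lambda>A. peak G A powr q') \<P> Q * measure N2 Q) \<le> K" if P: "\<P> \<subseteq> \<Q>" for \<P>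
    proof -
      have "(\<Sum>Q\<in>\<P>. increment (\<lambda>A. peak G A powr q') \<P> Q * measure N2 Q)
          \<le> 2 * (q * (2 * q) powr (q' - 1)) * (\<integral>x. g x powr q' \<partial>N2)"
        unfolding G_def
      proof (rule Doob_laminar)
        show "laminar \<P>" using lam P by (rule laminar_subset)
        show "1 < q'" "1 < q" "1 / q' + 1 / q = 1" using basic conj_q by auto
        show "g \<in> borel_measurable N2" by (simp add: N2_def)
      qed (use P Qb finN pos g0 gint in auto)
      then show ?thesis by (simp add: K_def gint1)
    qed
    have "(\<Sum>A\<in>\<Q>. measure lborel A powr (\<alpha> - 1) * (measure N1 A * F A) * (measure N2 A * G A))
        \<le> 4 * \<bar>level_const K\<bar> * X powr ?\<beta>"
    proof (rule all_levels_bilinear[OF lam pos lenQ(2) _ _ half _ _ up X K0 dF dG])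
      show "sum (measure N1) \<P> \<le> measure N1 R" "sum (measure N2) \<P> \<le> measure N2 R"
        if "R \<in> \<Q>" "\<P> \<subseteq> \<Q>" "disjoint \<P>" "\<And>A. A \<in> \<P> \<Longrightarrow> A \<subseteq> R" for R \<P>
        using that fm fin by (auto intro!: measure_sum_disjoint_le intro: finite_subset)
      show "measure lborel A powr (1 - \<alpha>) \<le> measure N1 A powr (1 / p') * measure N2 A powr (1 / q)" if "A \<in> \<Q>" for A
        using holder[of A] fm[OF that] lenQ(2)[OF that] by (simp add: mult.commute)
      \<comment> \<open>Hoelder's inequality on \<open>R - A\<close>, which has positive length
        because \<open>A\<close> is at most half of \<open>R\<close>.\<close>
      show "(measure lborel R - measure lborel A) powr (1 - \<alpha>)
          \<le> (measure N2 R - measure N2 A) powr (1 / q) * (measure N1 R - measure N1 A) powr (1 / p')"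
        if AR: "A \<in> \<Q>" "R \<in> \<Q>" "A \<subset> R" for A R
      proof -
        have fmd: "R - A \<in> fmeasurable N1" "R - A \<in> fmeasurable N2" "R - A \<in> fmeasurable lborel"
          using AR fm by (auto intro: fmeasurable.Diff)
        have d: "measure M (R - A) = measure M R - measure M A"
          if "R \<in> fmeasurable M" "A \<in> fmeasurable M" for M
          using that AR by (intro measurable_measure_Diff) (auto simp: fmeasurable_def)
        have "0 < measure lborel (R - A)"
          using half[OF AR] lenQ(2)[OF AR(2)] by (subst d) (use fm AR in auto)
        from holder[OF fmd this] show ?thesis using fm AR by (simp add: d)
      qed
      show "0 \<le> F A" "0 \<le> G A" for A
        using f(1) g0 by (auto simp: F_def G_def intro!: divide_nonneg_nonneg integral_nonneg_AE)
    qed auto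
    also have "4 * \<bar>level_const K\<bar> = family_const" by (simp add: family_const_def K_def)
    also have "(\<Sum>A\<in>\<Q>. measure lborel A powr (\<alpha> - 1) * (measure N1 A * F A) * (measure N2 A * G A))
        = (\<Sum>A\<in>\<Q>. c A * (\<integral>x. indicator A x * g x \<partial>N2))"
      using pos by (intro sum.cong refl) (auto simp: F_def G_def c_def less_le)
    also have "\<dots> = (\<integral>x. T x * g x \<partial>N2)"
    proof -
      have "integrable N2 (\<lambda>x. indicator A x * g x)" if "A \<in> \<Q>" for A
        using that gint g0 Qb finN basic by (intro indicator_times_integrable[of q']) (auto simp: N2_def)
      then have "(\<Sum>A\<in>\<Q>. c A * (\<integral>x. indicator A x * g x \<partial>N2)) = (\<integral>x. (\<Sum>A\<in>\<Q>. c A * (indicator A x * g x)) \<partial>N2)"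
        by (subst Bochner_Integration.integral_sum) auto
      also have "(\<lambda>x. \<Sum>A\<in>\<Q>. c A * (indicator A x * g x)) = (\<lambda>x. T x * g x)"
        by (simp add: T_eq sum_distrib_right mult.assoc)
      finally show ?thesis .
    qed
    also have "(\<lambda>x. T x * g x) = (\<lambda>x. T x powr q / Z powr (1 / q'))"
      using T0 by (simp add: g_def powr_mult_base)
    also have "(\<integral>x. T x powr q / Z powr (1 / q') \<partial>N2) = Z / Z powr (1 / q')" by (simp add: Z_def)
    also have "\<dots> = Z powr (1 / q)"
    proof -
      have "Z = Z powr (1 / q + 1 / q')" using Zp conj_q by simp
      then have "Z = Z powr (1 / q) * Z powr (1 / q')" by (simp only: powr_add)
      then show ?thesis using Zp by (simp add: divide_eq_eq)
    qed
    finally have "(Z powr (1 / q)) powr q \<le> (family_const * X powr ?\<beta>) powr q"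
      using basic by (intro powr_mono2) auto
    then have "Z \<le> (family_const * X powr ?\<beta>) powr q"
      using Zp basic by (simp add: powr_powr)
    then show ?thesis by (simp add: nnZ ennreal_leI)
  qed
qed

section \<open>Dyadic grids\<close>

text \<open>The alternating sign makes the shifted cells nest: twice the shift at scale
  \<open>k + 1\<close> and the shift at scale \<open>k\<close> differ by an integer, which fails for
  a constant third.\<close>

definition grid_shift :: "bool \<Rightarrow> int \<Rightarrow> real" where
  "grid_shift s k = (if s then if even k then 1 / 3 else - 1 / 3 else 0)"

definition cell_index :: "bool \<Rightarrow> int \<Rightarrow> real \<Rightarrow> int" where
  "cell_index s k x = \<lfloor>x / 2 powi k + grid_shift s k\<rfloor>"

definition cell :: "bool \<Rightarrow> int \<Rightarrow> int \<Rightarrow> real set" where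
  "cell s k j = {x. cell_index s k x = j}"

lemma cell_eq: "cell s k j = {2 powi k * (of_int j - grid_shift s k)..<2 powi k * (of_int j + 1 - grid_shift s k)}"
proof -
  have "(0::real) < 2 powi k" by simp
  then show ?thesis
    by (auto simp: cell_def cell_index_def floor_eq_iff field_simps)
qed

text \<open>The index at the coarser scale depends on the point only through its index at the finer
  scale; this is the nesting of the grid.\<close>

lemma cell_index_Suc:
  "cell_index s (k + 1) x = (cell_index s k x + (if s then if even k then - 1 else 1 else 0)) div 2"
proof -
  let ?d = "(if s then if even k then - 1 else 1 else 0) :: int"
  have "x / 2 powi (k + 1) + grid_shift s (k + 1) = (x / 2 powi k + grid_shift s k + of_int ?d) / of_int 2"
    by (simp add: grid_shift_def power_int_add field_simps)
  then have "cell_index s (k + 1) x = \<lfloor>(x / 2 powi k + grid_shift s k + of_int ?d) / of_int 2\<rfloor>"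
    by (simp only: cell_index_def)
  also have "\<dots> = \<lfloor>x / 2 powi k + grid_shift s k + of_int ?d\<rfloor> div 2"
    by (rule floor_divide_real_eq_div) simp
  finally show ?thesis by (simp only: floor_add_int[symmetric] cell_index_def)
qed

lemma cell_index_coarser:
  assumes "k \<le> k'" "cell_index s k x = cell_index s k y"
  shows "cell_index s k' x = cell_index s k' y"
  using assms(1)
  by (induction rule: int_ge_induct) (use assms(2) in \<open>simp_all add: cell_index_Suc\<close>)

lemma cell_subset_or_disjoint:
  assumes "k \<le> k'"
  shows "cell s k j \<subseteq> cell s k' j' \<or> cell s k j \<inter> cell s k' j' = {}"
proof (cases "cell s k j \<inter> cell s k' j' = {}")
  case False
  then obtain x where x: "cell_index s k x = j" "cell_index s k' x = j'" by (auto simp: cell_def)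
  have "cell_index s k' y = j'" if "cell_index s k y = j" for y
    using cell_index_coarser[OF assms, of s y x] that x by simp
  then show ?thesis by (auto simp: cell_def)
qed simp

text \<open>Scales and positions are both cut off at \<open>n\<close>, because the tree estimates
  are for finite families; every cell is reached for large \<open>n\<close>.\<close>

definition grid :: "bool \<Rightarrow> nat \<Rightarrow> real set set" where
  "grid s n = (\<lambda>(k, j). cell s k j) ` ({- int n..int n} \<times> {- int n..int n})"

lemma measure_cell: "measure lborel (cell s k j) = 2 powi k" "emeasure lborel (cell s k j) = ennreal (2 powi k)"
  by (simp_all add: cell_eq right_diff_distrib distrib_left mult_right_mono)

lemma cell_nonempty: "cell s k j \<noteq> {}"
proof
  assume "cell s k j = {}"
  then have "measure lborel (cell s k j) = 0" by simp
  then show False by (simp add: measure_cell)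
qed

lemma laminar_grid: "laminar (grid s n)"
  unfolding laminar_def
proof (intro conjI ballI)
  fix A B assume "A \<in> grid s n" "B \<in> grid s n"
  then obtain k j k' j' where "A = cell s k j" "B = cell s k' j'" by (auto simp: grid_def)
  then show "A \<subseteq> B \<or> B \<subseteq> A \<or> A \<inter> B = {}"
    using cell_subset_or_disjoint[of k k' s j j'] cell_subset_or_disjoint[of k' k s j' j]
    by (metis inf_commute linear)
qed (use cell_nonempty in \<open>auto simp: grid_def\<close>)

lemma grid_half:
  assumes "A \<in> grid s n" "R \<in> grid s n" "A \<subset> R"
  shows "measure lborel A \<le> measure lborel R / 2"
proof -
  obtain k j k' j' where AR: "A = cell s k j" "R = cell s k' j'" using assms by (auto simp: grid_def)
  have "k < k'"
  proof (rule ccontr)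
    assume "\<not> k < k'"
    then have "R \<subseteq> A \<or> R \<inter> A = {}" using cell_subset_or_disjoint[of k' k s j' j] by (simp add: AR)
    then show False using assms(3) cell_nonempty[of s k j] AR by auto
  qed
  then have "(2::real) powi (k + 1) \<le> 2 powi k'" by (intro power_int_increasing) auto
  then show ?thesis by (simp add: AR measure_cell power_int_add)
qed

lemma grid_mono: "n \<le> m \<Longrightarrow> grid s n \<subseteq> grid s m"
  unfolding grid_def by (intro image_mono) auto

definition dyadic_kernel :: "real \<Rightarrow> bool \<Rightarrow> nat \<Rightarrow> real \<Rightarrow> real \<Rightarrow> real" where
  "dyadic_kernel \<alpha> s n x t = (\<Sum>Q\<in>grid s n. measure lborel Q powr (\<alpha> - 1) * (indicator Q x * indicator Q t))"

lemma dyadic_kernel_mono: "n \<le> m \<Longrightarrow> dyadic_kernel \<alpha> s n x t \<le> dyadic_kernel \<alpha> s m x t"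
  unfolding dyadic_kernel_def using grid_mono[of n m s] laminarD(1)[OF laminar_grid]
  by (intro sum_mono2) (auto simp: zero_le_mult_iff)

lemma dyadic_kernel_nonneg: "0 \<le> dyadic_kernel \<alpha> s n x t"
  unfolding dyadic_kernel_def by (intro sum_nonneg) auto

text \<open>The one-third trick: an interval shorter than a third of the cell length cannot contain
  an endpoint of a cell of both grids.\<close>

lemma common_cell:
  assumes "3 * \<bar>x - t\<bar> < 2 powi k"
  shows "\<exists>s. cell_index s k x = cell_index s k t"
proof (rule ccontr)
  assume neg: "\<not> ?thesis"
  define a b e where "a = min x t / 2 powi k" and "b = max x t / 2 powi k" and "e = grid_shift True k"
  have "(0::real) < 2 powi k" by simp
  then have ab: "b - a < 1 / 3" "a \<le> b"
    using assms by (auto simp: a_def b_def field_simps min_def max_def abs_if split: if_splits)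
  have neg': "cell_index False k x \<noteq> cell_index False k t" "cell_index True k x \<noteq> cell_index True k t"
    using neg by auto
  have "\<lfloor>a\<rfloor> \<noteq> \<lfloor>b\<rfloor>" "\<lfloor>a + e\<rfloor> \<noteq> \<lfloor>b + e\<rfloor>"
    using neg' unfolding cell_index_def a_def b_def e_def
    by (cases "x \<le> t"; simp add: min_def max_def grid_shift_def)+
  moreover have "\<lfloor>a\<rfloor> \<le> \<lfloor>b\<rfloor>" "\<lfloor>a + e\<rfloor> \<le> \<lfloor>b + e\<rfloor>" using ab by (auto intro: floor_mono)
  ultimately have "\<lfloor>a\<rfloor> < \<lfloor>b\<rfloor>" "\<lfloor>a + e\<rfloor> < \<lfloor>b + e\<rfloor>" by auto
  then have 1: "a < of_int \<lfloor>b\<rfloor>" "a + e < of_int \<lfloor>b + e\<rfloor>" by (simp_all add: floor_less_iff)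
  have 2: "of_int \<lfloor>b\<rfloor> \<le> b" "of_int \<lfloor>b + e\<rfloor> \<le> b + e" by simp_all
  define z where "z = \<lfloor>b\<rfloor> - \<lfloor>b + e\<rfloor>"
  have z: "of_int z + e < 1 / 3" "- 1 / 3 < of_int z + e" using 1 2 ab unfolding z_def by simp_all linarith+
  consider "z \<le> - 1" | "z = 0" | "1 \<le> z" by linarith
  then show False
  proof cases
    case 1
    then have "real_of_int z \<le> - 1" by linarith
    then show False using z by (auto simp: e_def grid_shift_def split: if_splits)
  next
    case 3
    then have "1 \<le> real_of_int z" by linarith
    then show False using z by (auto simp: e_def grid_shift_def split: if_splits)
  qed (use z in \<open>auto simp: e_def grid_shift_def split: if_splits\<close>)
qed

text \<open>A single cell suffices. At the scale with
  \<open>3 * \<bar>x - t\<bar> < 2 powi k \<le> 6 * \<bar>x - t\<bar>\<close> one of the grids has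
  both points in one cell, and its term dominates the kernel up to the factor
  \<open>6 powr (1 - \<alpha>) \<le> 6\<close>.\<close>

lemma kernel_le_dyadic:
  assumes "x \<noteq> t" "\<alpha> < 1" "0 < \<alpha>"
  shows "\<exists>n. \<bar>x - t\<bar> powr (\<alpha> - 1) \<le> 6 * (dyadic_kernel \<alpha> False n x t + dyadic_kernel \<alpha> True n x t)"
proof -
  define d where "d = \<bar>x - t\<bar>"
  have d: "0 < d" using assms by (simp add: d_def)
  define k where "k = \<lfloor>log 2 (3 * d)\<rfloor> + 1"
  have pw: "(2::real) powi k = 2 powr of_int k" by (simp add: powr_real_of_int')
  have "3 * d < 2 powi k"
    unfolding pw using d by (subst log_less_iff[symmetric]) (auto simp: k_def)
  moreover have "2 powi k \<le> 6 * d"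
  proof -
    have "2 powr (of_int k - 1) \<le> 3 * d"
      using d by (subst le_log_iff[symmetric]) (auto simp: k_def)
    then show ?thesis by (simp add: pw powr_diff)
  qed
  ultimately obtain s where s: "cell_index s k x = cell_index s k t" and k6: "2 powi k \<le> 6 * d"
    using common_cell[of x t k] by (auto simp: d_def)
  define n where "n = nat (max \<bar>k\<bar> \<bar>cell_index s k x\<bar>)"
  let ?Q = "cell s k (cell_index s k x)"
  have Q: "?Q \<in> grid s n" unfolding grid_def n_def by (intro image_eqI[of _ _ "(k, cell_index s k x)"]) auto
  have xt: "x \<in> ?Q" "t \<in> ?Q" using s by (auto simp: cell_def)
  have "d powr (\<alpha> - 1) \<le> (2 powi k / 6) powr (\<alpha> - 1)"
    using k6 d assms by (intro powr_mono2') auto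
  also have "\<dots> = 6 powr (1 - \<alpha>) * (2 powi k) powr (\<alpha> - 1)"
    using powr_minus_divide[of 6 "\<alpha> - 1"] by (simp add: powr_divide)
  also have "\<dots> \<le> 6 powr 1 * (2 powi k) powr (\<alpha> - 1)"
    using assms by (intro mult_right_mono powr_mono) auto
  also have "(2 powi k) powr (\<alpha> - 1) = measure lborel ?Q powr (\<alpha> - 1) * (indicator ?Q x * indicator ?Q t)"
    using xt by (simp add: measure_cell)
  also have "\<dots> \<le> dyadic_kernel \<alpha> s n x t"
    unfolding dyadic_kernel_def using Q laminarD(1)[OF laminar_grid]
    by (intro member_le_sum[where f = "\<lambda>Q. measure lborel Q powr (\<alpha> - 1) * (indicator Q x * indicator Q t)"]) auto
  also have "\<dots> \<le> dyadic_kernel \<alpha> False n x t + dyadic_kernel \<alpha> True n x t"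
    using dyadic_kernel_nonneg[of \<alpha> False n x t] dyadic_kernel_nonneg[of \<alpha> True n x t]
    by (cases s) auto
  finally show ?thesis by (auto simp: d_def)
qed

section \<open>The one-dimensional inequality\<close>

lemma average_eq_density:
  assumes [measurable]: "g \<in> borel_measurable borel" "S \<in> sets borel"
  shows "average S g = emeasure (density lborel (\<lambda>x. ennreal (g x))) S / emeasure lborel S"
  unfolding average_def by (simp add: nn_integral_completion emeasure_density)

text \<open>The weight is positive, so neither factor of the Muckenhoupt product is 0 and a finite
  product forces both masses to be finite. Passing from closed to half-open intervals matches the
  cells.\<close>

lemma (in exponents) interval_bounds:
  fixes v :: "real \<Rightarrow> real"
  assumes [measurable]: "v \<in> borel_measurable borel" and v: "\<And>x. 0 < v x" and ab: "a < b" and X: "0 \<le> X"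
    and bd: "average {a..b} (\<lambda>s. v s powr q) * ennreal_powr (average {a..b} (\<lambda>s. v s powr - p')) (q / p') \<le> ennreal X"
  defines "N1 \<equiv> density lborel (\<lambda>x. ennreal (v x powr - p'))"
    and "N2 \<equiv> density lborel (\<lambda>x. ennreal (v x powr q))"
  shows "emeasure N1 {a..<b} < \<infinity>" "emeasure N2 {a..<b} < \<infinity>"
    "measure N1 {a..<b} powr (1 / p') * measure N2 {a..<b} powr (1 / q) \<le> X powr (1 / q) * (b - a) powr (1 - \<alpha>)"
proof -
  note basic = p_gt_1 q_gt_1 p'_gt_1 q'_gt_1 alpha_pos alpha_less_1 p_less_q
  define L where "L = b - a"
  have L: "0 < L" using ab by (simp add: L_def)
  have vpow: "0 < v x powr e" for x e using v[of x] by simp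
  have "0 < emeasure lborel {a..b}" using ab by simp
  then have posN: "0 < emeasure N1 {a..b}" "0 < emeasure N2 {a..b}"
    unfolding N1_def N2_def using vpow by (auto intro!: emeasure_density_pos)
  have av: "average {a..b} (\<lambda>s. v s powr q) = emeasure N2 {a..b} / ennreal L"
    "average {a..b} (\<lambda>s. v s powr - p') = emeasure N1 {a..b} / ennreal L"
    using ab by (simp_all add: average_eq_density N1_def N2_def L_def)
  have top1: "emeasure N1 {a..b} \<noteq> top"
  proof
    assume "emeasure N1 {a..b} = top"
    then have "emeasure N2 {a..b} / ennreal L * top \<le> ennreal X"
      using bd L by (simp add: av ennreal_top_divide)
    moreover have "emeasure N2 {a..b} / ennreal L \<noteq> 0" using posN by (simp add: ennreal_divide_eq_0_iff)
    ultimately show False by (simp add: ennreal_mult_top top_unique)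
  qed
  have top2: "emeasure N2 {a..b} \<noteq> top"
  proof
    assume "emeasure N2 {a..b} = top"
    then have "top * ennreal_powr (emeasure N1 {a..b} / ennreal L) (q / p') \<le> ennreal X"
      using bd L by (simp add: av ennreal_top_divide)
    moreover have "emeasure N1 {a..b} / ennreal L \<noteq> 0" using posN by (simp add: ennreal_divide_eq_0_iff)
    ultimately show False by (simp add: ennreal_top_mult top_unique)
  qed
  define s u where "s = measure N1 {a..b}" and "u = measure N2 {a..b}"
  have su: "emeasure N1 {a..b} = ennreal s" "emeasure N2 {a..b} = ennreal u"
    using top1 top2 by (simp_all add: s_def u_def emeasure_eq_ennreal_measure)
  have pos: "0 < s" "0 < u" using posN by (auto simp: su)
  have "ennreal ((u / L) * (s / L) powr (q / p')) \<le> ennreal X"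
    using bd pos L by (subst ennreal_mult) (simp_all add: av su divide_ennreal ennreal_powr_ennreal)
  then have "(u / L) * (s / L) powr (q / p') \<le> X" using X by simp
  then have "((u / L) * (s / L) powr (q / p')) powr (1 / q) \<le> X powr (1 / q)"
    using pos L basic by (intro powr_mono2) auto
  also have "((u / L) * (s / L) powr (q / p')) powr (1 / q) = s powr (1 / p') * u powr (1 / q) / L powr (1 / q + 1 / p')"
    using basic by (simp add: powr_mult powr_divide powr_powr powr_add)
  finally have main: "s powr (1 / p') * u powr (1 / q) \<le> X powr (1 / q) * (b - a) powr (1 - \<alpha>)"
    using L by (simp add: inv_q_p' divide_le_eq L_def)
  have le: "emeasure N1 {a..<b} \<le> emeasure N1 {a..b}" "emeasure N2 {a..<b} \<le> emeasure N2 {a..b}"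
    by (auto intro!: emeasure_mono simp: N1_def N2_def)
  then show "emeasure N1 {a..<b} < \<infinity>" "emeasure N2 {a..<b} < \<infinity>"
    by (auto simp: su intro: le_less_trans)
  have "measure N1 {a..<b} \<le> s" "measure N2 {a..<b} \<le> u"
    using le pos unfolding su by (auto simp: measure_def enn2real_leI)
  then have "measure N1 {a..<b} powr (1 / p') * measure N2 {a..<b} powr (1 / q) \<le> s powr (1 / p') * u powr (1 / q)"
    using basic by (intro mult_mono powr_mono2) auto
  then show "measure N1 {a..<b} powr (1 / p') * measure N2 {a..<b} powr (1 / q) \<le> X powr (1 / q) * (b - a) powr (1 - \<alpha>)"
    using main by linarith
qed

text \<open>The shifts are thirds, hence rational. Only countably many intervals are then involved,
  so the Muckenhoupt condition can be verified interval by interval for almost every slice.\<close>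

lemma cell_rational:
  obtains a b where "a \<in> \<rat>" "b \<in> \<rat>" "a < b" "cell s k j = {a..<b}"
proof
  show "2 powi k * (of_int j - grid_shift s k) \<in> \<rat>" "2 powi k * (of_int j + 1 - grid_shift s k) \<in> \<rat>"
    by (auto simp: grid_shift_def power_int_def)
qed (auto simp: cell_eq)

text \<open>The factor 24 is 6 from the kernel comparison, 2 for the sum of two grids and 2 for
  adding the two \<open>q\<close>-th powers. The added 1 makes the constant positive.\<close>

definition (in exponents) one_dim_const :: real where
  "one_dim_const = 24 * (family_const + 1)"

lemma (in exponents) one_dim_const_pos: "0 < one_dim_const"
  by (simp add: one_dim_const_def family_const_def add_nonneg_pos)

text \<open>With \<open>f = h * v powr p'\<close>, integrals of \<open>h\<close> over cubes become
  integrals of \<open>f\<close> against \<open>N1\<close>, and \<open>p' * p - p' = p\<close> turns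
  the weighted norm of \<open>h\<close> into the norm of \<open>f\<close> for \<open>N1\<close>. The
  finite potentials increase to a majorant of the full one, and monotone convergence preserves their
  uniform bound.\<close>

lemma (in exponents) one_dim_normalized:
  fixes v h :: "real \<Rightarrow> real"
  assumes [measurable]: "v \<in> borel_measurable borel" "h \<in> borel_measurable borel"
    and v: "\<And>x. 0 < v x" and h: "\<And>x. 0 \<le> h x" and X: "1 \<le> X"
    and bd: "\<And>a b. a \<in> \<rat> \<Longrightarrow> b \<in> \<rat> \<Longrightarrow> a < b \<Longrightarrow>
      average {a..b} (\<lambda>s. v s powr q) * ennreal_powr (average {a..b} (\<lambda>s. v s powr - p')) (q / p') \<le> ennreal X"
    and norm: "(\<integral>\<^sup>+x. ennreal ((v x * h x) powr p) \<partial>lborel) \<le> 1"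
  shows "(\<integral>\<^sup>+x. ennreal_powr (ennreal (v x) * (\<integral>\<^sup>+t. ennreal (h t) * ennreal (\<bar>x - t\<bar> powr (\<alpha> - 1)) \<partial>lborel)) q \<partial>lborel)
    \<le> ennreal ((one_dim_const * X powr (max 1 (p' / q) * (1 - \<alpha>))) powr q)"
proof -
  note basic = p_gt_1 q_gt_1 p'_gt_1 q'_gt_1 alpha_pos alpha_less_1 p_less_q
  let ?\<beta> = "max 1 (p' / q) * (1 - \<alpha>)"
  define N1 where "N1 = density lborel (\<lambda>x. ennreal (v x powr - p'))"
  define N2 where "N2 = density lborel (\<lambda>x. ennreal (v x powr q))"
  define f where "f x = h x * v x powr p'" for x
  have [measurable]: "f \<in> borel_measurable borel" unfolding f_def by measurable
  have f0: "0 \<le> f x" for x using h by (simp add: f_def)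
  have pp: "p' * p - p' = p" using conj_p basic by (simp add: field_simps)
  have fp: "v x powr - p' * f x powr p = (v x * h x) powr p" for x
  proof -
    have "v x powr - p' * f x powr p = h x powr p * (v x powr - p' * v x powr (p' * p))"
      by (simp add: f_def powr_mult powr_powr)
    also have "v x powr - p' * v x powr (p' * p) = v x powr p"
      using v[of x] by (simp add: powr_add[symmetric] pp)
    finally show ?thesis by (simp add: powr_mult mult.commute)
  qed
  have nnf: "(\<integral>\<^sup>+x. ennreal (f x powr p) \<partial>N1) \<le> 1"
  proof -
    have "(\<integral>\<^sup>+x. ennreal (f x powr p) \<partial>N1) = (\<integral>\<^sup>+x. ennreal (v x powr - p') * ennreal (f x powr p) \<partial>lborel)"
      by (simp add: N1_def nn_integral_density)
    also have "\<dots> = (\<integral>\<^sup>+x. ennreal ((v x * h x) powr p) \<partial>lborel)"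
      by (simp add: fp flip: ennreal_mult)
    finally show ?thesis using norm by simp
  qed
  have fint: "integrable N1 (\<lambda>x. f x powr p)"
    using nnf by (intro integrableI_bounded) (auto simp: N1_def intro: le_less_trans)
  have f1: "(\<integral>x. f x powr p \<partial>N1) \<le> 1"
  proof -
    have "ennreal (\<integral>x. f x powr p \<partial>N1) \<le> 1"
      using nnf nn_integral_eq_integral[OF fint] by simp
    then show ?thesis by simp
  qed
  define T where "T s n x = (\<Sum>Q\<in>grid s n. measure lborel Q powr (\<alpha> - 1) * (\<integral>t. indicator Q t * f t \<partial>N1) * indicator Q x)" for s n x
  have gridE: "\<exists>k j a b. Q = cell s k j \<and> a \<in> \<rat> \<and> b \<in> \<rat> \<and> a < b \<and> Q = {a..<b}" if "Q \<in> grid s n" for Q s n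
    using that cell_rational unfolding grid_def by (auto) (metis)
  have Qb: "Q \<in> sets borel" "emeasure lborel Q < \<infinity>" "0 < measure lborel Q" 
    "emeasure N1 Q < \<infinity>" "emeasure N2 Q < \<infinity>"
    "measure N1 Q powr (1 / p') * measure N2 Q powr (1 / q) \<le> X powr (1 / q) * measure lborel Q powr (1 - \<alpha>)"
    if inG: "Q \<in> grid s n" for Q s n
  proof -
    obtain a b where ab: "a \<in> \<rat>" "b \<in> \<rat>" "a < b" "Q = {a..<b}" using gridE[OF inG] by blast
    show "Q \<in> sets borel" "emeasure lborel Q < \<infinity>" "0 < measure lborel Q" using ab by auto
    show "emeasure N1 Q < \<infinity>" "emeasure N2 Q < \<infinity>"
      "measure N1 Q powr (1 / p') * measure N2 Q powr (1 / q) \<le> X powr (1 / q) * measure lborel Q powr (1 - \<alpha>)"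
      using interval_bounds[OF _ v \<open>a < b\<close> _ bd[OF ab(1-3)]] X ab unfolding N1_def N2_def by auto
  qed
  have Tmeas [measurable]: "T s n \<in> borel_measurable borel" for s n
    unfolding T_def using Qb(1) by measurable
  have T0: "0 \<le> T s n x" for s n x
    unfolding T_def using f0 by (intro sum_nonneg mult_nonneg_nonneg integral_nonneg_AE) auto
  have Tbound: "(\<integral>\<^sup>+x. ennreal (T s n x powr q) \<partial>N2) \<le> ennreal ((family_const * X powr ?\<beta>) powr q)" for s n
    unfolding T_def N1_def N2_def
    by (rule finite_family_bound[OF _ _ v X laminar_grid])
      (use Qb f0 fint f1 grid_half in \<open>auto simp: N1_def[symmetric] N2_def[symmetric]\<close>)
  have T_kernel: "(\<integral>\<^sup>+t. ennreal (h t) * ennreal (dyadic_kernel \<alpha> s n x t) \<partial>lborel) = ennreal (T s n x)" for s n x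
  proof -
    have "(\<integral>\<^sup>+t. ennreal (h t) * ennreal (dyadic_kernel \<alpha> s n x t) \<partial>lborel)
        = (\<integral>\<^sup>+t. (\<Sum>Q\<in>grid s n. ennreal (measure lborel Q powr (\<alpha> - 1) * indicator Q x) * (ennreal (h t) * indicator Q t)) \<partial>lborel)"
    proof (rule nn_integral_cong)
      fix t
      have "h t * dyadic_kernel \<alpha> s n x t = (\<Sum>Q\<in>grid s n. (measure lborel Q powr (\<alpha> - 1) * indicator Q x) * (h t * indicator Q t))"
        by (simp add: dyadic_kernel_def sum_distrib_left mult_ac)
      then have "ennreal (h t) * ennreal (dyadic_kernel \<alpha> s n x t)
          = ennreal (\<Sum>Q\<in>grid s n. (measure lborel Q powr (\<alpha> - 1) * indicator Q x) * (h t * indicator Q t))"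
        using h dyadic_kernel_nonneg by (simp flip: ennreal_mult)
      also have "\<dots> = (\<Sum>Q\<in>grid s n. ennreal ((measure lborel Q powr (\<alpha> - 1) * indicator Q x) * (h t * indicator Q t)))"
        using h by (intro sum_ennreal[symmetric]) auto
      also have "\<dots> = (\<Sum>Q\<in>grid s n. ennreal (measure lborel Q powr (\<alpha> - 1) * indicator Q x) * (ennreal (h t) * indicator Q t))"
        using h by (intro sum.cong) (auto simp: ennreal_mult indicator_def)
      finally show "ennreal (h t) * ennreal (dyadic_kernel \<alpha> s n x t)
          = (\<Sum>Q\<in>grid s n. ennreal (measure lborel Q powr (\<alpha> - 1) * indicator Q x) * (ennreal (h t) * indicator Q t))" .
    qed
    also have "\<dots> = (\<Sum>Q\<in>grid s n. \<integral>\<^sup>+t. ennreal (measure lborel Q powr (\<alpha> - 1) * indicator Q x) * (ennreal (h t) * indicator Q t) \<partial>lborel)"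
    proof (rule nn_integral_sum)
      fix Q assume "Q \<in> grid s n"
      note [measurable] = Qb(1)[OF this]
      show "(\<lambda>t. ennreal (measure lborel Q powr (\<alpha> - 1) * indicator Q x) * (ennreal (h t) * indicator Q t)) \<in> borel_measurable lborel"
        by measurable
    qed
    also have "\<dots> = (\<Sum>Q\<in>grid s n. ennreal (measure lborel Q powr (\<alpha> - 1) * (\<integral>t. indicator Q t * f t \<partial>N1) * indicator Q x))"
    proof (rule sum.cong[OF refl])
      fix Q assume Q: "Q \<in> grid s n"
      note [measurable] = Qb(1)[OF Q]
      have "ennreal (\<integral>t. indicator Q t * f t \<partial>N1) = (\<integral>\<^sup>+t. ennreal (indicator Q t * f t) \<partial>N1)"
        using Qb[OF Q] f0 fint basic
        by (intro nn_integral_eq_integral[symmetric] indicator_times_integrable[of p]) (auto simp: N1_def)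
      also have "\<dots> = (\<integral>\<^sup>+t. ennreal (v t powr - p') * ennreal (indicator Q t * f t) \<partial>lborel)"
        unfolding N1_def by (intro nn_integral_density) auto
      also have "\<dots> = (\<integral>\<^sup>+t. ennreal (h t) * indicator Q t \<partial>lborel)"
      proof (rule nn_integral_cong)
        fix t
        have "v t powr - p' * v t powr p' = 1" using v[of t] by (simp flip: powr_add)
        then have "v t powr - p' * (indicator Q t * f t) = h t * indicator Q t"
          by (simp add: f_def mult_ac)
        then show "ennreal (v t powr - p') * ennreal (indicator Q t * f t) = ennreal (h t) * indicator Q t"
          using f0 h by (auto simp: indicator_def simp flip: ennreal_mult)
      qed
      finally have e: "(\<integral>\<^sup>+t. ennreal (h t) * indicator Q t \<partial>lborel) = ennreal (\<integral>t. indicator Q t * f t \<partial>N1)" by simp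
      have "(\<integral>\<^sup>+t. ennreal (measure lborel Q powr (\<alpha> - 1) * indicator Q x) * (ennreal (h t) * indicator Q t) \<partial>lborel)
          = ennreal (measure lborel Q powr (\<alpha> - 1) * indicator Q x) * ennreal (\<integral>t. indicator Q t * f t \<partial>N1)"
        unfolding e[symmetric] by (intro nn_integral_cmult) measurable
      also have "\<dots> = ennreal (measure lborel Q powr (\<alpha> - 1) * (\<integral>t. indicator Q t * f t \<partial>N1) * indicator Q x)"
        using f0 by (subst ennreal_mult[symmetric]) (auto intro!: integral_nonneg_AE simp: mult_ac)
      finally show "(\<integral>\<^sup>+t. ennreal (measure lborel Q powr (\<alpha> - 1) * indicator Q x) * (ennreal (h t) * indicator Q t) \<partial>lborel)
          = ennreal (measure lborel Q powr (\<alpha> - 1) * (\<integral>t. indicator Q t * f t \<partial>N1) * indicator Q x)" .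
    qed
    also have "\<dots> = ennreal (T s n x)"
      unfolding T_def using f0 by (intro sum_ennreal mult_nonneg_nonneg integral_nonneg_AE) auto
    finally show ?thesis .
  qed
  define k where "k n x t = 6 * (dyadic_kernel \<alpha> False n x t + dyadic_kernel \<alpha> True n x t)" for n x t
  have kmono: "k n x t \<le> k m x t" if "n \<le> m" for n m x t
    unfolding k_def by (intro mult_left_mono add_mono dyadic_kernel_mono that) auto
  have kmeas [measurable]: "(\<lambda>t. dyadic_kernel \<alpha> s n x t) \<in> borel_measurable borel" for s n x
    unfolding dyadic_kernel_def using Qb(1) by measurable
  have T_int: "(\<integral>\<^sup>+t. ennreal (h t) * ennreal (k n x t) \<partial>lborel) = ennreal (6 * (T False n x + T True n x))" for n x
  proof -
    have "(\<integral>\<^sup>+t. ennreal (h t) * ennreal (k n x t) \<partial>lborel)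
        = (\<integral>\<^sup>+t. 6 * (ennreal (h t) * ennreal (dyadic_kernel \<alpha> False n x t) + ennreal (h t) * ennreal (dyadic_kernel \<alpha> True n x t)) \<partial>lborel)"
      using dyadic_kernel_nonneg by (intro nn_integral_cong) (simp add: k_def ennreal_mult' distrib_left mult_ac)
    also have "\<dots> = 6 * (ennreal (T False n x) + ennreal (T True n x))"
      by (simp add: nn_integral_cmult nn_integral_add T_kernel)
    finally show ?thesis using T0 by (simp add: ennreal_mult' ennreal_plus)
  qed
  have incT: "6 * (T False n x + T True n x) \<le> 6 * (T False m x + T True m x)" if "n \<le> m" for n m x
  proof -
    have "ennreal (6 * (T False n x + T True n x)) \<le> ennreal (6 * (T False m x + T True m x))"
      unfolding T_int[symmetric] using kmono[OF that] by (intro nn_integral_mono mult_left_mono ennreal_leI) auto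
    moreover have "0 \<le> 6 * (T False m x + T True m x)" using T0 by simp
    ultimately show ?thesis using ennreal_le_iff by blast
  qed
  have J: "(\<integral>\<^sup>+t. ennreal (h t) * ennreal (\<bar>x - t\<bar> powr (\<alpha> - 1)) \<partial>lborel)
      \<le> (SUP n. ennreal (6 * (T False n x + T True n x)))" for x
  proof -
    have "(\<integral>\<^sup>+t. ennreal (h t) * ennreal (\<bar>x - t\<bar> powr (\<alpha> - 1)) \<partial>lborel)
        \<le> (\<integral>\<^sup>+t. (SUP n. ennreal (h t) * ennreal (k n x t)) \<partial>lborel)"
    proof (rule nn_integral_mono)
      fix t
      show "ennreal (h t) * ennreal (\<bar>x - t\<bar> powr (\<alpha> - 1)) \<le> (SUP n. ennreal (h t) * ennreal (k n x t))"
      \<comment> \<open>On the diagonal the kernel has the value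
        \<open>0 powr (\<alpha> - 1) = 0\<close>, so only distinct points need a cell.\<close>
      proof (cases "x = t")
        case False
        from kernel_le_dyadic[OF False alpha_less_1 alpha_pos]
        obtain n where "\<bar>x - t\<bar> powr (\<alpha> - 1) \<le> k n x t" by (auto simp: k_def)
        then have "ennreal (h t) * ennreal (\<bar>x - t\<bar> powr (\<alpha> - 1)) \<le> ennreal (h t) * ennreal (k n x t)"
          by (intro mult_left_mono ennreal_leI) auto
        also have "\<dots> \<le> (SUP n. ennreal (h t) * ennreal (k n x t))" by (rule SUP_upper) simp
        finally show ?thesis .
      qed simp
    qed
    also have "\<dots> = (SUP n. \<integral>\<^sup>+t. ennreal (h t) * ennreal (k n x t) \<partial>lborel)"
    proof (rule nn_integral_monotone_convergence_SUP)
      show "incseq (\<lambda>n t. ennreal (h t) * ennreal (k n x t))"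
        using kmono by (intro monoI le_funI mult_left_mono ennreal_leI) auto
      show "(\<lambda>t. ennreal (h t) * ennreal (k n x t)) \<in> borel_measurable lborel" for n
        unfolding k_def by measurable
    qed
    finally show ?thesis by (simp add: T_int)
  qed
  let ?g = "\<lambda>n x. ennreal ((v x * (6 * (T False n x + T True n x))) powr q)"
  have "(\<integral>\<^sup>+x. ennreal_powr (ennreal (v x) * (\<integral>\<^sup>+t. ennreal (h t) * ennreal (\<bar>x - t\<bar> powr (\<alpha> - 1)) \<partial>lborel)) q \<partial>lborel)
      \<le> (\<integral>\<^sup>+x. (SUP n. ?g n x) \<partial>lborel)"
  proof (rule nn_integral_mono)
    fix x
    have "ennreal_powr (ennreal (v x) * (\<integral>\<^sup>+t. ennreal (h t) * ennreal (\<bar>x - t\<bar> powr (\<alpha> - 1)) \<partial>lborel)) q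
        \<le> ennreal_powr (ennreal (v x) * (SUP n. ennreal (6 * (T False n x + T True n x)))) q"
      using J basic by (intro ennreal_powr_mono mult_left_mono) auto
    also have "\<dots> = (SUP n. ennreal_powr (ennreal (v x) * ennreal (6 * (T False n x + T True n x))) q)"
      using basic by (subst SUP_mult_left_ennreal) (simp add: ennreal_powr_SUP)
    also have "\<dots> = (SUP n. ?g n x)"
    proof (intro SUP_cong refl)
      fix n
      have nn: "0 \<le> v x" "0 \<le> 6 * (T False n x + T True n x)" using v[of x] T0 by auto
      show "ennreal_powr (ennreal (v x) * ennreal (6 * (T False n x + T True n x))) q = ?g n x"
        unfolding ennreal_mult[OF nn, symmetric] by (rule ennreal_powr_ennreal[OF mult_nonneg_nonneg[OF nn]])
    qed
    finally show "ennreal_powr (ennreal (v x) * (\<integral>\<^sup>+t. ennreal (h t) * ennreal (\<bar>x - t\<bar> powr (\<alpha> - 1)) \<partial>lborel)) q \<le> (SUP n. ?g n x)" .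
  qed
  also have "\<dots> = (SUP n. \<integral>\<^sup>+x. ?g n x \<partial>lborel)"
  proof (rule nn_integral_monotone_convergence_SUP)
    show "incseq ?g"
    proof (intro monoI le_funI ennreal_leI powr_mono2)
      fix n m :: nat and x assume "n \<le> m"
      show "v x * (6 * (T False n x + T True n x)) \<le> v x * (6 * (T False m x + T True m x))"
        by (rule mult_left_mono[OF incT[OF \<open>n \<le> m\<close>] less_imp_le[OF v]])
    qed (use basic v T0 in \<open>auto simp: less_imp_le\<close>)
  qed measurable
  also have "\<dots> \<le> ennreal ((one_dim_const * X powr ?\<beta>) powr q)"
  proof (rule SUP_least)
    fix n :: nat
    let ?b = "(family_const * X powr ?\<beta>) powr q"
    have "(\<integral>\<^sup>+x. ?g n x \<partial>lborel)
        \<le> (\<integral>\<^sup>+x. ennreal (12 powr q) * (ennreal (v x powr q) * ennreal (T False n x powr q) + ennreal (v x powr q) * ennreal (T True n x powr q)) \<partial>lborel)"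
    proof (rule nn_integral_mono)
      fix x
      \<comment> \<open>The sum of the two potentials is at most twice the larger one, whose
        \<open>q\<close>-th power is bounded by the sum of both powers; hence
        \<open>12 = 6 * 2\<close>.\<close>
      define m where "m = max (T False n x) (T True n x)"
      have "(v x * (6 * (T False n x + T True n x))) powr q \<le> (v x * (12 * m)) powr q"
        using v[of x] T0 basic by (intro powr_mono2 mult_left_mono mult_nonneg_nonneg add_nonneg_nonneg) (auto simp: m_def)
      also have "\<dots> = 12 powr q * (v x powr q * m powr q)" by (simp add: powr_mult)
      also have "m powr q \<le> T False n x powr q + T True n x powr q" by (simp add: m_def max_def)
      finally have "(v x * (6 * (T False n x + T True n x))) powr q
          \<le> 12 powr q * (v x powr q * T False n x powr q + v x powr q * T True n x powr q)"
        by (simp add: distrib_left mult_left_mono)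
      then have "?g n x \<le> ennreal (12 powr q * (v x powr q * T False n x powr q + v x powr q * T True n x powr q))"
        by (rule ennreal_leI)
      also have "\<dots> = ennreal (12 powr q) * (ennreal (v x powr q) * ennreal (T False n x powr q) + ennreal (v x powr q) * ennreal (T True n x powr q))"
        by (simp add: ennreal_mult)
      finally show "?g n x \<le> ennreal (12 powr q) * (ennreal (v x powr q) * ennreal (T False n x powr q) + ennreal (v x powr q) * ennreal (T True n x powr q))" .
    qed
    also have "\<dots> = ennreal (12 powr q) * ((\<integral>\<^sup>+x. ennreal (T False n x powr q) \<partial>N2) + (\<integral>\<^sup>+x. ennreal (T True n x powr q) \<partial>N2))"
      by (simp add: nn_integral_cmult nn_integral_add N2_def nn_integral_density)
    also have "\<dots> \<le> ennreal (12 powr q) * (ennreal ?b + ennreal ?b)"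
      using Tbound by (intro mult_left_mono add_mono) auto
    also have "\<dots> = ennreal (2 * (12 powr q * ?b))" by (simp add: ennreal_mult mult_ac flip: ennreal_plus)
    also have "\<dots> \<le> ennreal (2 powr q * (12 powr q * ?b))"
      using basic powr_mono[of 1 q 2] by (intro ennreal_leI mult_right_mono) auto
    also have "2 powr q * (12 powr q * ?b) = (24 * (family_const * X powr ?\<beta>)) powr q"
      by (simp add: powr_mult)
        (simp add: mult.assoc[symmetric] powr_mult[symmetric])
    also have "\<dots> \<le> (one_dim_const * X powr ?\<beta>) powr q"
      using basic X by (intro powr_mono2) (auto simp: one_dim_const_def family_const_def distrib_right distrib_left)
    finally show "(\<integral>\<^sup>+x. ?g n x \<partial>lborel) \<le> ennreal ((one_dim_const * X powr ?\<beta>) powr q)"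
      by (simp add: ennreal_leI)
  qed
  finally show ?thesis .
qed

text \<open>Homogeneity reduces the claim to norm 1. In several variables \<open>h\<close> is a
  slice of an iterated potential and may be infinite, and a slice of the weight is positive only
  almost everywhere; \<open>h0\<close> and \<open>v0\<close> repair both on null sets, which no
  integral notices.\<close>

theorem (in exponents) one_dim:
  fixes v :: "real \<Rightarrow> real" and h :: "real \<Rightarrow> ennreal"
  assumes [measurable]: "v \<in> borel_measurable borel" "h \<in> borel_measurable borel"
    and v: "AE x in lborel. 0 < v x" and X: "1 \<le> X"
    and bd: "\<And>a b. a \<in> \<rat> \<Longrightarrow> b \<in> \<rat> \<Longrightarrow> a < b \<Longrightarrow>
      average {a..b} (\<lambda>s. v s powr q) * ennreal_powr (average {a..b} (\<lambda>s. v s powr - p')) (q / p') \<le> ennreal X"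
  shows "(\<integral>\<^sup>+x. ennreal_powr (ennreal (v x) * (\<integral>\<^sup>+t. h t * ennreal (\<bar>x - t\<bar> powr (\<alpha> - 1)) \<partial>lborel)) q \<partial>lborel)
    \<le> ennreal ((one_dim_const * X powr (max 1 (p' / q) * (1 - \<alpha>))) powr q) *
      ennreal_powr (\<integral>\<^sup>+x. ennreal_powr (ennreal (v x) * h x) p \<partial>lborel) (q / p)"
proof -
  note basic = p_gt_1 q_gt_1 p'_gt_1 q'_gt_1 alpha_pos alpha_less_1 p_less_q
  let ?C = "(one_dim_const * X powr (max 1 (p' / q) * (1 - \<alpha>))) powr q"
  have C: "0 < ?C" using one_dim_const_pos X by simp
  define v0 where "v0 x = (if 0 < v x then v x else 1)" for x
  have [measurable]: "v0 \<in> borel_measurable borel" unfolding v0_def by measurable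
  have v0: "AE x in lborel. v x = v0 x" using v by eventually_elim (simp add: v0_def)
  have v0p: "0 < v0 x" for x by (simp add: v0_def)
  have av: "average S (\<lambda>s. v s powr e) = average S (\<lambda>s. v0 s powr e)" for S e
    unfolding average_def nn_integral_completion using v0
    by (intro arg_cong2[where f="(/)"] nn_integral_cong_AE refl) auto
  define Y where "Y = (\<integral>\<^sup>+x. ennreal_powr (ennreal (v x) * h x) p \<partial>lborel)"
  have Yeq: "Y = (\<integral>\<^sup>+x. ennreal_powr (ennreal (v0 x) * h x) p \<partial>lborel)"
    unfolding Y_def using v0 by (intro nn_integral_cong_AE) auto
  define J where "J h x = (\<integral>\<^sup>+t. h t * ennreal (\<bar>x - t\<bar> powr (\<alpha> - 1)) \<partial>lborel)" for h :: "real \<Rightarrow> ennreal" and x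
  have Jcong: "J h1 x = J h2 x" if "AE t in lborel. h1 t = h2 t" for h1 h2 x
    unfolding J_def using that by (intro nn_integral_cong_AE) auto
  have L: "(\<integral>\<^sup>+x. ennreal_powr (ennreal (v x) * J h x) q \<partial>lborel) = (\<integral>\<^sup>+x. ennreal_powr (ennreal (v0 x) * J h x) q \<partial>lborel)"
    using v0 by (intro nn_integral_cong_AE) auto
  consider "Y = top" | "Y = 0" | y where "Y = ennreal y" "0 < y"
    by (cases Y) (auto simp: less_le)
  then have "(\<integral>\<^sup>+x. ennreal_powr (ennreal (v0 x) * J h x) q \<partial>lborel) \<le> ennreal ?C * ennreal_powr Y (q / p)"
  proof cases
    case 1
    then show ?thesis using C by (simp add: ennreal_mult_top)
  next
    case 2
    have "AE x in lborel. ennreal_powr (ennreal (v0 x) * h x) p = 0"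
      using 2 unfolding Yeq by (subst (asm) nn_integral_0_iff_AE) auto
    then have "AE x in lborel. h x = 0" 
    proof eventually_elim
      case (elim x)
      then show ?case using v0p[of x] by (simp add: ennreal_eq_0_iff)
    qed
    from Jcong[OF this] have "J h x = 0" for x by (simp add: J_def)
    then show ?thesis by simp
  next
    case 3
    define c where "c = y powr (1 / p)"
    have c: "0 < c" using 3 by (simp add: c_def)
    define h0 where "h0 t = enn2real (h t) / c" for t
    have [measurable]: "h0 \<in> borel_measurable borel" unfolding h0_def by measurable
    have h00: "0 \<le> h0 t" for t using c by (simp add: h0_def)
    have "AE x in lborel. ennreal_powr (ennreal (v0 x) * h x) p \<noteq> \<infinity>"
      using 3 unfolding Yeq by (intro nn_integral_noteq_infinite) auto
    then have h: "AE t in lborel. h t = ennreal c * ennreal (h0 t)"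
    proof eventually_elim
      case (elim t)
      then have "h t \<noteq> top" using v0p[of t] by (auto simp: ennreal_mult_top)
      then show ?case using c by (simp add: h0_def less_top flip: ennreal_mult)
    qed
    have Jc: "J h x = ennreal c * J (\<lambda>t. ennreal (h0 t)) x" for x
      unfolding Jcong[OF h] unfolding J_def by (simp add: nn_integral_cmult mult.assoc)
    have "Y = (\<integral>\<^sup>+x. ennreal (c powr p) * ennreal ((v0 x * h0 x) powr p) \<partial>lborel)"
      unfolding Yeq
    proof (rule nn_integral_cong_AE, use h in eventually_elim)
      case (elim x)
      have "ennreal (v0 x) * h x = ennreal (c * (v0 x * h0 x))"
        unfolding elim using c h00[of x] v0p[of x] by (simp add: mult_ac flip: ennreal_mult)
      then show ?case using c h00[of x] v0p[of x]
        by (simp add: ennreal_powr_ennreal ennreal_powr_mult powr_mult ennreal_mult)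
    qed
    also have "\<dots> = ennreal (c powr p) * (\<integral>\<^sup>+x. ennreal ((v0 x * h0 x) powr p) \<partial>lborel)"
      by (intro nn_integral_cmult) measurable
    also have "c powr p = y" using 3 basic by (simp add: c_def powr_powr)
    finally have "ennreal y * (\<integral>\<^sup>+x. ennreal ((v0 x * h0 x) powr p) \<partial>lborel) = ennreal y * 1"
      using 3 by simp
    then have norm: "(\<integral>\<^sup>+x. ennreal ((v0 x * h0 x) powr p) \<partial>lborel) \<le> 1"
      using 3 by (subst (asm) ennreal_mult_cancel_left) auto
    have "(\<integral>\<^sup>+x. ennreal_powr (ennreal (v0 x) * J h x) q \<partial>lborel)
        = (\<integral>\<^sup>+x. ennreal (c powr q) * ennreal_powr (ennreal (v0 x) * J (\<lambda>t. ennreal (h0 t)) x) q \<partial>lborel)"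
      unfolding Jc using c by (intro nn_integral_cong) (simp add: ennreal_powr_mult ennreal_powr_ennreal mult_ac)
    also have "\<dots> = ennreal (c powr q) * (\<integral>\<^sup>+x. ennreal_powr (ennreal (v0 x) * J (\<lambda>t. ennreal (h0 t)) x) q \<partial>lborel)"
      unfolding J_def by (intro nn_integral_cmult) measurable
    also have "\<dots> \<le> ennreal (c powr q) * ennreal ?C"
      unfolding J_def using bd
      by (intro mult_left_mono one_dim_normalized v0p h00 X norm) (auto simp: av)
    also have "c powr q = y powr (q / p)" by (simp add: c_def powr_powr)
    finally show ?thesis using 3 by (simp add: ennreal_powr_ennreal mult.commute)
  qed
  then show ?thesis unfolding L[symmetric] unfolding J_def Y_def .
qed

section \<open>Mixed norms and the product kernel\<close>

lemma ennreal_Young: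
  assumes "1 < r" "1 < r'" "1 / r + 1 / r' = 1"
  shows "x * y \<le> ennreal (1 / r) * ennreal_powr x r + ennreal (1 / r') * ennreal_powr y r'"
proof (cases "x = top \<or> y = top")
  case True
  then show ?thesis using assms by (auto simp: ennreal_mult_top)
next
  case False
  then obtain a b where ab: "x = ennreal a" "y = ennreal b" "0 \<le> a" "0 \<le> b" by (metis ennreal_cases)
  have "a * b \<le> a powr r / r + b powr r' / r'" using ab assms by (intro Youngs_inequality) auto
  then have "ennreal (a * b) \<le> ennreal (1 / r * a powr r + 1 / r' * b powr r')" by (intro ennreal_leI) simp
  also have "\<dots> = ennreal (1 / r) * ennreal (a powr r) + ennreal (1 / r') * ennreal (b powr r')"
    using assms by (simp only: ennreal_plus ennreal_mult divide_nonneg_nonneg mult_nonneg_nonneg powr_ge_zero zero_le_one less_imp_le[OF less_trans[OF zero_less_one]])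
  finally show ?thesis using ab by (simp add: ennreal_powr_ennreal ennreal_mult)
qed

lemma nn_integral_Holder:
  fixes f g :: "'a \<Rightarrow> ennreal"
  assumes r: "1 < r" "1 < r'" "1 / r + 1 / r' = 1"
    and [measurable]: "f \<in> borel_measurable M" "g \<in> borel_measurable M"
  shows "(\<integral>\<^sup>+x. f x * g x \<partial>M)
    \<le> ennreal_powr (\<integral>\<^sup>+x. ennreal_powr (f x) r \<partial>M) (1 / r) * ennreal_powr (\<integral>\<^sup>+x. ennreal_powr (g x) r' \<partial>M) (1 / r')"
proof -
  define A where "A = (\<integral>\<^sup>+x. ennreal_powr (f x) r \<partial>M)"
  define B where "B = (\<integral>\<^sup>+x. ennreal_powr (g x) r' \<partial>M)"
  consider "A = 0" | "B = 0" | "A \<noteq> 0" "B \<noteq> 0" "A = top \<or> B = top"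
    | a b where "A = ennreal a" "B = ennreal b" "0 < a" "0 < b"
    by (cases A; cases B) (auto simp: less_le)
  then have "(\<integral>\<^sup>+x. f x * g x \<partial>M) \<le> ennreal_powr A (1 / r) * ennreal_powr B (1 / r')"
  proof cases
    case 1
    then have "AE x in M. ennreal_powr (f x) r = 0"
      unfolding A_def by (subst (asm) nn_integral_0_iff_AE) auto
    then have "(\<integral>\<^sup>+x. f x * g x \<partial>M) = (\<integral>\<^sup>+x. 0 \<partial>M)" by (intro nn_integral_cong_AE) auto
    then show ?thesis by simp
  next
    case 2
    then have "AE x in M. ennreal_powr (g x) r' = 0"
      unfolding B_def by (subst (asm) nn_integral_0_iff_AE) auto
    then have "(\<integral>\<^sup>+x. f x * g x \<partial>M) = (\<integral>\<^sup>+x. 0 \<partial>M)" by (intro nn_integral_cong_AE) auto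
    then show ?thesis by simp
  next
    case 3
    then show ?thesis by (auto simp: ennreal_mult_top ennreal_top_mult)
  next
    case 4
    define c d where "c = a powr (1 / r)" and "d = b powr (1 / r')"
    have cd: "0 < c" "0 < d" using 4 by (auto simp: c_def d_def)
    have pw: "(1 / c) powr r = 1 / a" "(1 / d) powr r' = 1 / b"
      using 4 r by (auto simp: c_def d_def powr_divide powr_powr)
    have "(\<integral>\<^sup>+x. f x * g x \<partial>M) = (\<integral>\<^sup>+x. ennreal (c * d) * ((ennreal (1 / c) * f x) * (ennreal (1 / d) * g x)) \<partial>M)"
    proof (rule nn_integral_cong)
      fix x
      have "ennreal (c * d) * ((ennreal (1 / c) * f x) * (ennreal (1 / d) * g x))
          = (ennreal (c * d) * (ennreal (1 / c) * ennreal (1 / d))) * (f x * g x)" by (simp add: mult_ac)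
      also have "ennreal (c * d) * (ennreal (1 / c) * ennreal (1 / d)) = 1"
        using cd by (simp flip: ennreal_mult)
      finally show "f x * g x = ennreal (c * d) * ((ennreal (1 / c) * f x) * (ennreal (1 / d) * g x))" by simp
    qed
    also have "\<dots> = ennreal (c * d) * (\<integral>\<^sup>+x. (ennreal (1 / c) * f x) * (ennreal (1 / d) * g x) \<partial>M)"
      by (intro nn_integral_cmult) measurable
    also have "\<dots> \<le> ennreal (c * d) * (\<integral>\<^sup>+x. ennreal (1 / r) * (ennreal (1 / a) * ennreal_powr (f x) r)
        + ennreal (1 / r') * (ennreal (1 / b) * ennreal_powr (g x) r') \<partial>M)"
    proof (intro mult_left_mono nn_integral_mono)
      fix x
      show "(ennreal (1 / c) * f x) * (ennreal (1 / d) * g x) \<le> ennreal (1 / r) * (ennreal (1 / a) * ennreal_powr (f x) r)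
        + ennreal (1 / r') * (ennreal (1 / b) * ennreal_powr (g x) r')"
        using ennreal_Young[OF r, of "ennreal (1 / c) * f x" "ennreal (1 / d) * g x"] cd
        by (simp add: ennreal_powr_mult ennreal_powr_ennreal pw del: powr_one_eq_one)
    qed auto
    also have "(\<integral>\<^sup>+x. ennreal (1 / r) * (ennreal (1 / a) * ennreal_powr (f x) r)
        + ennreal (1 / r') * (ennreal (1 / b) * ennreal_powr (g x) r') \<partial>M)
        = ennreal (1 / r) * (ennreal (1 / a) * A) + ennreal (1 / r') * (ennreal (1 / b) * B)"
      by (simp add: nn_integral_add nn_integral_cmult A_def B_def)
    also have "\<dots> = 1"
      using 4 r by (simp flip: ennreal_mult ennreal_plus)
    also have "ennreal (c * d) * 1 = ennreal_powr A (1 / r) * ennreal_powr B (1 / r')"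
      using 4 by (simp add: ennreal_powr_ennreal c_def d_def ennreal_mult)
    finally show ?thesis .
  qed
  then show ?thesis by (simp add: A_def B_def)
qed

text \<open>The duality argument divides by a power of the left side, which has to be finite for
  that. It is therefore run for the truncations \<open>g n\<close>, cut off in height and in
  support, and monotone convergence gives the general case.\<close>

lemma nn_integral_Minkowski:
  fixes K :: "real \<Rightarrow> real \<Rightarrow> ennreal"
  assumes r: "1 < r" and [measurable]: "case_prod K \<in> borel_measurable (lborel \<Otimes>\<^sub>M lborel)"
  shows "(\<integral>\<^sup>+t. ennreal_powr (\<integral>\<^sup>+s. K t s \<partial>lborel) r \<partial>lborel)
    \<le> ennreal_powr (\<integral>\<^sup>+s. ennreal_powr (\<integral>\<^sup>+t. ennreal_powr (K t s) r \<partial>lborel) (1 / r) \<partial>lborel) r"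
proof -
  define r' where "r' = r / (r - 1)"
  have r': "1 < r'" "1 / r + 1 / r' = 1" "(r - 1) * r' = r" using r by (auto simp: r'_def field_simps)
  define R where "R = (\<integral>\<^sup>+s. ennreal_powr (\<integral>\<^sup>+t. ennreal_powr (K t s) r \<partial>lborel) (1 / r) \<partial>lborel)"
  define \<Phi> where "\<Phi> t = (\<integral>\<^sup>+s. K t s \<partial>lborel)" for t
  have [measurable]: "\<Phi> \<in> borel_measurable lborel" unfolding \<Phi>_def by measurable
  define g where "g n t = min (\<Phi> t) (of_nat n) * indicator {- real n..real n} t" for n :: nat and t
  have [measurable]: "g n \<in> borel_measurable lborel" for n unfolding g_def by measurable
  have g_le: "g n t \<le> \<Phi> t" for n t by (auto simp: g_def indicator_def)
  have sup: "(SUP n. ennreal_powr (g n t) r) = ennreal_powr (\<Phi> t) r" for t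
  proof -
    have "(SUP n. g n t) = \<Phi> t"
    proof (rule antisym)
      show "(SUP n. g n t) \<le> \<Phi> t" by (intro SUP_least g_le)
      show "\<Phi> t \<le> (SUP n. g n t)"
      proof (rule dense_le)
        fix y assume y: "y < \<Phi> t"
        then have "y < top" using top.not_eq_extremum by fastforce
        then obtain z where z: "y = ennreal z" "0 \<le> z" by (cases y) auto
        obtain n :: nat where n: "max z \<bar>t\<bar> < real n" using reals_Archimedean2 by blast
        have "y \<le> of_nat n" using n z by (simp add: ennreal_of_nat_eq_real_of_nat ennreal_leI)
        then have "y \<le> g n t" using y n by (auto simp: g_def indicator_def)
        then show "y \<le> (SUP n. g n t)" by (rule SUP_upper2[OF UNIV_I])
      qed
    qed
    then show ?thesis using r by (simp flip: ennreal_powr_SUP)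
  qed
  have inc: "incseq (\<lambda>n t. ennreal_powr (g n t) r)"
  proof (intro monoI le_funI ennreal_powr_mono)
    fix n m :: nat and t assume "n \<le> m"
    then have "(of_nat n :: ennreal) \<le> of_nat m" by simp
    then show "g n t \<le> g m t"
      using \<open>n \<le> m\<close> by (auto simp: g_def indicator_def intro: min.coboundedI2)
  qed (use r in simp)
  have In: "(\<integral>\<^sup>+t. ennreal_powr (g n t) r \<partial>lborel) \<le> ennreal_powr R r" for n
  proof -
    define I where "I = (\<integral>\<^sup>+t. ennreal_powr (g n t) r \<partial>lborel)"
    have "I \<le> (\<integral>\<^sup>+t. ennreal_powr (of_nat n) r * indicator {- real n..real n} t \<partial>lborel)"
      unfolding I_def using r by (intro nn_integral_mono) (auto simp: g_def indicator_def intro!: ennreal_powr_mono)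
    also have "\<dots> < top"
      by (simp add: nn_integral_cmult ennreal_mult_less_top of_nat_less_top)
    finally have Ifin: "I < top" .
    have "I \<le> (\<integral>\<^sup>+t. \<Phi> t * ennreal_powr (g n t) (r - 1) \<partial>lborel)"
      unfolding I_def
    proof (rule nn_integral_mono)
      fix t
      have "g n t < top" by (auto simp: g_def indicator_def min_less_iff_disj of_nat_less_top)
      then have "ennreal_powr (g n t) r = g n t * ennreal_powr (g n t) (r - 1)"
        using ennreal_powr_add[of 1 "r - 1" "g n t"] r by simp
      also have "\<dots> \<le> \<Phi> t * ennreal_powr (g n t) (r - 1)" by (intro mult_right_mono g_le) simp
      finally show "ennreal_powr (g n t) r \<le> \<Phi> t * ennreal_powr (g n t) (r - 1)" .
    qed
    also have "\<dots> = (\<integral>\<^sup>+t. \<integral>\<^sup>+s. K t s * ennreal_powr (g n t) (r - 1) \<partial>lborel \<partial>lborel)"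
      unfolding \<Phi>_def by (intro nn_integral_cong nn_integral_multc[symmetric]) measurable
    also have "\<dots> = (\<integral>\<^sup>+s. \<integral>\<^sup>+t. K t s * ennreal_powr (g n t) (r - 1) \<partial>lborel \<partial>lborel)"
      by (rule lborel_pair.Fubini') measurable
    also have "\<dots> \<le> (\<integral>\<^sup>+s. ennreal_powr (\<integral>\<^sup>+t. ennreal_powr (K t s) r \<partial>lborel) (1 / r) * ennreal_powr I (1 / r') \<partial>lborel)"
    proof (rule nn_integral_mono)
      fix s
      have "(\<integral>\<^sup>+t. K t s * ennreal_powr (g n t) (r - 1) \<partial>lborel)
        \<le> ennreal_powr (\<integral>\<^sup>+t. ennreal_powr (K t s) r \<partial>lborel) (1 / r)
          * ennreal_powr (\<integral>\<^sup>+t. ennreal_powr (ennreal_powr (g n t) (r - 1)) r' \<partial>lborel) (1 / r')"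
        using r r' by (intro nn_integral_Holder) measurable
      then show "(\<integral>\<^sup>+t. K t s * ennreal_powr (g n t) (r - 1) \<partial>lborel)
        \<le> ennreal_powr (\<integral>\<^sup>+t. ennreal_powr (K t s) r \<partial>lborel) (1 / r) * ennreal_powr I (1 / r')"
        by (simp add: ennreal_powr_powr r'(3) I_def)
    qed
    also have "\<dots> = R * ennreal_powr I (1 / r')" unfolding R_def by (intro nn_integral_multc) measurable
    finally have le: "I \<le> R * ennreal_powr I (1 / r')" .
    show ?thesis
    proof (cases "I = 0")
      case False
      have "ennreal_powr I (1 / r') \<noteq> 0" "ennreal_powr I (1 / r') \<noteq> top" using False Ifin by auto
      moreover have "I = ennreal_powr I (1 / r) * ennreal_powr I (1 / r')"
        using ennreal_powr_add[of "1 / r" "1 / r'" I] r r' by simp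
      ultimately have "ennreal_powr I (1 / r) \<le> R"
        using le by (metis ennreal_mult_le_mult_iff mult.commute)
      then show ?thesis using r ennreal_powr_le_swap[of "1 / r" I R] by (simp add: I_def)
    qed (simp add: I_def)
  qed
  have "(\<integral>\<^sup>+t. ennreal_powr (\<Phi> t) r \<partial>lborel) = (\<integral>\<^sup>+t. (SUP n. ennreal_powr (g n t) r) \<partial>lborel)" by (simp add: sup)
  also have "\<dots> = (SUP n. \<integral>\<^sup>+t. ennreal_powr (g n t) r \<partial>lborel)"
    by (intro nn_integral_monotone_convergence_SUP inc) measurable
  also have "\<dots> \<le> ennreal_powr R r" by (intro SUP_least In)
  finally show ?thesis by (simp add: R_def \<Phi>_def)
qed

section \<open>Slices of product measures and iteration over the variables\<close>

abbreviation lborel_fun :: "('n \<Rightarrow> real) measure" where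
  "lborel_fun \<equiv> Pi\<^sub>M UNIV (\<lambda>_. lborel)"

lemma product_sigma_finite_lborel: "product_sigma_finite (\<lambda>_::'n. lborel :: real measure)"
  by (intro product_sigma_finite.intro) (rule lborel.sigma_finite_measure_axioms)

text \<open>The result is again a function of all coordinates, constant in the \<open>i\<close>-th.
  Operators in different variables thus compose by \<open>foldr\<close> without a change of
  space.\<close>

definition slice_int :: "'n \<Rightarrow> (('n \<Rightarrow> real) \<Rightarrow> ennreal) \<Rightarrow> ('n \<Rightarrow> real) \<Rightarrow> ennreal" where
  "slice_int i h x = (\<integral>\<^sup>+t. h (x(i := t)) \<partial>lborel)"

definition riesz_slice :: "real \<Rightarrow> 'n \<Rightarrow> (('n \<Rightarrow> real) \<Rightarrow> ennreal) \<Rightarrow> ('n \<Rightarrow> real) \<Rightarrow> ennreal" where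
  "riesz_slice \<alpha> i h x = (\<integral>\<^sup>+t. h (x(i := t)) * ennreal (\<bar>x i - t\<bar> powr (\<alpha> - 1)) \<partial>lborel)"

lemma measurable_slice_upd [measurable]:
  "(\<lambda>(x, t). x(i := t)) \<in> lborel_fun \<Otimes>\<^sub>M lborel \<rightarrow>\<^sub>M (lborel_fun :: ('n::finite \<Rightarrow> real) measure)"
  using measurable_add_dim[of i UNIV "\<lambda>_::'n. lborel :: real measure"] by simp

lemma measurable_slice_upd' [measurable]:
  "(\<lambda>t. x(i := t)) \<in> lborel \<rightarrow>\<^sub>M (lborel_fun :: ('n::finite \<Rightarrow> real) measure)"
  using measurable_Pair2[OF measurable_slice_upd, of x i] by (simp add: space_PiM)

lemma measurable_slice_comp [measurable]:
  assumes "h \<in> borel_measurable (lborel_fun :: ('n::finite \<Rightarrow> real) measure)"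
  shows "(\<lambda>(x, t). h (x(i := t))) \<in> borel_measurable (lborel_fun \<Otimes>\<^sub>M lborel)"
  using measurable_compose[OF measurable_slice_upd assms] by (simp add: case_prod_unfold)

lemma measurable_slice_comp' [measurable]:
  assumes "h \<in> borel_measurable (lborel_fun :: ('n::finite \<Rightarrow> real) measure)"
  shows "(\<lambda>t. h (x(i := t))) \<in> borel_measurable lborel"
  by (rule measurable_compose[OF measurable_slice_upd' assms])

lemma measurable_slice_int [measurable]:
  assumes [measurable]: "h \<in> borel_measurable (lborel_fun :: ('n::finite \<Rightarrow> real) measure)"
  shows "slice_int i h \<in> borel_measurable lborel_fun"
  unfolding slice_int_def[abs_def] by (rule lborel.borel_measurable_nn_integral) measurable

lemma measurable_riesz_slice [measurable]:
  assumes [measurable]: "h \<in> borel_measurable (lborel_fun :: ('n::finite \<Rightarrow> real) measure)"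
  shows "riesz_slice \<alpha> i h \<in> borel_measurable lborel_fun"
  unfolding riesz_slice_def[abs_def] by (rule lborel.borel_measurable_nn_integral) measurable

lemma measurable_foldr_slice_int [measurable]:
  assumes "h \<in> borel_measurable (lborel_fun :: ('n::finite \<Rightarrow> real) measure)"
  shows "foldr slice_int is h \<in> borel_measurable lborel_fun"
  by (induction "is") (use assms in auto)

lemma measurable_foldr_riesz_slice [measurable]:
  assumes "h \<in> borel_measurable (lborel_fun :: ('n::finite \<Rightarrow> real) measure)"
  shows "foldr (riesz_slice \<alpha>) is h \<in> borel_measurable lborel_fun"
  by (induction "is") (use assms in auto)

lemma nn_integral_slice:
  fixes h :: "('n::finite \<Rightarrow> real) \<Rightarrow> ennreal"
  assumes "h \<in> borel_measurable lborel_fun"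
  shows "(\<integral>\<^sup>+x. h x \<partial>lborel_fun) = (\<integral>\<^sup>+y. slice_int i h y \<partial>Pi\<^sub>M (- {i}) (\<lambda>_. lborel))"
proof -
  interpret product_sigma_finite "\<lambda>_::'n. lborel :: real measure" by (rule product_sigma_finite_lborel)
  have "insert i (- {i}) = UNIV" by auto
  then show ?thesis
    using product_nn_integral_insert[of "- {i}" i h] assms by (simp add: slice_int_def)
qed

text \<open>A null set in the remaining variables times a line is null, by Tonelli. Statements about
  slices can thus be quantified over full vectors whose \<open>i\<close>-th entry is
  ignored.\<close>

lemma AE_lborel_fun_restrict:
  assumes "AE y in Pi\<^sub>M (- {i}) (\<lambda>_. lborel). Q y"
  shows "AE x in (lborel_fun :: ('n::finite \<Rightarrow> real) measure). Q (restrict x (- {i}))"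
proof -
  obtain N where N': "{y \<in> space (Pi\<^sub>M (- {i}) (\<lambda>_. lborel :: real measure)). \<not> Q y} \<subseteq> N"
    "emeasure (Pi\<^sub>M (- {i}) (\<lambda>_. lborel :: real measure)) N = 0" "N \<in> sets (Pi\<^sub>M (- {i}) (\<lambda>_. lborel :: real measure))"
    by (rule AE_E[OF assms])
  note N = N'(3,2,1)
  have [measurable]: "(\<lambda>x. restrict x (- {i})) \<in> (lborel_fun :: ('n \<Rightarrow> real) measure) \<rightarrow>\<^sub>M Pi\<^sub>M (- {i}) (\<lambda>_. lborel)"
    by (rule measurable_restrict_subset) simp
  note [measurable] = N(1)
  have restr: "restrict (y(i := t)) (- {i}) = y" if "y \<in> space (Pi\<^sub>M (- {i}) (\<lambda>_. lborel :: real measure))" for y t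
    using that by (auto simp: space_PiM PiE_def extensional_def restrict_def fun_eq_iff)
  have "(\<integral>\<^sup>+x. indicator N (restrict x (- {i})) \<partial>(lborel_fun :: ('n \<Rightarrow> real) measure))
      = (\<integral>\<^sup>+y. (\<integral>\<^sup>+t. indicator N (restrict (y(i := t)) (- {i})) \<partial>lborel) \<partial>Pi\<^sub>M (- {i}) (\<lambda>_. lborel))"
    using nn_integral_slice[of "\<lambda>x. indicator N (restrict x (- {i}))" i] by (simp add: slice_int_def[abs_def])
  also have "\<dots> = (\<integral>\<^sup>+y. (\<integral>\<^sup>+t. indicator N y \<partial>(lborel :: real measure)) \<partial>Pi\<^sub>M (- {i}) (\<lambda>_. lborel))"
  proof (intro nn_integral_cong)
    fix y t assume "y \<in> space (Pi\<^sub>M (- {i}) (\<lambda>_. lborel :: real measure))"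
    then show "indicator N (restrict (y(i := t)) (- {i})) = (indicator N y :: ennreal)"
      by (simp only: restr)
  qed
  also have "\<dots> = (\<integral>\<^sup>+y. 0 \<partial>Pi\<^sub>M (- {i}) (\<lambda>_. lborel :: real measure))"
  proof (rule nn_integral_cong_AE)
    have "AE y in Pi\<^sub>M (- {i}) (\<lambda>_. lborel). y \<notin> N" using N by (intro AE_not_in) auto
    then show "AE y in Pi\<^sub>M (- {i}) (\<lambda>_. lborel). (\<integral>\<^sup>+t. indicator N y \<partial>(lborel :: real measure)) = 0"
      by eventually_elim simp
  qed
  finally have "(\<integral>\<^sup>+x. indicator N (restrict x (- {i})) \<partial>(lborel_fun :: ('n \<Rightarrow> real) measure)) = 0" by simp
  then have "AE x in (lborel_fun :: ('n \<Rightarrow> real) measure). indicator N (restrict x (- {i})) = (0::ennreal)"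
    by (subst (asm) nn_integral_0_iff_AE) auto
  moreover have "restrict x (- {i}) \<in> space (Pi\<^sub>M (- {i}) (\<lambda>_. lborel :: real measure))" for x :: "'n \<Rightarrow> real"
    by (simp add: space_PiM)
  ultimately show ?thesis using N(3) by (auto elim!: eventually_mono simp: indicator_def split: if_splits)
qed

text \<open>By Tonelli almost every slice of a null set is null; the parameter again ranges over the
  full space, so that several such statements can be intersected for different
  \<open>i\<close>.\<close>

lemma AE_slice:
  assumes "AE x in (lborel_fun :: ('n::finite \<Rightarrow> real) measure). P x"
  shows "AE x in lborel_fun. AE t in lborel. P (x(i := t))"
proof -
  obtain N where N': "{y \<in> space (lborel_fun :: ('n \<Rightarrow> real) measure). \<not> P y} \<subseteq> N"
    "emeasure (lborel_fun :: ('n \<Rightarrow> real) measure) N = 0" "N \<in> sets (lborel_fun :: ('n \<Rightarrow> real) measure)"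
    by (rule AE_E[OF assms])
  note N = N'(3,2,1)
  note [measurable] = N(1)
  have "(\<integral>\<^sup>+y. slice_int i (indicator N) y \<partial>Pi\<^sub>M (- {i}) (\<lambda>_. lborel)) = 0"
    using N by (subst nn_integral_slice[symmetric]) auto
  moreover have "slice_int i (indicator N) \<in> borel_measurable (Pi\<^sub>M (- {i}) (\<lambda>_. lborel))"
    unfolding slice_int_def[abs_def]
  proof (rule lborel.borel_measurable_nn_integral)
    have "insert i (- {i}) = UNIV" by auto
    then have [measurable]: "(\<lambda>(x, t). x(i := t)) \<in> Pi\<^sub>M (- {i}) (\<lambda>_. lborel) \<Otimes>\<^sub>M lborel \<rightarrow>\<^sub>M (lborel_fun :: ('n \<Rightarrow> real) measure)"
      using measurable_add_dim[of i "- {i}" "\<lambda>_::'n. lborel :: real measure"] by simp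
    show "(\<lambda>(x, t). indicator N (x(i := t)) :: ennreal) \<in> borel_measurable (Pi\<^sub>M (- {i}) (\<lambda>_. lborel) \<Otimes>\<^sub>M lborel)"
      by measurable
  qed
  ultimately have "AE y in Pi\<^sub>M (- {i}) (\<lambda>_. lborel). slice_int i (indicator N) y = 0"
    by (subst (asm) nn_integral_0_iff_AE) auto
  from AE_lborel_fun_restrict[OF this]
  have "AE x in (lborel_fun :: ('n \<Rightarrow> real) measure). slice_int i (indicator N) (restrict x (- {i})) = 0" .
  then show ?thesis
  proof eventually_elim
    case (elim x)
    have "(restrict x (- {i}))(i := t) = x(i := t)" for t by (auto simp: fun_eq_iff restrict_def)
    then have "(\<integral>\<^sup>+t. indicator N (x(i := t)) \<partial>lborel) = 0" using elim by (simp add: slice_int_def)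
    then have "AE t in lborel. indicator N (x(i := t)) = (0::ennreal)"
      by (subst (asm) nn_integral_0_iff_AE) auto
    then show ?case
      by eventually_elim (use N(3) in \<open>auto simp: indicator_def space_PiM split: if_splits\<close>)
  qed
qed

lemma slice_int_mono_AE:
  assumes "AE x in (lborel_fun :: ('n::finite \<Rightarrow> real) measure). g x \<le> h x"
  shows "AE x in lborel_fun. slice_int i g x \<le> slice_int i h x"
  using AE_slice[OF assms, of i] by eventually_elim (auto simp: slice_int_def intro: nn_integral_mono_AE)

lemma foldr_slice_int_mono_AE:
  assumes "AE x in (lborel_fun :: ('n::finite \<Rightarrow> real) measure). g x \<le> h x"
  shows "AE x in lborel_fun. foldr slice_int is g x \<le> foldr slice_int is h x"
proof (induction "is")
  case (Cons i "is")
  show ?case using slice_int_mono_AE[OF Cons.IH, of i] by simp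
qed (use assms in simp)

lemma foldr_slice_int_cmult:
  assumes [measurable]: "h \<in> borel_measurable (lborel_fun :: ('n::finite \<Rightarrow> real) measure)"
  shows "foldr slice_int is (\<lambda>x. c * h x) = (\<lambda>x. c * foldr slice_int is h x)"
proof (induction "is")
  case (Cons j js)
  have "slice_int j (\<lambda>x. c * foldr slice_int js h x) x = c * slice_int j (foldr slice_int js h) x" for x
    unfolding slice_int_def[of j] by (intro nn_integral_cmult measurable_slice_comp') measurable
  then show ?case by (simp add: Cons fun_eq_iff)
qed simp

text \<open>It expresses iterated slices as one integral over a product space, from which their
  independence of the order is read off.\<close>

definition splice :: "'n set \<Rightarrow> ('n \<Rightarrow> real) \<Rightarrow> ('n \<Rightarrow> real) \<Rightarrow> 'n \<Rightarrow> real" where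
  "splice I z x = (\<lambda>i. if i \<in> I then z i else x i)"

lemma measurable_splice [measurable]:
  "(\<lambda>z. splice I z x) \<in> Pi\<^sub>M I (\<lambda>_. lborel) \<rightarrow>\<^sub>M (lborel_fun :: ('n::finite \<Rightarrow> real) measure)"
proof (rule measurable_PiM_single')
  fix i
  show "(\<lambda>z. splice I z x i) \<in> Pi\<^sub>M I (\<lambda>_. lborel) \<rightarrow>\<^sub>M lborel"
    by (cases "i \<in> I") (simp_all add: splice_def)
qed (simp add: splice_def)

lemma splice_insert: "j \<notin> I \<Longrightarrow> splice (insert j I) (z(j := t)) x = splice I z (x(j := t))"
  by (auto simp: splice_def fun_eq_iff)

lemma foldr_slice_int_eq:
  fixes h :: "('n::finite \<Rightarrow> real) \<Rightarrow> ennreal"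
  assumes [measurable]: "h \<in> borel_measurable lborel_fun" and "distinct is"
  shows "foldr slice_int is h x = (\<integral>\<^sup>+z. h (splice (set is) z x) \<partial>Pi\<^sub>M (set is) (\<lambda>_. lborel))"
  using assms(2)
proof (induction "is" arbitrary: x)
  case Nil
  have "splice {} z x = x" for z by (simp add: splice_def)
  then show ?case by (simp add: PiM_empty nn_integral_count_space_finite)
next
  case (Cons j js)
  interpret product_sigma_finite "\<lambda>_::'n. lborel :: real measure" by (rule product_sigma_finite_lborel)
  have "(\<integral>\<^sup>+z. h (splice (insert j (set js)) z x) \<partial>Pi\<^sub>M (insert j (set js)) (\<lambda>_. lborel))
      = (\<integral>\<^sup>+t. (\<integral>\<^sup>+z. h (splice (insert j (set js)) (z(j := t)) x) \<partial>Pi\<^sub>M (set js) (\<lambda>_. lborel)) \<partial>lborel)"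
    using Cons.prems by (intro product_nn_integral_insert_rev) auto
  also have "\<dots> = (\<integral>\<^sup>+t. foldr slice_int js h (x(j := t)) \<partial>lborel)"
    using Cons by (simp add: splice_insert)
  finally show ?case by (simp add: slice_int_def[of j])
qed

lemma foldr_slice_int_perm:
  fixes h :: "('n::finite \<Rightarrow> real) \<Rightarrow> ennreal"
  assumes "h \<in> borel_measurable lborel_fun" "distinct is" "distinct js" "set is = set js"
  shows "foldr slice_int is h = foldr slice_int js h"
  using assms by (simp add: fun_eq_iff foldr_slice_int_eq)

lemma foldr_slice_int_UNIV:
  fixes h :: "('n::finite \<Rightarrow> real) \<Rightarrow> ennreal"
  assumes "h \<in> borel_measurable lborel_fun" "distinct is" "set is = UNIV"
  shows "foldr slice_int is h x = (\<integral>\<^sup>+z. h z \<partial>lborel_fun)"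
proof -
  have "splice UNIV z x = z" for z by (simp add: splice_def)
  then show ?thesis using assms by (simp add: foldr_slice_int_eq)
qed

lemma foldr_riesz_slice_eq:
  fixes h :: "('n::finite \<Rightarrow> real) \<Rightarrow> ennreal"
  assumes [measurable]: "h \<in> borel_measurable lborel_fun" and "distinct is"
  shows "foldr (riesz_slice \<alpha>) is h x
    = (\<integral>\<^sup>+z. h (splice (set is) z x) * (\<Prod>i\<in>set is. ennreal (\<bar>x i - z i\<bar> powr (\<alpha> - 1))) \<partial>Pi\<^sub>M (set is) (\<lambda>_. lborel))"
  using assms(2)
proof (induction "is" arbitrary: x)
  case Nil
  have "splice {} z x = x" for z by (simp add: splice_def)
  then show ?case by (simp add: PiM_empty nn_integral_count_space_finite)
next
  case (Cons j js)
  interpret product_sigma_finite "\<lambda>_::'n. lborel :: real measure" by (rule product_sigma_finite_lborel)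
  let ?k = "\<lambda>x z i. ennreal (\<bar>x i - z i\<bar> powr (\<alpha> - 1))"
  have "(\<integral>\<^sup>+z. h (splice (insert j (set js)) z x) * (\<Prod>i\<in>insert j (set js). ?k x z i) \<partial>Pi\<^sub>M (insert j (set js)) (\<lambda>_. lborel))
      = (\<integral>\<^sup>+t. (\<integral>\<^sup>+z. h (splice (insert j (set js)) (z(j := t)) x) * (\<Prod>i\<in>insert j (set js). ?k x (z(j := t)) i) \<partial>Pi\<^sub>M (set js) (\<lambda>_. lborel)) \<partial>lborel)"
    using Cons.prems by (intro product_nn_integral_insert_rev) auto
  also have "\<dots> = (\<integral>\<^sup>+t. (\<integral>\<^sup>+z. h (splice (set js) z (x(j := t))) * (\<Prod>i\<in>set js. ?k (x(j := t)) z i) * ennreal (\<bar>x j - t\<bar> powr (\<alpha> - 1)) \<partial>Pi\<^sub>M (set js) (\<lambda>_. lborel)) \<partial>lborel)"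
  proof (intro nn_integral_cong)
    fix t z
    have "(\<Prod>i\<in>insert j (set js). ?k x (z(j := t)) i) = ennreal (\<bar>x j - t\<bar> powr (\<alpha> - 1)) * (\<Prod>i\<in>set js. ?k x (z(j := t)) i)"
      using Cons.prems by simp
    also have "(\<Prod>i\<in>set js. ?k x (z(j := t)) i) = (\<Prod>i\<in>set js. ?k (x(j := t)) z i)"
      using Cons.prems by (intro prod.cong) auto
    finally show "h (splice (insert j (set js)) (z(j := t)) x) * (\<Prod>i\<in>insert j (set js). ?k x (z(j := t)) i)
        = h (splice (set js) z (x(j := t))) * (\<Prod>i\<in>set js. ?k (x(j := t)) z i) * ennreal (\<bar>x j - t\<bar> powr (\<alpha> - 1))"
      using Cons.prems by (simp add: splice_insert mult_ac)
  qed
  also have "\<dots> = (\<integral>\<^sup>+t. foldr (riesz_slice \<alpha>) js h (x(j := t)) * ennreal (\<bar>x j - t\<bar> powr (\<alpha> - 1)) \<partial>lborel)"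
    using Cons by (intro nn_integral_cong) (subst nn_integral_multc, auto)
  finally show ?case by (simp add: riesz_slice_def[of \<alpha> j])
qed

text \<open>Each variable in the list passes through the integral in the variable \<open>i\<close>
  by one use of the two-variable inequality. The root \<open>1 / r\<close> left by the induction
  hypothesis cancels against the power \<open>r\<close> that this use takes.\<close>

lemma foldr_slice_int_Minkowski:
  fixes H :: "('n::finite \<Rightarrow> real) \<Rightarrow> ennreal"
  assumes r: "1 < r" and [measurable]: "H \<in> borel_measurable lborel_fun" and "i \<notin> set is"
  shows "foldr slice_int is (\<lambda>y. ennreal_powr (slice_int i H y) r) x
    \<le> ennreal_powr (slice_int i (\<lambda>y. ennreal_powr (foldr slice_int is (\<lambda>z. ennreal_powr (H z) r) y) (1 / r)) x) r"
  using assms(3)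
proof (induction "is" arbitrary: x)
  case Nil
  then show ?case using r by (simp add: ennreal_powr_powr)
next
  case (Cons j js)
  define G where "G = foldr slice_int js (\<lambda>z. ennreal_powr (H z) r)"
  have [measurable]: "G \<in> borel_measurable lborel_fun" unfolding G_def by measurable
  have meas: "(\<lambda>(t, s). ennreal_powr (G (x(j := t, i := s))) (1 / r)) \<in> borel_measurable (lborel \<Otimes>\<^sub>M lborel)"
  proof -
    have "(\<lambda>ts. ((\<lambda>(y, t). y(i := t)) (x(j := fst ts), snd ts))) \<in> lborel \<Otimes>\<^sub>M lborel \<rightarrow>\<^sub>M (lborel_fun :: ('n \<Rightarrow> real) measure)"
      by (rule measurable_compose[OF _ measurable_slice_upd]) measurable
    then have [measurable]: "(\<lambda>ts. x(j := fst ts, i := snd ts)) \<in> lborel \<Otimes>\<^sub>M lborel \<rightarrow>\<^sub>M (lborel_fun :: ('n \<Rightarrow> real) measure)"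
      by simp
    show ?thesis unfolding case_prod_unfold by measurable
  qed
  have "foldr slice_int (j # js) (\<lambda>y. ennreal_powr (slice_int i H y) r) x
      \<le> (\<integral>\<^sup>+t. ennreal_powr (\<integral>\<^sup>+s. ennreal_powr (G (x(j := t, i := s))) (1 / r) \<partial>lborel) r \<partial>lborel)"
  proof -
    have "foldr slice_int js (\<lambda>y. ennreal_powr (slice_int i H y) r) (x(j := t))
        \<le> ennreal_powr (\<integral>\<^sup>+s. ennreal_powr (G (x(j := t, i := s))) (1 / r) \<partial>lborel) r" for t
    proof -
      have "foldr slice_int js (\<lambda>y. ennreal_powr (slice_int i H y) r) (x(j := t))
          \<le> ennreal_powr (slice_int i (\<lambda>y. ennreal_powr (G y) (1 / r)) (x(j := t))) r"
        unfolding G_def using Cons.prems by (intro Cons.IH) simp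
      also have "slice_int i (\<lambda>y. ennreal_powr (G y) (1 / r)) (x(j := t))
          = (\<integral>\<^sup>+s. ennreal_powr (G (x(j := t, i := s))) (1 / r) \<partial>lborel)"
        by (rule slice_int_def)
      finally show ?thesis .
    qed
    then show ?thesis by (simp add: slice_int_def[of j] nn_integral_mono)
  qed
  also have "\<dots> \<le> ennreal_powr (\<integral>\<^sup>+s. ennreal_powr (\<integral>\<^sup>+t. ennreal_powr (ennreal_powr (G (x(j := t, i := s))) (1 / r)) r \<partial>lborel) (1 / r) \<partial>lborel) r"
    by (rule nn_integral_Minkowski[OF r meas])
  also have "\<dots> = ennreal_powr (slice_int i (\<lambda>y. ennreal_powr (foldr slice_int (j # js) (\<lambda>z. ennreal_powr (H z) r) y) (1 / r)) x) r"
    using r Cons.prems by (auto simp: slice_int_def ennreal_powr_powr G_def fun_upd_twist)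
  finally show ?case .
qed

text \<open>The unit cube has mass 1, so the measure is not zero. This removes the idle quantifier
  that remains once every variable has been integrated out.\<close>

lemma AE_lborel_fun_const:
  assumes "AE x in (lborel_fun :: ('n::finite \<Rightarrow> real) measure). C"
  shows C
proof (rule ccontr)
  assume "\<not> C"
  with assms have F: "AE x in (lborel_fun :: ('n \<Rightarrow> real) measure). False" by simp
  have "\<not> (AE x in (lborel_fun :: ('n \<Rightarrow> real) measure). False)"
  proof -
    interpret product_sigma_finite "\<lambda>_::'n. lborel :: real measure" by (rule product_sigma_finite_lborel)
    have "emeasure (lborel_fun :: ('n \<Rightarrow> real) measure) (Pi\<^sub>E UNIV (\<lambda>_. {0..1})) = (\<Prod>i\<in>(UNIV :: 'n set). emeasure lborel {0..1::real})"
      by (intro emeasure_PiM) auto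
    also have "\<dots> = 1" by simp
    finally have 1: "emeasure (lborel_fun :: ('n \<Rightarrow> real) measure) (Pi\<^sub>E UNIV (\<lambda>_. {0..1})) = 1" .
    have "emeasure (lborel_fun :: ('n \<Rightarrow> real) measure) (Pi\<^sub>E UNIV (\<lambda>_. {0..1})) \<le> emeasure (lborel_fun :: ('n \<Rightarrow> real) measure) (space lborel_fun)"
      by (rule emeasure_space)
    then have "emeasure (lborel_fun :: ('n \<Rightarrow> real) measure) (space lborel_fun) \<noteq> 0" using 1 by auto
    then show ?thesis by (auto simp: AE_iff_measurable[OF _ refl])
  qed
  with F show False by simp
qed

text \<open>The one-variable inequality works with the other variables frozen, so its variable has
  to be integrated first. Minkowski's inequality with exponent \<open>q / p > 1\<close> then moves
  the \<open>p\<close>-norm in that variable outside the \<open>q\<close>-norms of the variables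
  treated earlier.\<close>

theorem (in exponents) multi_dim:
  fixes W :: "('n::finite \<Rightarrow> real) \<Rightarrow> real" and f :: "('n \<Rightarrow> real) \<Rightarrow> ennreal" and X :: "'n \<Rightarrow> real"
  assumes [measurable]: "W \<in> borel_measurable lborel_fun" "f \<in> borel_measurable lborel_fun"
    and W: "AE x in lborel_fun. 0 < W x" and X: "\<And>i. 1 \<le> X i"
    and bd: "\<And>i. AE x in lborel_fun. \<forall>a\<in>\<rat>. \<forall>b\<in>\<rat>. a < b \<longrightarrow>
      average {a..b} (\<lambda>s. W (x(i := s)) powr q) * ennreal_powr (average {a..b} (\<lambda>s. W (x(i := s)) powr - p')) (q / p') \<le> ennreal (X i)"
  shows "ennreal_powr (\<integral>\<^sup>+x. ennreal_powr (ennreal (W x) *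
        (\<integral>\<^sup>+z. f z * (\<Prod>i\<in>UNIV. ennreal (\<bar>x i - z i\<bar> powr (\<alpha> - 1))) \<partial>lborel_fun)) q \<partial>lborel_fun) (1 / q)
    \<le> (\<Prod>i\<in>UNIV. ennreal (one_dim_const * X i powr (max 1 (p' / q) * (1 - \<alpha>)))) *
      ennreal_powr (\<integral>\<^sup>+x. ennreal_powr (ennreal (W x) * f x) p \<partial>lborel_fun) (1 / p)"
proof -
  note basic = p_gt_1 q_gt_1 p'_gt_1 q'_gt_1 alpha_pos alpha_less_1 p_less_q
  define k where "k i = one_dim_const * X i powr (max 1 (p' / q) * (1 - \<alpha>))" for i
  have k0: "0 \<le> k i" for i using one_dim_const_pos by (simp add: k_def less_imp_le)
  define T where "T is = foldr (riesz_slice \<alpha>) is f" for "is"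
  have [measurable]: "T is \<in> borel_measurable lborel_fun" for "is" unfolding T_def by measurable
  define w where "w h e x = ennreal_powr (ennreal (W x) * h x) e" for h :: "('n \<Rightarrow> real) \<Rightarrow> ennreal" and e x
  have [measurable]: "w h e \<in> borel_measurable lborel_fun" if [measurable]: "h \<in> borel_measurable lborel_fun" for h e
    unfolding w_def by measurable
  have one: "AE x in lborel_fun. slice_int i (w (riesz_slice \<alpha> i h) q) x
      \<le> ennreal (k i powr q) * ennreal_powr (slice_int i (w h p) x) (q / p)"
    if [measurable]: "h \<in> borel_measurable lborel_fun" for h i
    using bd[of i] AE_slice[OF W, of i]
  proof eventually_elim
    case (elim x)
    have "(\<integral>\<^sup>+s. ennreal_powr (ennreal (W (x(i := s))) * (\<integral>\<^sup>+t. h (x(i := t)) * ennreal (\<bar>s - t\<bar> powr (\<alpha> - 1)) \<partial>lborel)) q \<partial>lborel)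
      \<le> ennreal ((one_dim_const * X i powr (max 1 (p' / q) * (1 - \<alpha>))) powr q) *
        ennreal_powr (\<integral>\<^sup>+s. ennreal_powr (ennreal (W (x(i := s))) * h (x(i := s))) p \<partial>lborel) (q / p)"
      using elim X by (intro one_dim) auto
    then show ?case by (simp add: slice_int_def w_def riesz_slice_def k_def)
  qed
  \<comment> \<open>Variables in \<open>is\<close> have been treated and carry the exponent
    \<open>q\<close> inside; those in \<open>js\<close> still carry \<open>p\<close> outside. For
    empty \<open>is\<close> the left side is the integral on the right; for empty \<open>js\<close>
    it is the power \<open>p / q\<close> of the integral sought.\<close>
  have main: "AE x in lborel_fun. foldr slice_int js (\<lambda>y. ennreal_powr (foldr slice_int is (w (T is) q) y) (p / q)) x
      \<le> (\<Prod>i\<in>set is. ennreal (k i powr p)) * (\<integral>\<^sup>+x. w f p x \<partial>lborel_fun)"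
    if "distinct (is @ js)" "set is \<union> set js = UNIV" for "is" js
    using that
  proof (induction "is" arbitrary: js)
    case Nil
    have "(\<lambda>y. ennreal_powr (w f q y) (p / q)) = w f p"
      using basic by (simp add: w_def ennreal_powr_powr fun_eq_iff)
    then have "foldr slice_int js (\<lambda>y. ennreal_powr (w f q y) (p / q)) x = (\<integral>\<^sup>+x. w f p x \<partial>lborel_fun)" for x
      using Nil by (simp add: foldr_slice_int_UNIV)
    then show ?case by (simp add: T_def)
  next
    case (Cons i "is")
    define h where "h = T is"
    have [measurable]: "h \<in> borel_measurable lborel_fun" by (simp add: h_def)
    have Th: "T (i # is) = riesz_slice \<alpha> i h" by (simp add: T_def h_def)
    \<comment> \<open>The new variable is appended to \<open>js\<close>: it becomes the innermost of
      the untreated ones, directly outside the treated ones, where Minkowski's inequality will put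
      it.\<close>
    have IH: "AE x in lborel_fun. foldr slice_int (js @ [i]) (\<lambda>y. ennreal_powr (foldr slice_int is (w h q) y) (p / q)) x
        \<le> (\<Prod>i\<in>set is. ennreal (k i powr p)) * (\<integral>\<^sup>+x. w f p x \<partial>lborel_fun)"
      unfolding h_def using Cons.prems by (intro Cons.IH) auto
    \<comment> \<open>Tonelli brings the new variable to the first place of integration, so that the
      inequality \<open>one\<close> applies under the other integrals.\<close>
    have perm: "foldr slice_int (i # is) (w (T (i # is)) q) = foldr slice_int is (slice_int i (w (riesz_slice \<alpha> i h) q))"
      using foldr_slice_int_perm[of "w (T (i # is)) q" "i # is" "is @ [i]"] Cons.prems by (simp add: Th)
    have "AE x in lborel_fun. foldr slice_int is (slice_int i (w (riesz_slice \<alpha> i h) q)) x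
        \<le> foldr slice_int is (\<lambda>y. ennreal (k i powr q) * ennreal_powr (slice_int i (w h p) y) (q / p)) x"
      by (intro foldr_slice_int_mono_AE one) measurable
    then have "AE y in lborel_fun. ennreal_powr (foldr slice_int (i # is) (w (T (i # is)) q) y) (p / q)
        \<le> ennreal (k i powr p) * slice_int i (\<lambda>y. ennreal_powr (foldr slice_int is (w h q) y) (p / q)) y"
    proof eventually_elim
      case (elim y)
      have hp: "(\<lambda>z. ennreal_powr (w h p z) (q / p)) = w h q"
        using basic by (simp add: w_def ennreal_powr_powr fun_eq_iff)
      have "foldr slice_int (i # is) (w (T (i # is)) q) y
          \<le> ennreal (k i powr q) * foldr slice_int is (\<lambda>y. ennreal_powr (slice_int i (w h p) y) (q / p)) y"
        using elim unfolding perm by (subst (asm) foldr_slice_int_cmult) measurable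
      also have "\<dots> \<le> ennreal (k i powr q) * ennreal_powr (slice_int i (\<lambda>y. ennreal_powr (foldr slice_int is (w h q) y) (1 / (q / p))) y) (q / p)"
        unfolding hp[symmetric] using Cons.prems basic
        by (intro mult_left_mono foldr_slice_int_Minkowski) auto
      finally have "ennreal_powr (foldr slice_int (i # is) (w (T (i # is)) q) y) (p / q)
          \<le> ennreal_powr (ennreal (k i powr q) * ennreal_powr (slice_int i (\<lambda>y. ennreal_powr (foldr slice_int is (w h q) y) (1 / (q / p))) y) (q / p)) (p / q)"
        using basic by (intro ennreal_powr_mono) auto
      also have "\<dots> = ennreal (k i powr p) * slice_int i (\<lambda>y. ennreal_powr (foldr slice_int is (w h q) y) (p / q)) y"
        using basic by (simp add: ennreal_powr_mult ennreal_powr_powr ennreal_powr_ennreal powr_powr)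
      finally show ?case .
    qed
    from foldr_slice_int_mono_AE[OF this, of js] IH
    show ?case
    proof eventually_elim
      case (elim x)
      let ?S = "\<lambda>y. ennreal_powr (foldr slice_int is (w h q) y) (p / q)"
      have "foldr slice_int js (\<lambda>y. ennreal_powr (foldr slice_int (i # is) (w (T (i # is)) q) y) (p / q)) x
          \<le> foldr slice_int js (\<lambda>y. ennreal (k i powr p) * slice_int i ?S y) x" by (rule elim(1))
      also have "\<dots> = ennreal (k i powr p) * foldr slice_int (js @ [i]) ?S x"
        by (subst foldr_slice_int_cmult) simp_all
      also have "\<dots> \<le> ennreal (k i powr p) * ((\<Prod>i\<in>set is. ennreal (k i powr p)) * (\<integral>\<^sup>+x. w f p x \<partial>lborel_fun))"
        using elim(2) by (intro mult_left_mono) auto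
      also have "\<dots> = (\<Prod>i\<in>set (i # is). ennreal (k i powr p)) * (\<integral>\<^sup>+x. w f p x \<partial>lborel_fun)"
        using Cons.prems by (simp add: mult.assoc)
      finally show ?case .
    qed
  qed
  obtain "is" :: "'n list" where il: "distinct is" "set is = UNIV"
    using finite_distinct_list[of "UNIV :: 'n set"] by auto
  let ?C = "ennreal_powr (\<integral>\<^sup>+x. w (T is) q x \<partial>lborel_fun) (p / q)
      \<le> (\<Prod>i\<in>UNIV. ennreal (k i powr p)) * (\<integral>\<^sup>+x. w f p x \<partial>lborel_fun)"
  have AEC: "AE x in (lborel_fun :: ('n \<Rightarrow> real) measure). ?C"
    using main[of "is" "[]"] il by (simp add: foldr_slice_int_UNIV)
  have fin: ?C using AE_lborel_fun_const[OF AEC] .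
  have Teq: "T is x = (\<integral>\<^sup>+z. f z * (\<Prod>i\<in>UNIV. ennreal (\<bar>x i - z i\<bar> powr (\<alpha> - 1))) \<partial>lborel_fun)" for x
  proof -
    have "splice UNIV z x = z" for z by (simp add: splice_def)
    then show ?thesis unfolding T_def using il by (simp add: foldr_riesz_slice_eq)
  qed
  have "ennreal_powr (ennreal_powr (\<integral>\<^sup>+x. w (T is) q x \<partial>lborel_fun) (p / q)) (1 / p)
      \<le> ennreal_powr ((\<Prod>i\<in>UNIV. ennreal (k i powr p)) * (\<integral>\<^sup>+x. w f p x \<partial>lborel_fun)) (1 / p)"
    using fin basic by (intro ennreal_powr_mono) auto
  also have "\<dots> = (\<Prod>i\<in>UNIV. ennreal (k i)) * ennreal_powr (\<integral>\<^sup>+x. w f p x \<partial>lborel_fun) (1 / p)"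
  proof -
    have "(\<Prod>i\<in>(UNIV :: 'n set). ennreal (k i powr p)) = ennreal ((\<Prod>i\<in>UNIV. k i) powr p)"
      using k0 by (simp add: prod_ennreal prod_powr_distrib)
    then have "ennreal_powr (\<Prod>i\<in>UNIV. ennreal (k i powr p)) (1 / p) = (\<Prod>i\<in>UNIV. ennreal (k i))"
      using k0 basic by (simp add: ennreal_powr_ennreal powr_powr prod_ennreal prod_nonneg)
    then show ?thesis by (simp add: ennreal_powr_mult)
  qed
  finally show ?thesis using basic by (simp add: ennreal_powr_powr w_def Teq k_def)
qed

section \<open>Strong weights and their slices\<close>

text \<open>Otherwise every box meets \<open>E\<close> in at most the proportion
  \<open>\<eta>\<close>. A bounded part of measure \<open>m\<close> is covered by nonoverlapping
  boxes inside an open set of measure at most \<open>m + (1 - \<eta>) * m\<close>, whence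
  \<open>1 \<le> \<eta> * (2 - \<eta>)\<close>, that is,
  \<open>(1 - \<eta>)\<^sup>2 \<le> 0\<close>. The shape of the box is left uncontrolled.\<close>

lemma density_box:
  fixes E :: "'a::euclidean_space set"
  assumes E [measurable]: "E \<in> sets borel" and pos: "emeasure lborel E \<noteq> 0" and \<eta>: "0 < \<eta>" "\<eta> < 1"
  obtains a b where "\<And>i. i \<in> Basis \<Longrightarrow> a \<bullet> i < b \<bullet> i"
    "ennreal \<eta> * emeasure lborel (cbox a b) \<le> emeasure lborel (E \<inter> cbox a b)"
proof (rule ccontr)
  note hyp = that
  assume neg: "\<not> thesis"
  have small: "emeasure lborel (E \<inter> cbox c d) \<le> ennreal \<eta> * emeasure lborel (cbox c d)" if ne: "box c d \<noteq> {}" for c d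
    using neg hyp[of c d] box_ne_empty(2)[of c d] ne by (meson linear)
  let ?B = "\<lambda>n::nat. box (- (real n *\<^sub>R One)) (real n *\<^sub>R One) :: 'a set"
  have "\<exists>n. emeasure lborel (E \<inter> ?B n) \<noteq> 0"
  proof (rule ccontr)
    assume "\<not> ?thesis"
    then have "(\<Union>n. E \<inter> ?B n) \<in> null_sets lborel" by (intro null_sets_UN) (auto simp: null_sets_def)
    moreover have "(\<Union>n. E \<inter> ?B n) = E" using UN_box_eq_UNIV by blast
    ultimately show False using pos by auto
  qed
  then obtain n where n: "emeasure lborel (E \<inter> ?B n) \<noteq> 0" by auto
  define E' where "E' = E \<inter> ?B n"
  have [measurable]: "E' \<in> sets borel" by (simp add: E'_def)
  have "emeasure lborel E' \<le> emeasure lborel (?B n)" by (intro emeasure_mono) (auto simp: E'_def)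
  also have "\<dots> < \<infinity>" by (simp add: emeasure_lborel_box_eq)
  finally obtain m where m: "emeasure lborel E' = ennreal m" "0 < m"
    using n by (cases "emeasure lborel E'") (auto simp: E'_def less_le)
  obtain U where U: "open U" "E' \<subseteq> U" "emeasure lborel (U - E') < ennreal ((1 - \<eta>) * m)"
    using outer_regular_lborel[of E' "(1 - \<eta>) * m"] m \<eta> by auto
  \<comment> \<open>Every covering box has a tag in \<open>E'\<close> and lies in the gauge set of
    its tag, hence in \<open>U\<close>.\<close>
  define g where "g x = (if x \<in> U then U else UNIV)" for x
  have gauge: "gauge g" using U by (auto simp: gauge_def g_def)
  have E'box: "E' \<subseteq> cbox (- (real n *\<^sub>R One)) (real n *\<^sub>R One)" using box_subset_cbox by (auto simp: E'_def)
  have "E' \<noteq> {}" using m by auto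
  then have "?B n \<noteq> {}" by (auto simp: E'_def)
  from covering_lemma[OF E'box this gauge] obtain \<D> where D: "countable \<D>"
    "\<And>K. K \<in> \<D> \<Longrightarrow> interior K \<noteq> {} \<and> (\<exists>c d. K = cbox c d)"
    "pairwise (\<lambda>A B. interior A \<inter> interior B = {}) \<D>"
    "\<And>K. K \<in> \<D> \<Longrightarrow> \<exists>x \<in> E' \<inter> K. K \<subseteq> g x" "E' \<subseteq> \<Union>\<D>" by metis
  have KU: "K \<subseteq> U" if KD: "K \<in> \<D>" for K
  proof -
    obtain x where x: "x \<in> E'" "K \<subseteq> g x" using D(4)[OF KD] by auto
    then have "g x = U" using U(2) by (auto simp: g_def)
    then show ?thesis using x by simp
  qed
  have [measurable]: "K \<in> sets borel" if "K \<in> \<D>" for K using D(2)[OF that] by auto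
  have bd: "K - interior K \<in> null_sets lborel" "emeasure lborel K = emeasure lborel (interior K)" if KD: "K \<in> \<D>" for K
  proof -
    obtain c d where K: "K = cbox c d" using D(2)[OF KD] by auto
    show "emeasure lborel K = emeasure lborel (interior K)"
      by (simp add: K interior_cbox emeasure_lborel_box_eq emeasure_lborel_cbox_eq)
    then show "K - interior K \<in> null_sets lborel"
      using box_subset_cbox[of c d]
      by (auto simp: null_sets_def K interior_cbox emeasure_Diff emeasure_lborel_cbox_eq emeasure_lborel_box_eq)
  qed
  have disj: "disjoint_family_on (\<lambda>K. E' \<inter> interior K) \<D>" "disjoint_family_on interior \<D>"
    using D(3) by (auto simp: disjoint_family_on_def pairwise_def)
  define N where "N = (\<Union>K\<in>\<D>. K - interior K)"
  have N: "N \<in> null_sets lborel" unfolding N_def using D(1) bd by (intro null_sets_UN') auto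
  have Um: "(\<Union>K\<in>\<D>. E' \<inter> interior K) \<in> sets lborel" using D(1) by (intro sets.countable_UN') auto
  have "emeasure lborel E' \<le> emeasure lborel ((\<Union>K\<in>\<D>. E' \<inter> interior K) \<union> N)"
    using D(5) Um N by (intro emeasure_mono) (auto simp: N_def)
  also have "\<dots> = emeasure lborel (\<Union>K\<in>\<D>. E' \<inter> interior K)" by (rule emeasure_Un_null_set[OF Um N])
  also have "\<dots> = (\<integral>\<^sup>+K. emeasure lborel (E' \<inter> interior K) \<partial>count_space \<D>)"
    using D(1) disj by (intro emeasure_UN_countable) auto
  also have "\<dots> \<le> (\<integral>\<^sup>+K. ennreal \<eta> * emeasure lborel (interior K) \<partial>count_space \<D>)"
  proof (rule nn_integral_mono)
    fix K assume "K \<in> space (count_space \<D>)"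
    then have K: "K \<in> \<D>" by simp
    obtain c d where cd: "K = cbox c d" using D(2)[OF K] by auto
    have ne: "box c d \<noteq> {}" using D(2)[OF K] by (simp add: cd interior_cbox)
    have "emeasure lborel (E' \<inter> interior K) \<le> emeasure lborel (E \<inter> K)"
      using K interior_subset by (intro emeasure_mono) (auto simp: E'_def)
    also have "\<dots> \<le> ennreal \<eta> * emeasure lborel K" using small[OF ne] cd by simp
    finally show "emeasure lborel (E' \<inter> interior K) \<le> ennreal \<eta> * emeasure lborel (interior K)" using bd K by simp
  qed
  also have "\<dots> = ennreal \<eta> * (\<integral>\<^sup>+K. emeasure lborel (interior K) \<partial>count_space \<D>)"
    by (intro nn_integral_cmult) simp
  also have "(\<integral>\<^sup>+K. emeasure lborel (interior K) \<partial>count_space \<D>) = emeasure lborel (\<Union>K\<in>\<D>. interior K)"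
    using D(1) disj by (intro emeasure_UN_countable[symmetric]) auto
  also have "\<dots> \<le> emeasure lborel U"
  proof (rule emeasure_mono)
    show "(\<Union>K\<in>\<D>. interior K) \<subseteq> U" using KU interior_subset by (meson UN_least order_trans)
  qed (use U(1) in simp)
  also have "emeasure lborel U \<le> ennreal (m + (1 - \<eta>) * m)"
  proof -
    have "emeasure lborel U = emeasure lborel (E' \<union> (U - E'))" using U(2) by (intro arg_cong2[where f=emeasure]) auto
    also have "\<dots> \<le> emeasure lborel E' + emeasure lborel (U - E')" using U(1) by (intro emeasure_subadditive) auto
    also have "\<dots> \<le> ennreal m + ennreal ((1 - \<eta>) * m)" using m U(3) by (intro add_mono) auto
    finally show ?thesis using m \<eta> by simp
  qed
  finally have "ennreal m \<le> ennreal \<eta> * ennreal (m + (1 - \<eta>) * m)" using m by (simp add: mult_left_mono)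
  moreover have nn: "0 \<le> m + (1 - \<eta>) * m" using m \<eta> by simp
  ultimately have "ennreal m \<le> ennreal (\<eta> * (m + (1 - \<eta>) * m))"
    using \<eta> by (subst ennreal_mult) auto
  then have "m \<le> \<eta> * (m + (1 - \<eta>) * m)"
    using nn \<eta> ennreal_le_iff[of "\<eta> * (m + (1 - \<eta>) * m)" m] by (simp del: ennreal_plus)
  then have "m * 1 \<le> m * (\<eta> * (2 - \<eta>))" by (simp add: algebra_simps)
  then have "1 \<le> \<eta> * (2 - \<eta>)" using m by simp
  then have "(1 - \<eta>)\<^sup>2 \<le> 0" by (simp add: power2_eq_square algebra_simps)
  then show False using \<eta> by simp
qed

section \<open>Passage between vectors and functions on the index set\<close>

abbreviation vec_of :: "('n::finite \<Rightarrow> real) \<Rightarrow> real^'n" where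
  "vec_of z \<equiv> (\<chi> i. z i)"

lemma measurable_vec_of [measurable]: "(\<lambda>z. vec_of z) \<in> lborel_fun \<rightarrow>\<^sub>M (borel :: (real^'n::finite) measure)"
proof -
  have "(\<lambda>z. vec_of z \<bullet> b) \<in> borel_measurable lborel_fun" if bB: "b \<in> Basis" for b :: "real^'n"
  proof -
    obtain i where b: "b = axis i 1" using bB by (auto simp: Basis_vec_def)
    show ?thesis by (simp add: b inner_axis)
  qed
  then show ?thesis by (subst borel_measurable_euclidean_space) auto
qed

lemma measurable_vec_component [measurable]: "(\<lambda>x::real^'n::finite. x $ i) \<in> borel_measurable borel"
  by (simp add: borel_measurable_continuous_onI continuous_on_component)

lemma measurable_vec_nth [measurable]: "(\<lambda>x. (\<lambda>i. x $ i)) \<in> (borel :: (real^'n::finite) measure) \<rightarrow>\<^sub>M lborel_fun"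
proof (rule measurable_PiM_single')
  fix i :: 'n
  show "(\<lambda>x::real^'n. x $ i) \<in> borel \<rightarrow>\<^sub>M lborel"
    by simp
qed simp

lemma prod_Basis_vec: "(\<Prod>b\<in>Basis. g b) = (\<Prod>i\<in>UNIV. g (axis i (1::real) :: real^'n::finite))"
proof -
  have "Basis = range (\<lambda>i. axis i 1 :: real^'n)" by (auto simp: Basis_vec_def)
  moreover have inj: "inj (\<lambda>i. axis i 1 :: real^'n)" by (auto simp: inj_def axis_eq_axis)
  ultimately show ?thesis using prod.reindex[OF inj, of g] by (simp add: o_def)
qed

lemma lborel_vec_eq: "(lborel :: (real^'n::finite) measure) = distr lborel_fun borel (\<lambda>z. vec_of z)"
proof (rule lborel_eqI)
  interpret product_sigma_finite "\<lambda>_::'n. lborel :: real measure" by (rule product_sigma_finite_lborel)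
  fix l u :: "real^'n" assume le: "\<And>b. b \<in> Basis \<Longrightarrow> l \<bullet> b \<le> u \<bullet> b"
  have lu: "l $ i \<le> u $ i" for i using le[of "axis i 1"] by (simp add: inner_axis)
  have "emeasure (distr lborel_fun borel (\<lambda>z. vec_of z)) (box l u)
      = emeasure (lborel_fun :: ('n \<Rightarrow> real) measure) (Pi\<^sub>E UNIV (\<lambda>i. {l $ i<..<u $ i}))"
    by (subst emeasure_distr) (auto simp: mem_box_cart space_PiM PiE_iff intro!: arg_cong2[where f=emeasure])
  also have "\<dots> = (\<Prod>i\<in>UNIV. emeasure lborel {l $ i<..<u $ i})" by (intro emeasure_PiM) auto
  also have "\<dots> = (\<Prod>b\<in>Basis. (u - l) \<bullet> b)"
    using lu by (simp add: prod_Basis_vec inner_axis prod_ennreal)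
  finally show "emeasure (distr lborel_fun borel (\<lambda>z. vec_of z)) (box l u) = (\<Prod>b\<in>Basis. (u - l) \<bullet> b)" .
qed simp

lemma nn_integral_vec:
  fixes g :: "real^'n::finite \<Rightarrow> ennreal"
  assumes "g \<in> borel_measurable borel"
  shows "(\<integral>\<^sup>+x. g x \<partial>lebesgue) = (\<integral>\<^sup>+z. g (vec_of z) \<partial>lborel_fun)"
  unfolding nn_integral_completion by (subst lborel_vec_eq, subst nn_integral_distr) (use assms in auto)

lemma AE_vec:
  assumes "AE x in (lebesgue :: (real^'n::finite) measure). P x"
  shows "AE z in lborel_fun. P (vec_of z)"
proof -
  have "AE x in distr lborel_fun borel (\<lambda>z. vec_of z :: real^'n). P x"
    using assms unfolding AE_completion_iff lborel_vec_eq[symmetric] .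
  then show ?thesis by (rule AE_distrD[rotated]) measurable
qed

lemma weight_measurable:
  fixes w :: "'a::euclidean_space \<Rightarrow> real"
  assumes "weight w"
  shows "w \<in> borel_measurable lebesgue"
proof (rule borel_measurable_LIMSEQ_metric)
  let ?B = "\<lambda>n::nat. cbox (- (real n *\<^sub>R One)) (real n *\<^sub>R One) :: 'a set"
  show "(\<lambda>x. indicator (?B n) x *\<^sub>R w x) \<in> borel_measurable lebesgue" for n
    using assms by (auto simp: weight_def set_integrable_def dest!: spec[of _ "?B n"])
  fix x :: 'a
  obtain n where n: "x \<in> box (- (real n *\<^sub>R One)) (real n *\<^sub>R One)" using UN_box_eq_UNIV by blast
  have "x \<in> ?B m" if "n \<le> m" for m
  proof -
    have "box (- (real n *\<^sub>R One)) (real n *\<^sub>R One) \<subseteq> ?B m"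
      using that by (auto simp: mem_box) (smt (verit) of_nat_mono)+
    then show ?thesis using n by auto
  qed
  then have "eventually (\<lambda>m. indicator (?B m) x *\<^sub>R w x = w x) sequentially"
    unfolding eventually_sequentially by (intro exI[of _ n]) auto
  then show "(\<lambda>m. indicator (?B m) x *\<^sub>R w x) \<longlonglongrightarrow> w x" by (rule tendsto_eventually)
qed

lemma riesz_integrand_abs:
  "\<bar>riesz_integrand \<alpha> f x t\<bar> = \<bar>f t\<bar> * (\<Prod>i\<in>UNIV. \<bar>x $ i - t $ i\<bar> powr (\<alpha> - 1))"
proof -
  have e: "inverse (\<bar>x $ i - t $ i\<bar> powr (1 - \<alpha>)) = \<bar>x $ i - t $ i\<bar> powr (\<alpha> - 1)" for i
    using powr_minus[of "\<bar>x $ i - t $ i\<bar>" "1 - \<alpha>"] by simp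
  have "\<bar>riesz_integrand \<alpha> f x t\<bar> = \<bar>f t\<bar> * inverse (\<Prod>i\<in>UNIV. \<bar>x $ i - t $ i\<bar> powr (1 - \<alpha>))"
    by (simp add: riesz_integrand_def abs_mult abs_prod divide_inverse)
  also have "inverse (\<Prod>i\<in>UNIV. \<bar>x $ i - t $ i\<bar> powr (1 - \<alpha>)) = (\<Prod>i\<in>UNIV. \<bar>x $ i - t $ i\<bar> powr (\<alpha> - 1))"
    unfolding prod_inversef[symmetric] by (simp add: e)
  finally show ?thesis .
qed

lemma average_slice_cong:
  assumes "AE s in lborel. v s = v' s"
  shows "average S (\<lambda>s. v s powr e) = average S (\<lambda>s. v' s powr e)"
  unfolding average_def nn_integral_completion using assms
  by (intro arg_cong2[where f="(/)"] nn_integral_cong_AE refl) auto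

text \<open>Individual slices of a Lebesgue measurable function may fail to be measurable. A Borel
  representative agrees with almost every slice almost everywhere, so averages over these slices are
  unchanged.\<close>

lemma borel_version:
  fixes w :: "real^'n::finite \<Rightarrow> real"
  assumes "w \<in> borel_measurable lebesgue"
  obtains w0 where "w0 \<in> borel_measurable borel" "AE x in lebesgue. w x = w0 x"
    "AE z in lborel_fun. w (vec_of z) = w0 (vec_of z)"
    "\<And>i. AE z in lborel_fun. AE s in lborel. w (\<chi> j. if j = i then s else z j) = w0 (vec_of (z(i := s)))"
proof -
  obtain w0 where w0: "w0 \<in> borel_measurable lborel" "AE x in lborel. w x = w0 x"
    using completion_ex_borel_measurable_real[OF assms] by auto
  have 1: "AE x in lebesgue. w x = w0 x" using w0(2) by (simp add: AE_completion_iff)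
  note 2 = AE_vec[OF 1]
  have eq: "(\<chi> j. if j = i then s else z j) = vec_of (z(i := s))" for i s and z :: "'n \<Rightarrow> real"
    by (simp add: vec_eq_iff)
  have 3: "AE z in lborel_fun. AE s in lborel. w (\<chi> j. if j = i then s else z j) = w0 (vec_of (z(i := s)))" for i
    using AE_slice[OF 2, of i] unfolding eq .
  show ?thesis using that[OF _ 1 2 3] w0(1) by simp
qed

text \<open>Rational endpoints make this a countable conjunction, so an almost everywhere bound for
  each interval gives one for all of them together.\<close>

definition slice_condition :: "real \<Rightarrow> real \<Rightarrow> real \<Rightarrow> (real \<Rightarrow> real) \<Rightarrow> bool" where
  "slice_condition p q X v \<longleftrightarrow> (\<forall>a\<in>\<rat>. \<forall>b\<in>\<rat>. a < b \<longrightarrow>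
     average {a..b} (\<lambda>s. v s powr q) * ennreal_powr (average {a..b} (\<lambda>s. v s powr - (p / (p - 1)))) (q / (p / (p - 1))) \<le> ennreal X)"

text \<open>The estimate is proved for \<open>J\<close>, the potential of the absolute value of
  \<open>f\<close> with values up to infinity. \<open>J\<close> dominates the Bochner potential in
  every case; if the weighted norm of \<open>f\<close> is finite, then \<open>J\<close> is finite
  almost everywhere, which is integrability of the integrand.\<close>

lemma (in exponents) transfer_bound:
  fixes w f :: "real^'n::finite \<Rightarrow> real" and X :: "'n \<Rightarrow> real"
  assumes wm: "w \<in> borel_measurable lebesgue" and wp: "AE x in lebesgue. 0 < w x"
    and fm: "f \<in> borel_measurable lebesgue" and X: "\<And>i. 1 \<le> X i"
    and bd: "\<And>i. AE z in lborel_fun. slice_condition p q (X i) (\<lambda>s. w (\<chi> j. if j = i then s else z j))"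
  shows "Lp_norm q (\<lambda>x. w x * riesz_potential \<alpha> f x)
      \<le> (\<Prod>i\<in>UNIV. ennreal (one_dim_const * X i powr (max 1 (p' / q) * (1 - \<alpha>)))) * Lp_norm p (\<lambda>x. w x * f x)"
    and "Lp_norm p (\<lambda>x. w x * f x) < \<infinity> \<Longrightarrow> AE x in lebesgue. integrable lebesgue (riesz_integrand \<alpha> f x)"
proof -
  note basic = p_gt_1 q_gt_1 p'_gt_1 q'_gt_1 alpha_pos alpha_less_1 p_less_q
  obtain w0 where w0 [measurable]: "w0 \<in> borel_measurable borel" and ww: "AE x in lebesgue. w x = w0 x"
    "AE z in lborel_fun. w (vec_of z) = w0 (vec_of z)"
    "\<And>i. AE z in lborel_fun. AE s in lborel. w (\<chi> j. if j = i then s else z j) = w0 (vec_of (z(i := s)))"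
    using borel_version[OF wm] by blast
  obtain f0 where f0 [measurable]: "f0 \<in> borel_measurable borel" and ff: "AE x in lebesgue. f x = f0 x"
    using borel_version[OF fm] by blast
  define W where "W z = w0 (vec_of z)" for z
  define F where "F z = ennreal \<bar>f0 (vec_of z)\<bar>" for z
  have [measurable]: "W \<in> borel_measurable lborel_fun" "F \<in> borel_measurable lborel_fun"
    unfolding W_def F_def by measurable
  define J where "J x = (\<integral>\<^sup>+z. F z * (\<Prod>i\<in>UNIV. ennreal (\<bar>x i - z i\<bar> powr (\<alpha> - 1))) \<partial>lborel_fun)" for x :: "'n \<Rightarrow> real"
  obtain "is" :: "'n list" where il: "distinct is" "set is = UNIV"
    using finite_distinct_list[of "UNIV :: 'n set"] by auto
  \<comment> \<open>Writing \<open>J\<close> as iterated slices yields its measurability.\<close>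
  have "foldr (riesz_slice \<alpha>) is F x = J x" for x
  proof -
    have "splice UNIV z x = z" for z by (simp add: splice_def)
    then show ?thesis unfolding J_def using il by (simp add: foldr_riesz_slice_eq)
  qed
  then have "J = foldr (riesz_slice \<alpha>) is F" by (simp add: fun_eq_iff)
  then have [measurable]: "J \<in> borel_measurable lborel_fun" by simp
  have Wpos: "AE z in lborel_fun. 0 < W z"
    using AE_vec[OF wp] ww(2) by eventually_elim (simp add: W_def)
  have main: "ennreal_powr (\<integral>\<^sup>+x. ennreal_powr (ennreal (W x) * J x) q \<partial>lborel_fun) (1 / q)
    \<le> (\<Prod>i\<in>UNIV. ennreal (one_dim_const * X i powr (max 1 (p' / q) * (1 - \<alpha>)))) *
      ennreal_powr (\<integral>\<^sup>+x. ennreal_powr (ennreal (W x) * F x) p \<partial>lborel_fun) (1 / p)"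
    unfolding J_def
  proof (rule multi_dim[OF _ _ Wpos X])
    fix i
    show "AE x in lborel_fun. \<forall>a\<in>\<rat>. \<forall>b\<in>\<rat>. a < b \<longrightarrow>
      average {a..b} (\<lambda>s. W (x(i := s)) powr q) * ennreal_powr (average {a..b} (\<lambda>s. W (x(i := s)) powr - p')) (q / p') \<le> ennreal (X i)"
      using bd[of i] ww(3)[of i]
    proof eventually_elim
      case (elim z)
      have "average S (\<lambda>s. w (\<chi> j. if j = i then s else z j) powr e) = average S (\<lambda>s. W (z(i := s)) powr e)" for S e
        using elim(2) unfolding W_def by (rule average_slice_cong)
      then show ?case using elim(1) by (simp add: slice_condition_def p'_eq)
    qed
  qed measurable
  have Lp: "Lp_norm p (\<lambda>x. w x * f x) = ennreal_powr (\<integral>\<^sup>+x. ennreal_powr (ennreal (W x) * F x) p \<partial>lborel_fun) (1 / p)"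
  proof -
    have "(\<integral>\<^sup>+x. ennreal (\<bar>w x * f x\<bar> powr p) \<partial>lebesgue) = (\<integral>\<^sup>+x. ennreal (\<bar>w0 x * f0 x\<bar> powr p) \<partial>lebesgue)"
      by (rule nn_integral_cong_AE, use ww(1) ff in eventually_elim) simp
    also have "\<dots> = (\<integral>\<^sup>+z. ennreal (\<bar>w0 (vec_of z) * f0 (vec_of z)\<bar> powr p) \<partial>lborel_fun)"
      by (rule nn_integral_vec) measurable
    also have "\<dots> = (\<integral>\<^sup>+x. ennreal_powr (ennreal (W x) * F x) p \<partial>lborel_fun)"
    proof (rule nn_integral_cong_AE, use Wpos in eventually_elim)
      case (elim z)
      then have "ennreal (W z) * F z = ennreal \<bar>w0 (vec_of z) * f0 (vec_of z)\<bar>"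
        by (simp add: W_def F_def abs_mult flip: ennreal_mult)
      then show ?case by (simp add: ennreal_powr_ennreal)
    qed
    finally show ?thesis by (simp add: Lp_norm_def)
  qed
  have R: "(\<integral>\<^sup>+t. ennreal \<bar>riesz_integrand \<alpha> f x t\<bar> \<partial>lebesgue) = J (\<lambda>i. x $ i)" for x
  proof -
    have "(\<integral>\<^sup>+t. ennreal \<bar>riesz_integrand \<alpha> f x t\<bar> \<partial>lebesgue)
        = (\<integral>\<^sup>+t. ennreal (\<bar>f0 t\<bar> * (\<Prod>i\<in>UNIV. \<bar>x $ i - t $ i\<bar> powr (\<alpha> - 1))) \<partial>lebesgue)"
      by (rule nn_integral_cong_AE, use ff in eventually_elim) (simp add: riesz_integrand_abs)
    also have "\<dots> = (\<integral>\<^sup>+z. ennreal (\<bar>f0 (vec_of z)\<bar> * (\<Prod>i\<in>UNIV. \<bar>x $ i - vec_of z $ i\<bar> powr (\<alpha> - 1))) \<partial>lborel_fun)"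
      by (rule nn_integral_vec) measurable
    also have "\<dots> = J (\<lambda>i. x $ i)"
      unfolding J_def F_def by (intro nn_integral_cong) (simp add: ennreal_mult prod_nonneg prod_ennreal)
    finally show ?thesis .
  qed
  have rm: "riesz_integrand \<alpha> f x \<in> borel_measurable lebesgue" for x
  proof -
    have "(\<lambda>t. \<Prod>i\<in>UNIV. \<bar>x $ i - t $ i\<bar> powr (1 - \<alpha>)) \<in> borel_measurable (lborel :: (real^'n) measure)"
      by measurable
    from measurable_completion[OF this] show ?thesis
      unfolding riesz_integrand_def[abs_def] by (rule borel_measurable_divide[OF fm])
  qed
  \<comment> \<open>Where the integrand is not integrable, the Bochner integral is 0 by convention
    and the bound is trivial.\<close>
  have pot: "ennreal \<bar>riesz_potential \<alpha> f x\<bar> \<le> J (\<lambda>i. x $ i)" for x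
  proof (cases "integrable lebesgue (riesz_integrand \<alpha> f x)")
    case True
    then show ?thesis using integral_norm_bound_ennreal[OF True] by (simp add: R riesz_potential_def)
  qed (simp add: riesz_potential_def not_integrable_integral_eq)
  have "Lp_norm q (\<lambda>x. w x * riesz_potential \<alpha> f x)
      \<le> ennreal_powr (\<integral>\<^sup>+x. ennreal_powr (ennreal (w0 x) * J (\<lambda>i. x $ i)) q \<partial>lebesgue) (1 / q)"
    unfolding Lp_norm_def
  proof (rule ennreal_powr_mono)
    show "(\<integral>\<^sup>+x. ennreal (\<bar>w x * riesz_potential \<alpha> f x\<bar> powr q) \<partial>lebesgue)
        \<le> (\<integral>\<^sup>+x. ennreal_powr (ennreal (w0 x) * J (\<lambda>i. x $ i)) q \<partial>lebesgue)"
    proof (rule nn_integral_mono_AE, use ww(1) wp in eventually_elim)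
      case (elim x)
      have "ennreal (\<bar>w x * riesz_potential \<alpha> f x\<bar> powr q) = ennreal_powr (ennreal (w0 x) * ennreal \<bar>riesz_potential \<alpha> f x\<bar>) q"
        using elim by (simp add: ennreal_powr_ennreal abs_mult flip: ennreal_mult)
      also have "\<dots> \<le> ennreal_powr (ennreal (w0 x) * J (\<lambda>i. x $ i)) q"
        using pot basic by (intro ennreal_powr_mono mult_left_mono) auto
      finally show ?case .
    qed
  qed (use basic in simp)
  also have eqJ: "(\<integral>\<^sup>+x. ennreal_powr (ennreal (w0 x) * J (\<lambda>i. x $ i)) q \<partial>lebesgue) = (\<integral>\<^sup>+x. ennreal_powr (ennreal (W x) * J x) q \<partial>lborel_fun)"
  proof -
    have "($) (vec_of z) = z" for z :: "'n \<Rightarrow> real" by (simp add: fun_eq_iff)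
    then show ?thesis by (subst nn_integral_vec) (simp_all add: W_def)
  qed
  also have "ennreal_powr \<dots> (1 / q) \<le> (\<Prod>i\<in>UNIV. ennreal (one_dim_const * X i powr (max 1 (p' / q) * (1 - \<alpha>)))) * Lp_norm p (\<lambda>x. w x * f x)"
    using main by (simp add: Lp)
  finally show "Lp_norm q (\<lambda>x. w x * riesz_potential \<alpha> f x)
      \<le> (\<Prod>i\<in>UNIV. ennreal (one_dim_const * X i powr (max 1 (p' / q) * (1 - \<alpha>)))) * Lp_norm p (\<lambda>x. w x * f x)" .
  show "AE x in lebesgue. integrable lebesgue (riesz_integrand \<alpha> f x)" if "Lp_norm p (\<lambda>x. w x * f x) < \<infinity>"
  proof -
    have "(\<Prod>i\<in>(UNIV :: 'n set). ennreal (one_dim_const * X i powr (max 1 (p' / q) * (1 - \<alpha>)))) * Lp_norm p (\<lambda>x. w x * f x) < top"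
      using that one_dim_const_pos by (simp add: prod_ennreal less_imp_le ennreal_mult_less_top)
    then have "ennreal_powr (\<integral>\<^sup>+x. ennreal_powr (ennreal (w0 x) * J (\<lambda>i. x $ i)) q \<partial>lebesgue) (1 / q) < top"
      using main unfolding eqJ Lp by (rule le_less_trans[rotated])
    then have "(\<integral>\<^sup>+x. ennreal_powr (ennreal (w0 x) * J (\<lambda>i. x $ i)) q \<partial>lborel) \<noteq> \<infinity>"
      by (simp add: nn_integral_completion)
    then have "AE x in lborel. ennreal_powr (ennreal (w0 x) * J (\<lambda>i. x $ i)) q \<noteq> \<infinity>"
      by (intro nn_integral_noteq_infinite) measurable
    then have "AE x in lebesgue. ennreal_powr (ennreal (w0 x) * J (\<lambda>i. x $ i)) q \<noteq> \<infinity>"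
      by (simp add: AE_completion_iff)
    then show ?thesis using ww(1) wp
    proof eventually_elim
      case (elim x)
      then have "J (\<lambda>i. x $ i) \<noteq> top" by (auto simp: ennreal_mult_top)
      then have "(\<integral>\<^sup>+t. ennreal (norm (riesz_integrand \<alpha> f x t)) \<partial>lebesgue) < \<infinity>"
        by (simp add: R less_top)
      then show ?case using rm by (intro integrableI_bounded) auto
    qed
  qed
qed

section \<open>Uniform Muckenhoupt bounds on slices of strong weights\<close>

text \<open>Violation of a bound is an open condition, so a rational threshold witnesses it. The
  slices that violate the Muckenhoupt condition thus lie in a countable union of sets given by
  thresholds.\<close>

lemma ennreal_powr_approx:
  assumes "K < ennreal_powr U a * c" "0 < a"
  shows "\<exists>r\<in>\<rat>. 0 < r \<and> ennreal r < U \<and> K < ennreal_powr (ennreal r) a * c"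
proof -
  let ?R = "{r \<in> \<rat>. 0 < r \<and> ennreal r < U}"
  have U: "U = (SUP r\<in>?R. ennreal r)"
  proof (rule antisym)
    show "U \<le> (SUP r\<in>?R. ennreal r)"
    proof (rule dense_le)
      fix y assume "y < U"
      then obtain r :: rat where r: "y < ennreal (real_of_rat r)" "ennreal (real_of_rat r) < U"
        using ennreal_rat_dense by blast
      have "0 < real_of_rat r"
      proof (rule ccontr)
        assume "\<not> ?thesis"
        then have "ennreal (real_of_rat r) = 0" by (simp add: ennreal_eq_0_iff)
        with r(1) show False by simp
      qed
      then have "real_of_rat r \<in> ?R" using r by simp
      then show "y \<le> (SUP r\<in>?R. ennreal r)" using r(1) by (meson SUP_upper less_imp_le order_trans)
    qed
  qed (auto intro!: SUP_least)
  have "ennreal_powr U a * c = ennreal_powr (SUP r\<in>?R. ennreal r) a * c"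
    by (rule arg_cong[OF U, of "\<lambda>u. ennreal_powr u a * c"])
  also have "\<dots> = (SUP r\<in>?R. ennreal_powr (ennreal r) a * c)"
    by (simp only: ennreal_powr_SUP[OF assms(2)] SUP_mult_right_ennreal)
  finally have "K < (SUP r\<in>?R. ennreal_powr (ennreal r) a * c)" using assms(1) by (simp only:)
  then show ?thesis unfolding less_SUP_iff by blast
qed

text \<open>The slice average \<open>G\<close> does not depend on the \<open>i\<close>-th
  coordinate. The side of the dense box in that direction, over which there is no control, may
  therefore be exchanged for \<open>{a..b}\<close>, and its length cancels.\<close>

lemma box_average:
  fixes g :: "('n::finite \<Rightarrow> real) \<Rightarrow> ennreal" and lo hi :: "'n \<Rightarrow> real"
  assumes [measurable]: "g \<in> borel_measurable lborel_fun" and E [measurable]: "E \<in> sets lborel_fun"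
    and ab: "a < b" and lohi: "\<And>j. lo j < hi j" and r: "0 \<le> r" "0 \<le> \<eta>"
    and EG: "\<And>x. x \<in> E \<Longrightarrow> ennreal r \<le> slice_int i (\<lambda>y. g y * indicator {a..b} (y i)) x / ennreal (b - a)"
    and dens: "ennreal \<eta> * ennreal (\<Prod>j\<in>UNIV. hi j - lo j) \<le> emeasure lborel_fun (E \<inter> Pi\<^sub>E UNIV (\<lambda>j. {lo j..hi j}))"
  shows "ennreal (r * \<eta>) \<le> (\<integral>\<^sup>+x. g x * (\<Prod>j\<in>UNIV. indicator {(lo(i := a)) j..(hi(i := b)) j} (x j)) \<partial>lborel_fun)
      / ennreal (\<Prod>j\<in>UNIV. (hi(i := b)) j - (lo(i := a)) j)"
proof -
  define G where "G x = slice_int i (\<lambda>y. g y * indicator {a..b} (y i)) x" for x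
  have [measurable]: "G \<in> borel_measurable lborel_fun" unfolding G_def by measurable
  \<comment> \<open>Here \<open>q\<close> is the indicator of the cross-section common to both
    boxes, not an exponent.\<close>
  define q where "q x = (\<Prod>j\<in>- {i}. indicator {lo j..hi j} (x j) :: ennreal)" for x :: "'n \<Rightarrow> real"
  have [measurable]: "q \<in> borel_measurable lborel_fun" unfolding q_def by measurable
  have q_upd: "q (x(i := t)) = q x" for x t unfolding q_def by (intro prod.cong) auto
  have G_upd: "G (x(i := t)) = G x" for x t by (simp add: G_def slice_int_def)
  have split: "(\<Prod>j\<in>UNIV. h j) = h i * (\<Prod>j\<in>- {i}. h j)" for h :: "'n \<Rightarrow> 'b::comm_monoid_mult"
  proof -
    have "UNIV = insert i (- {i})" by auto
    then have "(\<Prod>j\<in>UNIV. h j) = (\<Prod>j\<in>insert i (- {i}). h j)" by simp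
    then show ?thesis by simp
  qed
  let ?P' = "\<lambda>x. (\<Prod>j\<in>UNIV. indicator {(lo(i := a)) j..(hi(i := b)) j} (x j)) :: ennreal"
  let ?P = "\<lambda>x. (\<Prod>j\<in>UNIV. indicator {lo j..hi j} (x j)) :: ennreal"
  have P': "?P' x = indicator {a..b} (x i) * q x" for x
    unfolding split q_def by (intro arg_cong2[where f="(*)"] prod.cong) auto
  have P: "?P x = indicator {lo i..hi i} (x i) * q x" for x unfolding split q_def ..
  define D where "D = (\<Prod>j\<in>- {i}. hi j - lo j)"
  have D: "0 < D" unfolding D_def using lohi by (intro prod_pos) simp
  have vol: "(\<Prod>j\<in>UNIV. hi j - lo j) = (hi i - lo i) * D" unfolding split D_def ..
  have vol': "(\<Prod>j\<in>UNIV. (hi(i := b)) j - (lo(i := a)) j) = (b - a) * D"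
    unfolding split D_def by (intro arg_cong2[where f="(*)"] prod.cong) auto
  define I where "I = (\<integral>\<^sup>+x. g x * ?P' x \<partial>lborel_fun)"
  have e1: "slice_int i (\<lambda>x. g x * ?P' x) x = q x * G x" for x
  proof -
    have "slice_int i (\<lambda>x. g x * ?P' x) x = (\<integral>\<^sup>+t. q x * (g (x(i := t)) * indicator {a..b} t) \<partial>lborel)"
      unfolding slice_int_def P' q_upd by (intro nn_integral_cong) (simp add: mult_ac)
    also have "\<dots> = q x * (\<integral>\<^sup>+t. g (x(i := t)) * indicator {a..b} t \<partial>lborel)"
      by (intro nn_integral_cmult borel_measurable_times measurable_slice_comp') measurable
    finally show ?thesis by (simp add: G_def slice_int_def)
  qed
  have e2: "slice_int i (\<lambda>x. G x * ?P x) x = ennreal (hi i - lo i) * (q x * G x)" for x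
  proof -
    have "slice_int i (\<lambda>x. G x * ?P x) x = (\<integral>\<^sup>+t. (q x * G x) * indicator {lo i..hi i} t \<partial>lborel)"
      unfolding slice_int_def P q_upd G_upd by (intro nn_integral_cong) (simp add: mult_ac)
    also have "\<dots> = (q x * G x) * ennreal (hi i - lo i)"
      using lohi[of i] by (subst nn_integral_cmult) (auto simp: less_imp_le)
    finally show ?thesis by (simp add: mult_ac)
  qed
  have mP: "(\<lambda>x. g x * ?P' x) \<in> borel_measurable lborel_fun" "(\<lambda>x. G x * ?P x) \<in> borel_measurable lborel_fun"
    unfolding P' P by measurable
  \<comment> \<open>Integrating out the \<open>i\<close>-th variable leaves \<open>q * G\<close> on
    either side; only the old side length in direction \<open>i\<close> remains as a factor.\<close>
  have A1: "(\<integral>\<^sup>+x. G x * ?P x \<partial>lborel_fun) = ennreal (hi i - lo i) * I"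
  proof -
    have qG: "(\<lambda>y. q y * G y) \<in> borel_measurable (Pi\<^sub>M (- {i}) (\<lambda>_. lborel))"
    proof -
      have [measurable]: "(\<lambda>y. y(i := 0)) \<in> Pi\<^sub>M (- {i}) (\<lambda>_. lborel) \<rightarrow>\<^sub>M (lborel_fun :: ('n \<Rightarrow> real) measure)"
      proof (rule measurable_PiM_single')
        fix j
        show "(\<lambda>y. (y(i := 0)) j) \<in> Pi\<^sub>M (- {i}) (\<lambda>_. lborel) \<rightarrow>\<^sub>M (lborel :: real measure)"
        proof (cases "j = i")
          case False
          then have "(\<lambda>y. y j) \<in> Pi\<^sub>M (- {i}) (\<lambda>_. lborel) \<rightarrow>\<^sub>M (lborel :: real measure)"
            by (intro measurable_component_singleton) simp
          then show ?thesis using False by simp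
        qed simp
      qed simp
      have "(\<lambda>y. q (y(i := 0)) * G (y(i := 0))) \<in> borel_measurable (Pi\<^sub>M (- {i}) (\<lambda>_. lborel))" by measurable
      then show ?thesis by (simp add: q_upd G_upd)
    qed
    have "(\<integral>\<^sup>+x. G x * ?P x \<partial>lborel_fun) = (\<integral>\<^sup>+y. ennreal (hi i - lo i) * (q y * G y) \<partial>Pi\<^sub>M (- {i}) (\<lambda>_. lborel))"
      unfolding nn_integral_slice[OF mP(2), of i] ext[OF e2] ..
    also have "\<dots> = ennreal (hi i - lo i) * (\<integral>\<^sup>+y. q y * G y \<partial>Pi\<^sub>M (- {i}) (\<lambda>_. lborel))"
      using qG by (rule nn_integral_cmult)
    also have "(\<integral>\<^sup>+y. q y * G y \<partial>Pi\<^sub>M (- {i}) (\<lambda>_. lborel)) = I"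
      unfolding I_def nn_integral_slice[OF mP(1), of i] ext[OF e1] ..
    finally show ?thesis .
  qed
  have A2: "ennreal (r * (b - a)) * emeasure lborel_fun (E \<inter> Pi\<^sub>E UNIV (\<lambda>j. {lo j..hi j})) \<le> (\<integral>\<^sup>+x. G x * ?P x \<partial>lborel_fun)"
  proof -
    have box: "Pi\<^sub>E UNIV (\<lambda>j. {lo j..hi j}) \<in> sets (lborel_fun :: ('n \<Rightarrow> real) measure)"
      by (rule sets_PiM_I_finite) auto
    have "ennreal (r * (b - a)) * emeasure lborel_fun (E \<inter> Pi\<^sub>E UNIV (\<lambda>j. {lo j..hi j}))
        = (\<integral>\<^sup>+x. ennreal (r * (b - a)) * indicator (E \<inter> Pi\<^sub>E UNIV (\<lambda>j. {lo j..hi j})) x \<partial>lborel_fun)"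
      using box by (simp add: nn_integral_cmult_indicator)
    also have "\<dots> \<le> (\<integral>\<^sup>+x. G x * ?P x \<partial>lborel_fun)"
    proof (rule nn_integral_mono)
      fix x
      show "ennreal (r * (b - a)) * indicator (E \<inter> Pi\<^sub>E UNIV (\<lambda>j. {lo j..hi j})) x \<le> G x * ?P x"
      proof (cases "x \<in> E \<inter> Pi\<^sub>E UNIV (\<lambda>j. {lo j..hi j})")
        case True
        have "ennreal r * ennreal (b - a) \<le> G x / ennreal (b - a) * ennreal (b - a)"
          using EG[of x] True by (intro mult_right_mono) (auto simp: G_def)
        also have "\<dots> = G x" using ab by (simp add: ennreal_divide_times ennreal_times_divide[symmetric] mult_divide_eq_ennreal)
        finally have "ennreal (r * (b - a)) \<le> G x" using r ab by (simp add: ennreal_mult)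
        moreover have "?P x = 1" using True by (intro prod.neutral) (auto simp: indicator_def PiE_iff)
        ultimately show ?thesis using True by simp
      qed simp
    qed
    finally show ?thesis .
  qed
  have "ennreal (r * (b - a)) * (ennreal \<eta> * ennreal ((hi i - lo i) * D)) \<le> ennreal (hi i - lo i) * I"
    using order_trans[OF mult_left_mono[OF dens[unfolded vol], of "ennreal (r * (b - a))"] A2] unfolding A1 by simp
  moreover have "ennreal (r * (b - a)) * (ennreal \<eta> * ennreal ((hi i - lo i) * D))
      = ennreal (hi i - lo i) * ennreal (r * \<eta> * ((b - a) * D))"
    using r ab lohi[of i] D by (simp add: mult_ac flip: ennreal_mult)
  ultimately have "ennreal (hi i - lo i) * ennreal (r * \<eta> * ((b - a) * D)) \<le> ennreal (hi i - lo i) * I" by simp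
  then have "ennreal (r * \<eta> * ((b - a) * D)) \<le> I"
    using lohi[of i] by (subst (asm) ennreal_mult_le_mult_iff) auto
  moreover have pos: "0 < (b - a) * D" using ab D by simp
  ultimately have "ennreal (r * \<eta> * ((b - a) * D)) / ennreal ((b - a) * D) \<le> I / ennreal ((b - a) * D)"
    by (intro divide_right_mono_ennreal)
  moreover have "ennreal (r * \<eta> * ((b - a) * D)) / ennreal ((b - a) * D) = ennreal (r * \<eta>)"
    using pos r by (subst divide_ennreal) auto
  ultimately show ?thesis by (simp only: I_def vol')
qed

text \<open>Suppose that on a set of positive measure the two slice averages over
  \<open>{a..b}\<close> exceed thresholds whose combined value is larger than \<open>K\<close>. A
  box almost filled by that set, with its \<open>i\<close>-th side replaced by
  \<open>{a..b}\<close>, then violates the strong condition. Thresholds and endpoints are rational,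
  so countably many null sets suffice.\<close>

lemma (in exponents) strong_slice_condition:
  fixes w :: "real^'n::finite \<Rightarrow> real"
  assumes w: "w \<in> A_strong p q"
  obtains X where "1 \<le> X" "\<And>i. AE z in lborel_fun. slice_condition p q X (\<lambda>s. w (\<chi> j. if j = i then s else z j))"
proof -
  note basic = p_gt_1 q_gt_1 p'_gt_1 q'_gt_1 alpha_pos alpha_less_1 p_less_q
  have wt: "weight w" using w by (simp add: A_strong_def)
  obtain w0 where w0 [measurable]: "w0 \<in> borel_measurable borel" and ww: "AE x in lebesgue. w x = w0 x"
    "\<And>i. AE z in lborel_fun. AE s in lborel. w (\<chi> j. if j = i then s else z j) = w0 (vec_of (z(i := s)))"
    using borel_version[OF weight_measurable[OF wt]] by blast
  define W where "W z = w0 (vec_of z)" for z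
  have [measurable]: "W \<in> borel_measurable lborel_fun" unfolding W_def by measurable
  define S where "S = (SUP P \<in> {cbox a b | a b :: real^'n. \<forall>i. a $ i < b $ i}.
        ennreal_powr (average P (\<lambda>x. w x powr q)) (1 / q) * ennreal_powr (average P (\<lambda>x. w x powr - p')) (1 / p'))"
  have "S < top" using w by (simp add: A_strong_def S_def p'_eq)
  then obtain K where K: "S = ennreal K" "0 \<le> K" by (cases S) auto
  have avg: "average (cbox (vec_of lo) (vec_of hi)) (\<lambda>x. w x powr e)
      = (\<integral>\<^sup>+x. ennreal (W x powr e) * (\<Prod>j\<in>UNIV. indicator {lo j..hi j} (x j)) \<partial>lborel_fun) / ennreal (\<Prod>j\<in>UNIV. hi j - lo j)"
    if lh: "\<And>j. lo j < hi j" for lo hi :: "'n \<Rightarrow> real" and e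
  proof -
    have "(\<integral>\<^sup>+x\<in>cbox (vec_of lo) (vec_of hi). ennreal (w x powr e) \<partial>lebesgue)
        = (\<integral>\<^sup>+x\<in>cbox (vec_of lo) (vec_of hi). ennreal (w0 x powr e) \<partial>lebesgue)"
      by (rule nn_integral_cong_AE, use ww(1) in eventually_elim) simp
    also have "\<dots> = (\<integral>\<^sup>+z. ennreal (W z powr e) * indicator (cbox (vec_of lo) (vec_of hi)) (vec_of z) \<partial>lborel_fun)"
      by (subst nn_integral_vec) (simp_all add: W_def)
    also have "\<dots> = (\<integral>\<^sup>+x. ennreal (W x powr e) * (\<Prod>j\<in>UNIV. indicator {lo j..hi j} (x j)) \<partial>lborel_fun)"
    proof (intro nn_integral_cong arg_cong2[where f="(*)"] refl)
      fix z :: "'n \<Rightarrow> real"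
      show "indicator (cbox (vec_of lo) (vec_of hi)) (vec_of z) = (\<Prod>j\<in>UNIV. indicator {lo j..hi j} (z j) :: ennreal)"
      proof (cases "\<forall>j. z j \<in> {lo j..hi j}")
        case False
        then obtain j where j: "z j \<notin> {lo j..hi j}" by auto
        have "\<exists>j\<in>UNIV. indicator {lo j..hi j} (z j) = (0 :: ennreal)"
          by (rule bexI[of _ j]) (use j in \<open>simp_all add: indicator_def\<close>)
        then have "(\<Prod>j\<in>UNIV. indicator {lo j..hi j} (z j) :: ennreal) = 0"
          by (intro prod_zero) auto
        then show ?thesis using False by (auto simp: mem_box_cart indicator_def)
      qed (auto simp: mem_box_cart indicator_def)
    qed
    finally have num: "(\<integral>\<^sup>+x\<in>cbox (vec_of lo) (vec_of hi). ennreal (w x powr e) \<partial>lebesgue)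
        = (\<integral>\<^sup>+x. ennreal (W x powr e) * (\<Prod>j\<in>UNIV. indicator {lo j..hi j} (x j)) \<partial>lborel_fun)" .
    have "emeasure lebesgue (cbox (vec_of lo) (vec_of hi :: real^'n)) = ennreal (\<Prod>j\<in>UNIV. hi j - lo j)"
    proof -
      have "\<forall>b\<in>Basis. vec_of lo \<bullet> b \<le> (vec_of hi :: real^'n) \<bullet> b"
        using lh by (auto simp: Basis_vec_def inner_axis less_imp_le)
      then show ?thesis by (simp add: emeasure_lborel_cbox_eq prod_Basis_vec inner_axis)
    qed
    then show ?thesis unfolding average_def num by simp
  qed
  have boxK: "ennreal_powr ((\<integral>\<^sup>+x. ennreal (W x powr q) * (\<Prod>j\<in>UNIV. indicator {lo j..hi j} (x j)) \<partial>lborel_fun) / ennreal (\<Prod>j\<in>UNIV. hi j - lo j)) (1 / q)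
      * ennreal_powr ((\<integral>\<^sup>+x. ennreal (W x powr - p') * (\<Prod>j\<in>UNIV. indicator {lo j..hi j} (x j)) \<partial>lborel_fun) / ennreal (\<Prod>j\<in>UNIV. hi j - lo j)) (1 / p')
      \<le> ennreal K" if lh: "\<And>j. lo j < hi j" for lo hi :: "'n \<Rightarrow> real"
    unfolding K(1)[symmetric] S_def avg[OF lh, symmetric]
    by (intro SUP_upper CollectI exI[of _ "vec_of lo"] exI[of _ "vec_of hi"] conjI refl allI) (simp add: lh)
  define A where "A e i a b x = slice_int i (\<lambda>y. ennreal (W y powr e) * indicator {a..b} (y i)) x / ennreal (b - a)" for e i a b x
  have [measurable]: "A e i a b \<in> borel_measurable lborel_fun" for e i a b unfolding A_def by measurable
  have null: "AE x in lborel_fun. \<not> (ennreal r < A q i a b x \<and> ennreal t < A (- p') i a b x)"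
    if ab: "a < b" and rt: "0 < r" "0 < t" "K < r powr (1 / q) * t powr (1 / p')" for i a b r t
  proof (rule ccontr)
    assume neg: "\<not> ?thesis"
    define E where "E = {x. ennreal r < A q i a b x \<and> ennreal t < A (- p') i a b x}"
    have Em [measurable]: "E \<in> sets lborel_fun"
    proof -
      have "E = {x \<in> space lborel_fun. ennreal r < A q i a b x \<and> ennreal t < A (- p') i a b x}"
        by (simp add: E_def space_PiM)
      then show ?thesis by simp
    qed
    have posE: "emeasure lborel_fun E \<noteq> 0"
    proof
      assume "emeasure lborel_fun E = 0"
      then have "AE x in lborel_fun. x \<notin> E" by (intro AE_not_in) (auto simp: null_sets_def)
      with neg show False by (simp add: E_def)
    qed
    define E0 where "E0 = (\<lambda>x::real^'n. (\<lambda>i. x $ i)) -` E"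
    have [measurable]: "E0 \<in> sets borel"
      using measurable_sets[OF measurable_vec_nth \<open>E \<in> sets lborel_fun\<close>] by (simp add: E0_def)
    have me: "emeasure lborel B = emeasure lborel_fun ((\<lambda>z. vec_of z) -` B)" if "B \<in> sets borel" for B :: "(real^'n) set"
      by (subst lborel_vec_eq, subst emeasure_distr) (use that in \<open>auto simp: space_PiM\<close>)
    have vE0: "(\<lambda>z. vec_of z) -` (E0 \<inter> C) = E \<inter> (\<lambda>z. vec_of z) -` C" for C
    proof -
      have "($) (vec_of z) = z" for z :: "'n \<Rightarrow> real" by (simp add: fun_eq_iff)
      then show ?thesis by (auto simp: E0_def)
    qed
    define \<kappa> where "\<kappa> = r powr (1 / q) * t powr (1 / p')"
    have kap: "0 < \<kappa>" "K < \<kappa>" using rt by (auto simp: \<kappa>_def)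
    define k where "k = K / \<kappa>"
    \<comment> \<open>Any proportion strictly between \<open>K / \<kappa>\<close> and 1 works,
      because \<open>\<eta> \<le> \<eta> powr (1 - \<alpha>)\<close>; the midpoint is taken.\<close>
    define \<eta> where "\<eta> = (k + 1) / 2"
    have kk: "k < 1" "0 \<le> k" using kap K by (auto simp: k_def)
    have eta: "0 < \<eta>" "\<eta> < 1" "k < \<eta>" unfolding \<eta>_def using kk by auto
    obtain a' b' :: "real^'n" where box: "\<And>j. j \<in> Basis \<Longrightarrow> a' \<bullet> j < b' \<bullet> j"
      "ennreal \<eta> * emeasure lborel (cbox a' b') \<le> emeasure lborel (E0 \<inter> cbox a' b')"
      using density_box[of E0 \<eta>] posE me[of E0] vE0[of UNIV] eta by auto
    have lh: "a' $ j < b' $ j" for j using box(1)[of "axis j 1"] by (simp add: inner_axis)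
    have vol: "emeasure lborel (cbox a' b') = ennreal (\<Prod>j\<in>UNIV. b' $ j - a' $ j)"
    proof -
      have "\<forall>b\<in>Basis. a' \<bullet> b \<le> b' \<bullet> b" using box(1) by (auto simp: less_imp_le)
      then show ?thesis by (simp add: emeasure_lborel_cbox_eq prod_Basis_vec inner_axis)
    qed
    have "emeasure lborel (E0 \<inter> cbox a' b') = emeasure lborel_fun (E \<inter> Pi\<^sub>E UNIV (\<lambda>j. {a' $ j..b' $ j}))"
    proof -
      have v: "(\<lambda>z. vec_of z) -` cbox a' b' = Pi\<^sub>E UNIV (\<lambda>j. {a' $ j..b' $ j})"
        by (auto simp: mem_box_cart PiE_iff)
      have "emeasure lborel (E0 \<inter> cbox a' b') = emeasure lborel_fun ((\<lambda>z. vec_of z) -` (E0 \<inter> cbox a' b'))"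
        by (rule me) simp
      then show ?thesis unfolding vE0 v .
    qed
    then have dens: "ennreal \<eta> * ennreal (\<Prod>j\<in>UNIV. b' $ j - a' $ j) \<le> emeasure lborel_fun (E \<inter> Pi\<^sub>E UNIV (\<lambda>j. {a' $ j..b' $ j}))"
      using box(2) vol by simp
    let ?lo = "(\<lambda>j. a' $ j)(i := a)" and ?hi = "(\<lambda>j. b' $ j)(i := b)"
    let ?av = "\<lambda>e. (\<integral>\<^sup>+x. ennreal (W x powr e) * (\<Prod>j\<in>UNIV. indicator {?lo j..?hi j} (x j)) \<partial>lborel_fun) / ennreal (\<Prod>j\<in>UNIV. ?hi j - ?lo j)"
    have r_le: "ennreal (r * \<eta>) \<le> ?av q"
      using rt eta by (intro box_average[OF _ Em ab lh _ _ _ dens]) (auto simp: E_def A_def less_imp_le simp del: fun_upd_apply)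
    have t_le: "ennreal (t * \<eta>) \<le> ?av (- p')"
      using rt eta by (intro box_average[OF _ Em ab lh _ _ _ dens]) (auto simp: E_def A_def less_imp_le simp del: fun_upd_apply)
    have "ennreal ((r * \<eta>) powr (1 / q) * (t * \<eta>) powr (1 / p')) = ennreal_powr (ennreal (r * \<eta>)) (1 / q) * ennreal_powr (ennreal (t * \<eta>)) (1 / p')"
    proof -
      have nn: "0 \<le> r * \<eta>" "0 \<le> t * \<eta>" using rt eta by auto
      show ?thesis by (simp only: ennreal_powr_ennreal[OF nn(1)] ennreal_powr_ennreal[OF nn(2)] ennreal_mult powr_ge_zero)
    qed
    also have "\<dots> \<le> ennreal_powr (?av q) (1 / q) * ennreal_powr (?av (- p')) (1 / p')"
      using r_le t_le basic by (intro mult_mono ennreal_powr_mono) auto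
    also have "\<dots> \<le> ennreal K" using ab lh by (intro boxK) auto
    finally have "(r * \<eta>) powr (1 / q) * (t * \<eta>) powr (1 / p') \<le> K" using K by simp
    moreover have "(r * \<eta>) powr (1 / q) * (t * \<eta>) powr (1 / p') = \<kappa> * \<eta> powr (1 - \<alpha>)"
      by (simp add: powr_mult \<kappa>_def inv_q_p'[symmetric] powr_add)
    moreover have "\<eta> powr 1 \<le> \<eta> powr (1 - \<alpha>)" using eta basic by (intro powr_mono') auto
    ultimately have "\<kappa> * \<eta> \<le> K" using kap eta by (smt (verit) mult_left_mono powr_one)
    then show False using eta(3) kap by (simp add: k_def divide_less_eq mult.commute)
  qed
  \<comment> \<open>The power \<open>q\<close> accounts for the different normalisations of
    \<open>A_strong\<close> and of the one-variable condition.\<close>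
  define X where "X = max 1 (K powr q)"
  show ?thesis
  proof (rule that)
    show "1 \<le> X" by (simp add: X_def)
    fix i
    have ae: "AE x in lborel_fun. \<forall>a\<in>\<rat>. \<forall>b\<in>\<rat>. \<forall>r\<in>\<rat>. \<forall>t\<in>\<rat>. a < b \<and> 0 < r \<and> 0 < t \<and> K < r powr (1 / q) * t powr (1 / p') \<longrightarrow>
        \<not> (ennreal r < A q i a b x \<and> ennreal t < A (- p') i a b x)"
    proof (intro AE_ball_countable' countable_rat)
      fix a b r t :: real
      show "AE x in lborel_fun. a < b \<and> 0 < r \<and> 0 < t \<and> K < r powr (1 / q) * t powr (1 / p') \<longrightarrow>
        \<not> (ennreal r < A q i a b x \<and> ennreal t < A (- p') i a b x)"
        using null[of a b r t i] by (cases "a < b \<and> 0 < r \<and> 0 < t \<and> K < r powr (1 / q) * t powr (1 / p')") auto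
    qed
    show "AE z in lborel_fun. slice_condition p q X (\<lambda>s. w (\<chi> j. if j = i then s else z j))"
      using ae ww(2)[of i]
    proof eventually_elim
      case (elim z)
      have av: "average {a..b} (\<lambda>s. w (\<chi> j. if j = i then s else z j) powr e) = A e i a b z" if "a < b" for a b e
      proof -
        have "average {a..b} (\<lambda>s. w (\<chi> j. if j = i then s else z j) powr e) = average {a..b} (\<lambda>s. W (z(i := s)) powr e)"
          using elim(2) unfolding W_def by (rule average_slice_cong)
        also have "\<dots> = A e i a b z"
          using that by (simp add: average_def A_def slice_int_def nn_integral_completion)
        finally show ?thesis .
      qed
      show ?case
        unfolding slice_condition_def p'_eq[symmetric]
      proof (intro ballI impI)
        fix a b :: real assume ab: "a \<in> \<rat>" "b \<in> \<rat>" "a < b"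
        have "ennreal_powr (A q i a b z) (1 / q) * ennreal_powr (A (- p') i a b z) (1 / p') \<le> ennreal K"
        proof (rule ccontr)
          assume "\<not> ?thesis"
          then have "ennreal K < ennreal_powr (A q i a b z) (1 / q) * ennreal_powr (A (- p') i a b z) (1 / p')" by simp
          from ennreal_powr_approx[OF this] basic obtain r where r: "r \<in> \<rat>" "0 < r" "ennreal r < A q i a b z"
            "ennreal K < ennreal_powr (ennreal r) (1 / q) * ennreal_powr (A (- p') i a b z) (1 / p')" by auto
          then have "ennreal K < ennreal_powr (A (- p') i a b z) (1 / p') * ennreal_powr (ennreal r) (1 / q)" by (simp add: mult.commute)
          from ennreal_powr_approx[OF this] basic obtain t where t: "t \<in> \<rat>" "0 < t" "ennreal t < A (- p') i a b z"
            "ennreal K < ennreal_powr (ennreal t) (1 / p') * ennreal_powr (ennreal r) (1 / q)" by auto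
          have "ennreal K < ennreal (r powr (1 / q) * t powr (1 / p'))"
            using t r by (simp add: ennreal_powr_ennreal ennreal_mult mult.commute)
          then have "K < r powr (1 / q) * t powr (1 / p')" using K by (simp add: ennreal_less_iff)
          then show False using elim(1) ab r t by blast
        qed
        then have "ennreal_powr (ennreal_powr (A q i a b z) (1 / q) * ennreal_powr (A (- p') i a b z) (1 / p')) q \<le> ennreal_powr (ennreal K) q"
          using basic by (intro ennreal_powr_mono) auto
        then have "A q i a b z * ennreal_powr (A (- p') i a b z) (q / p') \<le> ennreal (K powr q)"
          using basic K by (simp add: ennreal_powr_mult ennreal_powr_powr ennreal_powr_ennreal)
        also have "\<dots> \<le> ennreal X" by (intro ennreal_leI) (simp add: X_def)
        finally show "average {a..b} (\<lambda>s. w (\<chi> j. if j = i then s else z j) powr q)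
            * ennreal_powr (average {a..b} (\<lambda>s. w (\<chi> j. if j = i then s else z j) powr - p')) (q / p') \<le> ennreal X"
          using ab by (simp add: av)
      qed
    qed
  qed
qed

section \<open>Characteristics and the upper bound\<close>

text \<open>This is Hoelder's inequality on an interval of length 1. If a mass is infinite, so is
  the product, because both masses are positive.\<close>

lemma (in exponents) slice_average_ge_1:
  fixes v :: "real \<Rightarrow> real"
  assumes [measurable]: "v \<in> borel_measurable borel" and v: "AE s in lborel. 0 < v s"
  shows "1 \<le> average {0..1} (\<lambda>s. v s powr q) * ennreal_powr (average {0..1} (\<lambda>s. v s powr - p')) (q / p')"
proof -
  note basic = p_gt_1 q_gt_1 p'_gt_1 q'_gt_1 alpha_pos alpha_less_1 p_less_q
  define v0 where "v0 x = (if 0 < v x then v x else 1)" for x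
  have [measurable]: "v0 \<in> borel_measurable borel" unfolding v0_def by measurable
  have vv: "AE x in lborel. v x = v0 x" using v by eventually_elim (simp add: v0_def)
  have v0p: "0 < v0 x" for x by (simp add: v0_def)
  have vpow: "0 < v0 x powr e" for x e using v0p[of x] by simp
  let ?N = "\<lambda>e. emeasure (density lborel (\<lambda>x. ennreal (v0 x powr e))) {0..1}"
  have av: "average {0..1} (\<lambda>s. v s powr e) = ?N e" for e
    using average_slice_cong[OF vv, of "{0..1}" e] by (simp add: average_eq_density divide_ennreal_def)
  have pos: "0 < ?N e" for e using vpow by (intro emeasure_density_pos) auto
  have "1 \<le> ?N q * ennreal_powr (?N (- p')) (q / p')"
  proof (cases "?N q = top \<or> ?N (- p') = top")
    case True
    then show ?thesis using pos[of q] pos[of "- p'"] by (auto simp: ennreal_mult_top ennreal_top_mult)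
  next
    case False
    define U S where "U = enn2real (?N q)" and "S = enn2real (?N (- p'))"
    have US: "?N q = ennreal U" "?N (- p') = ennreal S" "0 \<le> U" "0 \<le> S"
      using False by (simp_all add: U_def S_def less_top)
    have US0: "0 < U" "0 < S" using pos[of q] pos[of "- p'"] US by auto
    have "1 powr (1 - \<alpha>) \<le> U powr (1 / q) * S powr (1 / p')"
      using v0p US US0 by (intro weight_Holder[of v0 "{0..1}"]) auto
    then have "1 powr q \<le> (U powr (1 / q) * S powr (1 / p')) powr q"
      using basic by (intro powr_mono2) auto
    then have "1 \<le> U * S powr (q / p')"
      using US0 basic by (simp add: powr_mult powr_powr)
    then have "ennreal 1 \<le> ennreal (U * S powr (q / p'))" by (rule ennreal_leI)
    then show ?thesis using US by (simp add: ennreal_powr_ennreal ennreal_mult)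
  qed
  then show ?thesis by (simp add: av)
qed

lemma A_slice_sup_upper:
  assumes "a < b"
  shows "average {a..b} (\<lambda>s. v s powr q) * ennreal_powr (average {a..b} (\<lambda>s. v s powr - (p / (p - 1)))) (q / (p / (p - 1)))
    \<le> A_slice_sup p q v"
  unfolding A_slice_sup_def by (rule SUP_upper) (use assms in auto)

lemma AE_A_char_var:
  fixes w :: "real^'n::finite \<Rightarrow> real"
  shows "AE z in lborel_fun. A_slice_sup p q (\<lambda>s. w (\<chi> j. if j = i then s else z j)) \<le> A_char_var p q i w"
proof -
  have "AE y in completion (Pi\<^sub>M (- {i}) (\<lambda>_. lborel)). A_slice_sup p q (\<lambda>s. w (\<chi> j. if j = i then s else y j)) \<le> A_char_var p q i w"
    unfolding A_char_var_def by (rule esssup_AE)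
  then have "AE y in Pi\<^sub>M (- {i}) (\<lambda>_. lborel). A_slice_sup p q (\<lambda>s. w (\<chi> j. if j = i then s else y j)) \<le> A_char_var p q i w"
    unfolding AE_completion_iff .
  from AE_lborel_fun_restrict[OF this] have "AE x in lborel_fun. A_slice_sup p q (\<lambda>s. w (\<chi> j. if j = i then s else restrict x (- {i}) j)) \<le> A_char_var p q i w" .
  moreover have "(\<chi> j. if j = i then s else restrict x (- {i}) j) = (\<chi> j. if j = i then s else x j)" for s and x :: "'n \<Rightarrow> real"
    by (simp add: vec_eq_iff)
  ultimately show ?thesis by simp
qed

text \<open>Almost every slice is positive, agrees with a Borel function almost everywhere and has
  its characteristic bounded by the essential supremum. The conclusion does not mention the slice,
  so one such slice decides it.\<close>

lemma (in exponents) A_char_var_ge_1: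
  fixes w :: "real^'n::finite \<Rightarrow> real"
  assumes w: "weight w"
  shows "1 \<le> A_char_var p q i w"
proof -
  obtain w0 where w0 [measurable]: "w0 \<in> borel_measurable borel"
    and ww: "AE z in lborel_fun. w (vec_of z) = w0 (vec_of z)"
      "\<And>i. AE z in lborel_fun. AE s in lborel. w (\<chi> j. if j = i then s else z j) = w0 (vec_of (z(i := s)))"
    using borel_version[OF weight_measurable[OF w]] by blast
  have "AE x in lebesgue. 0 < w x" using w by (simp add: weight_def)
  from AE_vec[OF this] ww(1) have "AE z in lborel_fun. 0 < w0 (vec_of z)" by eventually_elim simp
  from AE_slice[OF this, of i] ww(2)[of i] AE_A_char_var[of p q w i]
  have "AE z in (lborel_fun :: ('n \<Rightarrow> real) measure). 1 \<le> A_char_var p q i w"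
  proof eventually_elim
    case (elim z)
    let ?v = "\<lambda>s. w (\<chi> j. if j = i then s else z j)"
    have "(\<lambda>s. w0 (vec_of (z(i := s)))) \<in> borel_measurable lborel"
      by (rule measurable_compose[OF measurable_slice_upd']) measurable
    then have "1 \<le> average {0..1} (\<lambda>s. w0 (vec_of (z(i := s))) powr q) * ennreal_powr (average {0..1} (\<lambda>s. w0 (vec_of (z(i := s))) powr - p')) (q / p')"
      using elim(1) by (intro slice_average_ge_1) (simp_all del: fun_upd_apply)
    also have "\<dots> = average {0..1} (\<lambda>s. ?v s powr q) * ennreal_powr (average {0..1} (\<lambda>s. ?v s powr - (p / (p - 1)))) (q / (p / (p - 1)))"
      using average_slice_cong[OF elim(2)] by (simp add: p'_eq)
    also have "\<dots> \<le> A_slice_sup p q ?v" by (rule A_slice_sup_upper) simp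
    finally show ?case using elim(3) by simp
  qed
  then show ?thesis by (rule AE_lborel_fun_const)
qed

lemma (in exponents) A_char_prod_ge_1:
  fixes w :: "real^'n::finite \<Rightarrow> real"
  assumes "weight w"
  shows "1 \<le> A_char_prod p q w"
proof -
  have "(\<Prod>i\<in>(UNIV :: 'n set). (1::ennreal)) \<le> (\<Prod>i\<in>UNIV. A_char_var p q i w)"
    using A_char_var_ge_1[OF assms] by (intro prod_mono_ennreal) auto
  then show ?thesis by (simp add: A_char_prod_def)
qed

text \<open>Integrability comes from the uniform slice bound \<open>X\<close>, so finiteness of the
  characteristics is not presupposed. If one of them is infinite, the right side is infinite unless
  \<open>w * f\<close> has norm 0, and then the bound with \<open>X\<close> makes the left side 0.
  Otherwise the transfer is repeated with the characteristics themselves as constants, which gives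
  the sharp power.\<close>

theorem (in exponents) upper_bound:
  fixes w f :: "real^'n::finite \<Rightarrow> real"
  assumes w: "w \<in> A_strong p q" and f: "f \<in> weighted_Lp p w"
  shows "AE x in lebesgue. integrable lebesgue (riesz_integrand \<alpha> f x)"
    and "Lp_norm q (\<lambda>x. w x * riesz_potential \<alpha> f x)
      \<le> ennreal (one_dim_const ^ CARD('n)) * ennreal_powr (A_char_prod p q w) (max 1 (p' / q) * (1 - \<alpha>)) * Lp_norm p (\<lambda>x. w x * f x)"
proof -
  let ?\<beta> = "max 1 (p' / q) * (1 - \<alpha>)"
  have wt: "weight w" using w by (simp add: A_strong_def)
  have wm: "w \<in> borel_measurable lebesgue" by (rule weight_measurable[OF wt])
  have wp: "AE x in lebesgue. 0 < w x" using wt by (simp add: weight_def)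
  have fm: "f \<in> borel_measurable lebesgue" and fLp: "Lp_norm p (\<lambda>x. w x * f x) < \<infinity>"
    using f by (auto simp: weighted_Lp_def)
  obtain X where X: "1 \<le> X" "\<And>i. AE z in lborel_fun. slice_condition p q X (\<lambda>s. w (\<chi> j. if j = i then s else z j))"
    using strong_slice_condition[OF w] by blast
  note tb = transfer_bound[OF wm wp fm X]
  show "AE x in lebesgue. integrable lebesgue (riesz_integrand \<alpha> f x)" by (rule tb(2)[OF fLp])
  have ge1: "1 \<le> A_char_var p q i w" for i by (rule A_char_var_ge_1[OF wt])
  show "Lp_norm q (\<lambda>x. w x * riesz_potential \<alpha> f x)
      \<le> ennreal (one_dim_const ^ CARD('n)) * ennreal_powr (A_char_prod p q w) ?\<beta> * Lp_norm p (\<lambda>x. w x * f x)"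
  proof (cases "\<exists>i. A_char_var p q i w = top")
    case True
    then obtain i where i: "A_char_var p q i w = top" by auto
    have "A_char_prod p q w = A_char_var p q i w * (\<Prod>j\<in>UNIV - {i}. A_char_var p q j w)"
      unfolding A_char_prod_def by (rule prod.remove) auto
    moreover have "(\<Prod>j\<in>UNIV - {i}. A_char_var p q j w) \<noteq> 0"
    proof -
      have "(\<Prod>j\<in>UNIV - {i}. (1::ennreal)) \<le> (\<Prod>j\<in>UNIV - {i}. A_char_var p q j w)"
        using ge1 by (intro prod_mono_ennreal) auto
      then have *: "1 \<le> (\<Prod>j\<in>UNIV - {i}. A_char_var p q j w)" by simp
      show ?thesis
      proof
        assume z: "(\<Prod>j\<in>UNIV - {i}. A_char_var p q j w) = 0"
        show False using * unfolding z by simp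
      qed
    qed
    ultimately have top: "A_char_prod p q w = top" using i by (simp add: ennreal_top_mult)
    show ?thesis
    proof (cases "Lp_norm p (\<lambda>x. w x * f x) = 0")
      case True
      then show ?thesis using tb(1) by simp
    next
      case False
      then show ?thesis using one_dim_const_pos by (simp add: top ennreal_mult_top ennreal_top_mult)
    qed
  next
    case False
    define Y where "Y i = enn2real (A_char_var p q i w)" for i
    have Y: "A_char_var p q i w = ennreal (Y i)" "1 \<le> Y i" for i
    proof -
      show *: "A_char_var p q i w = ennreal (Y i)" using False by (simp add: Y_def less_top)
      then show "1 \<le> Y i" using ge1[of i] by (simp add: ennreal_le_iff2)
    qed
    have "Lp_norm q (\<lambda>x. w x * riesz_potential \<alpha> f x)
        \<le> (\<Prod>i\<in>UNIV. ennreal (one_dim_const * Y i powr ?\<beta>)) * Lp_norm p (\<lambda>x. w x * f x)"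
    proof (rule transfer_bound(1)[OF wm wp fm Y(2)])
      fix i
      show "AE z in lborel_fun. slice_condition p q (Y i) (\<lambda>s. w (\<chi> j. if j = i then s else z j))"
        using AE_A_char_var[of p q w i]
      proof eventually_elim
        case (elim z)
        show ?case unfolding slice_condition_def Y(1)[symmetric]
          by (intro ballI impI order_trans[OF A_slice_sup_upper elim])
      qed
    qed
    also have "(\<Prod>i\<in>(UNIV :: 'n set). ennreal (one_dim_const * Y i powr ?\<beta>)) = ennreal (one_dim_const ^ CARD('n)) * ennreal_powr (A_char_prod p q w) ?\<beta>"
    proof -
      have Y0: "0 \<le> Y i" for i using Y(2)[of i] by simp
      have "(\<Prod>i\<in>(UNIV :: 'n set). ennreal (one_dim_const * Y i powr ?\<beta>)) = ennreal (\<Prod>i\<in>(UNIV :: 'n set). one_dim_const * Y i powr ?\<beta>)"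
        using one_dim_const_pos Y0 by (intro prod_ennreal) auto
      also have "(\<Prod>i\<in>(UNIV :: 'n set). one_dim_const * Y i powr ?\<beta>) = one_dim_const ^ CARD('n) * (\<Prod>i\<in>UNIV. Y i) powr ?\<beta>"
        by (simp add: prod.distrib prod_powr_distrib)
      also have "ennreal \<dots> = ennreal (one_dim_const ^ CARD('n)) * ennreal ((\<Prod>i\<in>UNIV. Y i) powr ?\<beta>)"
        using one_dim_const_pos by (intro ennreal_mult) auto
      also have "ennreal ((\<Prod>i\<in>UNIV. Y i) powr ?\<beta>) = ennreal_powr (A_char_prod p q w) ?\<beta>"
        using Y0 by (simp add: A_char_prod_def Y(1) prod_ennreal prod_nonneg ennreal_powr_ennreal)
      finally show ?thesis .
    qed
    finally show ?thesis .
  qed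
qed

section \<open>Averages of power functions\<close>

lemma nn_integral_powr_from_0:
  fixes c e :: real
  assumes "0 < e" "0 \<le> c"
  shows "(\<integral>\<^sup>+x. ennreal (x powr (e - 1)) * indicator {0..c} x \<partial>lborel) = ennreal (c powr e / e)"
proof -
  have "((\<lambda>x. x powr (e - 1)) has_integral (c powr e / e)) {0..c}"
    using has_integral_powr_from_0[of "e - 1" c] assms by simp
  then have "((\<lambda>x. if x \<in> {0..c} then x powr (e - 1) else 0) has_integral (c powr e / e)) UNIV"
    by (simp only: has_integral_restrict_UNIV)
  moreover have "(\<lambda>x. if x \<in> {0..c} then x powr (e - 1) else 0) = (\<lambda>x. x powr (e - 1) * indicator {0..c} x)"
    by (auto simp: fun_eq_iff indicator_def)
  ultimately have "((\<lambda>x. x powr (e - 1) * indicator {0..c} x) has_integral (c powr e / e)) UNIV" by simp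
  from nn_integral_has_integral_lborel[OF _ _ this]
  have "(\<integral>\<^sup>+x. ennreal (x powr (e - 1) * indicator {0..c} x) \<partial>lborel) = ennreal (c powr e / e)" by simp
  moreover have "ennreal (x powr (e - 1) * indicator {0..c} x) = ennreal (x powr (e - 1)) * indicator {0..c} x" for x :: real
    by (auto simp: indicator_def)
  ultimately show ?thesis by simp
qed

lemma average_le_const:
  fixes a b c :: real
  assumes "a < b" "\<And>s. s \<in> {a..b} \<Longrightarrow> g s \<le> c"
  shows "average {a..b} g \<le> ennreal c"
proof -
  have "(\<integral>\<^sup>+x\<in>{a..b}. ennreal (g x) \<partial>lebesgue) \<le> (\<integral>\<^sup>+x. ennreal c * indicator {a..b} x \<partial>lebesgue)"
    using assms(2) by (intro nn_integral_mono) (auto simp: indicator_def ennreal_leI)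
  also have "\<dots> = ennreal c * ennreal (b - a)" using assms(1) by (simp add: nn_integral_cmult_indicator)
  finally have "average {a..b} g \<le> ennreal c * ennreal (b - a) / ennreal (b - a)"
    unfolding average_def using assms(1) by (simp add: divide_right_mono_ennreal)
  then show ?thesis using assms(1) by (simp add: mult_divide_eq_ennreal)
qed

text \<open>If the interval is at least half as long as \<open>m\<close>, it may be enlarged to
  \<open>{- m..m}\<close>; otherwise it stays at distance \<open>m / 2\<close> from 0, where the
  function is comparable to \<open>m powr (\<delta> - 1)\<close>. Expressing the bound by the larger
  endpoint makes all powers of it cancel in the Muckenhoupt product.\<close>

lemma average_abs_powr_neg:
  fixes a b \<delta> :: real
  assumes ab: "a < b" and \<delta>: "0 < \<delta>" "\<delta> < 1"
  shows "average {a..b} (\<lambda>s. \<bar>s\<bar> powr (\<delta> - 1)) \<le> ennreal (4 / \<delta> * max \<bar>a\<bar> \<bar>b\<bar> powr (\<delta> - 1))"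
proof -
  define m where "m = max \<bar>a\<bar> \<bar>b\<bar>"
  have m: "0 < m" "{a..b} \<subseteq> {- m..m}" using ab by (auto simp: m_def)
  have "average {a..b} (\<lambda>s. \<bar>s\<bar> powr (\<delta> - 1)) \<le> ennreal (4 / \<delta> * m powr (\<delta> - 1))"
  proof (cases "m / 2 \<le> b - a")
    case True
    let ?h = "\<lambda>x. ennreal (x powr (\<delta> - 1)) * indicator {0..m} x"
    have "(\<integral>\<^sup>+x\<in>{a..b}. ennreal (\<bar>x\<bar> powr (\<delta> - 1)) \<partial>lebesgue) \<le> (\<integral>\<^sup>+x. ?h x + ?h (0 + (- 1) * x) \<partial>lborel)"
      unfolding nn_integral_completion using m
      by (intro nn_integral_mono) (auto simp: indicator_def abs_if)
    also have "\<dots> = (\<integral>\<^sup>+x. ?h x \<partial>lborel) + (\<integral>\<^sup>+x. ?h (0 + (- 1) * x) \<partial>lborel)"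
      by (intro nn_integral_add) measurable
    also have "(\<integral>\<^sup>+x. ?h (0 + (- 1) * x) \<partial>lborel) = (\<integral>\<^sup>+x. ?h x \<partial>lborel)"
      using nn_integral_real_affine[of ?h "- 1" 0] by simp
    also have "(\<integral>\<^sup>+x. ?h x \<partial>lborel) = ennreal (m powr \<delta> / \<delta>)"
      using \<delta> m by (intro nn_integral_powr_from_0) auto
    finally have "(\<integral>\<^sup>+x\<in>{a..b}. ennreal (\<bar>x\<bar> powr (\<delta> - 1)) \<partial>lebesgue) \<le> ennreal (2 * m powr \<delta> / \<delta>)"
      using \<delta> by (simp flip: ennreal_plus)
    then have "average {a..b} (\<lambda>s. \<bar>s\<bar> powr (\<delta> - 1)) \<le> ennreal (2 * m powr \<delta> / \<delta>) / ennreal (b - a)"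
      unfolding average_def using ab by (simp add: divide_right_mono_ennreal)
    also have "\<dots> = ennreal (2 * m powr \<delta> / \<delta> / (b - a))" using ab \<delta> by (intro divide_ennreal) auto
    also have "\<dots> \<le> ennreal (2 * m powr \<delta> / \<delta> / (m / 2))"
      using True m \<delta> ab by (intro ennreal_leI divide_left_mono) auto
    also have "2 * m powr \<delta> / \<delta> / (m / 2) = 4 / \<delta> * m powr (\<delta> - 1)"
      using m by (simp add: powr_diff)
    finally show ?thesis .
  next
    case False
    show ?thesis
    proof (rule average_le_const[OF ab])
      fix s assume "s \<in> {a..b}"
      then have "m / 2 \<le> \<bar>s\<bar>" using False ab by (auto simp: m_def max_def abs_if split: if_splits)
      then have "\<bar>s\<bar> powr (\<delta> - 1) \<le> (m / 2) powr (\<delta> - 1)" using \<delta> m by (intro powr_mono2') auto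
      also have "\<dots> = 2 powr (1 - \<delta>) * m powr (\<delta> - 1)"
        using powr_minus_divide[of 2 "\<delta> - 1"] by (simp add: powr_divide)
      also have "\<dots> \<le> 4 / \<delta> * m powr (\<delta> - 1)"
      proof (rule mult_right_mono)
        have "2 powr (1 - \<delta>) \<le> 2 powr (1::real)" using \<delta> by (intro powr_mono) auto
        also have "\<dots> \<le> 4 / \<delta>" using \<delta> by (simp add: field_simps)
        finally show "2 powr (1 - \<delta>) \<le> 4 / \<delta>" .
      qed simp
      finally show "\<bar>s\<bar> powr (\<delta> - 1) \<le> 4 / \<delta> * m powr (\<delta> - 1)" .
    qed
  qed
  then show ?thesis by (simp add: m_def)
qed

lemma average_abs_powr_pos:
  fixes a b e :: real
  assumes ab: "a < b" and e: "0 \<le> e"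
  shows "average {a..b} (\<lambda>s. \<bar>s\<bar> powr e) \<le> ennreal (max \<bar>a\<bar> \<bar>b\<bar> powr e)"
  by (rule average_le_const[OF ab]) (use e in \<open>auto intro!: powr_mono2\<close>)

section \<open>Sharpness\<close>

lemma ennreal_powr_prod: "ennreal_powr (\<Prod>i\<in>I. g i) e = (\<Prod>i\<in>I. ennreal_powr (g i) e)"
  by (induction I rule: infinite_finite_induct) (simp_all add: ennreal_powr_mult)

lemma ennreal_prod_less_top:
  fixes g :: "'i \<Rightarrow> ennreal"
  assumes "\<And>i. i \<in> I \<Longrightarrow> g i < top"
  shows "(\<Prod>i\<in>I. g i) < top"
  using assms by (induction I rule: infinite_finite_induct) (auto simp: ennreal_mult_less_top)

definition prod_fun :: "(real \<Rightarrow> real) \<Rightarrow> real^'n::finite \<Rightarrow> real" where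
  "prod_fun g x = (\<Prod>i\<in>UNIV. g (x $ i))"

lemma borel_measurable_prod_fun [measurable]:
  assumes [measurable]: "g \<in> borel_measurable borel"
  shows "prod_fun g \<in> borel_measurable (borel :: (real^'n::finite) measure)"
  unfolding prod_fun_def[abs_def] by measurable

lemma prod_fun_nonneg: "(\<And>s. 0 \<le> g s) \<Longrightarrow> 0 \<le> prod_fun g x"
  by (auto simp: prod_fun_def intro: prod_nonneg)

lemma prod_fun_powr: "prod_fun g x powr e = prod_fun (\<lambda>s. g s powr e) x"
  by (simp add: prod_fun_def prod_powr_distrib)

lemma prod_fun_mult: "prod_fun g x * prod_fun h x = prod_fun (\<lambda>s. g s * h s) x"
  by (simp add: prod_fun_def prod.distrib)

lemma nn_integral_prod_components:
  fixes h :: "'n::finite \<Rightarrow> real \<Rightarrow> ennreal"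
  assumes [measurable]: "\<And>i. h i \<in> borel_measurable borel"
  shows "(\<integral>\<^sup>+x. (\<Prod>i\<in>UNIV. h i (x $ i)) \<partial>(lebesgue :: (real^'n) measure)) = (\<Prod>i\<in>UNIV. \<integral>\<^sup>+s. h i s \<partial>lborel)"
proof -
  interpret product_sigma_finite "\<lambda>_::'n. lborel :: real measure" by (rule product_sigma_finite_lborel)
  have "(\<integral>\<^sup>+x. (\<Prod>i\<in>UNIV. h i (x $ i)) \<partial>(lebesgue :: (real^'n) measure)) = (\<integral>\<^sup>+z. (\<Prod>i\<in>UNIV. h i (z i)) \<partial>lborel_fun)"
  proof -
    have m: "(\<lambda>x::real^'n. \<Prod>i\<in>UNIV. h i (x $ i)) \<in> borel_measurable borel" by measurable
    show ?thesis by (subst nn_integral_vec[OF m]) simp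
  qed
  also have "\<dots> = (\<Prod>i\<in>UNIV. \<integral>\<^sup>+s. h i s \<partial>lborel)"
    by (rule product_nn_integral_prod) auto
  finally show ?thesis .
qed

lemma nn_integral_prod_fun:
  assumes [measurable]: "g \<in> borel_measurable borel" and g: "\<And>s. 0 \<le> g s"
  shows "(\<integral>\<^sup>+x. ennreal (prod_fun g x) \<partial>(lebesgue :: (real^'n::finite) measure)) = (\<integral>\<^sup>+s. ennreal (g s) \<partial>lborel) ^ CARD('n)"
proof -
  have "ennreal (prod_fun g x) = (\<Prod>i\<in>UNIV. ennreal (g (x $ i)))" for x :: "real^'n"
    using g by (simp add: prod_fun_def prod_ennreal)
  then show ?thesis using nn_integral_prod_components[of "\<lambda>_::'n. \<lambda>s. ennreal (g s)"] by simp
qed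

lemma nn_integral_box_prod_fun:
  fixes a b :: "real^'n::finite"
  assumes [measurable]: "g \<in> borel_measurable borel" and g: "\<And>s. 0 \<le> g s"
  shows "(\<integral>\<^sup>+x\<in>cbox a b. ennreal (prod_fun g x) \<partial>lebesgue) = (\<Prod>i\<in>UNIV. \<integral>\<^sup>+s\<in>{a $ i..b $ i}. ennreal (g s) \<partial>lborel)"
proof -
  have "ennreal (prod_fun g x) * indicator (cbox a b) x = (\<Prod>i\<in>UNIV. ennreal (g (x $ i)) * indicator {a $ i..b $ i} (x $ i))" for x
  proof (cases "x \<in> cbox a b")
    case True
    then show ?thesis using g by (simp add: prod_fun_def prod_ennreal mem_box_cart indicator_def)
  next
    case False
    then obtain j where j: "x $ j \<notin> {a $ j..b $ j}" by (auto simp: mem_box_cart)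
    have "\<exists>i\<in>UNIV. ennreal (g (x $ i)) * indicator {a $ i..b $ i} (x $ i) = 0"
      by (rule bexI[of _ j]) (use j in \<open>simp_all add: indicator_def\<close>)
    then have "(\<Prod>i\<in>UNIV. ennreal (g (x $ i)) * indicator {a $ i..b $ i} (x $ i)) = 0" by (intro prod_zero) auto
    then show ?thesis using False by simp
  qed
  then show ?thesis
    using nn_integral_prod_components[of "\<lambda>i s. ennreal (g s) * indicator {a $ i..b $ i} s"] by simp
qed

lemma average_box_prod_fun:
  fixes a b :: "real^'n::finite"
  assumes "g \<in> borel_measurable borel" "\<And>s. 0 \<le> g s" and ab: "\<And>i. a $ i < b $ i"
    and fin: "\<And>i. average {a $ i..b $ i} g < top"
  shows "average (cbox a b) (prod_fun g) = (\<Prod>i\<in>UNIV. average {a $ i..b $ i} g)"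
proof -
  define I where "I i = (\<integral>\<^sup>+s\<in>{a $ i..b $ i}. ennreal (g s) \<partial>lborel)" for i
  have av: "average {a $ i..b $ i} g = I i / ennreal (b $ i - a $ i)" for i
    using ab[of i] by (simp add: average_def I_def nn_integral_completion)
  have Ifin: "I i < top" for i
    using fin[of i] ab[of i] unfolding av by (cases "I i = top") (auto simp: ennreal_top_divide less_top)
  define J where "J i = enn2real (I i)" for i
  have J: "I i = ennreal (J i)" "0 \<le> J i" for i using Ifin by (simp_all add: J_def)
  have "\<forall>c\<in>Basis. a \<bullet> c \<le> b \<bullet> c" using ab by (auto simp: Basis_vec_def inner_axis less_imp_le)
  then have vol: "emeasure lebesgue (cbox a b) = ennreal (\<Prod>i\<in>UNIV. b $ i - a $ i)"
    by (simp add: emeasure_lborel_cbox_eq prod_Basis_vec inner_axis)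
  have "average (cbox a b) (prod_fun g) = (\<Prod>i\<in>UNIV. ennreal (J i)) / ennreal (\<Prod>i\<in>UNIV. b $ i - a $ i)"
    unfolding average_def vol nn_integral_box_prod_fun[OF assms(1,2)] I_def[symmetric] J(1) ..
  also have "\<dots> = ennreal ((\<Prod>i\<in>UNIV. J i) / (\<Prod>i\<in>UNIV. b $ i - a $ i))"
    using J(2) ab by (simp add: prod_ennreal divide_ennreal prod_nonneg prod_pos)
  also have "(\<Prod>i\<in>UNIV. J i) / (\<Prod>i\<in>UNIV. b $ i - a $ i) = (\<Prod>i\<in>UNIV. J i / (b $ i - a $ i))"
    by (simp add: prod_dividef)
  also have "ennreal \<dots> = (\<Prod>i\<in>UNIV. ennreal (J i / (b $ i - a $ i)))"
    using J(2) ab by (intro prod_ennreal[symmetric]) (simp add: less_imp_le)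
  also have "\<dots> = (\<Prod>i\<in>UNIV. average {a $ i..b $ i} g)"
    using J(2) ab by (intro prod.cong) (simp_all add: av J(1) divide_ennreal)
  finally show ?thesis .
qed

lemma average_cmult:
  fixes S :: "real set"
  assumes [measurable]: "g \<in> borel_measurable borel" "S \<in> sets borel" and "0 \<le> c" "\<And>s. 0 \<le> g s"
  shows "average S (\<lambda>s. c * g s) = ennreal c * average S g"
proof -
  have "(\<integral>\<^sup>+x\<in>S. ennreal (c * g x) \<partial>lborel) = (\<integral>\<^sup>+x. ennreal c * (ennreal (g x) * indicator S x) \<partial>lborel)"
    using assms by (intro nn_integral_cong) (simp add: ennreal_mult mult.assoc)
  also have "\<dots> = ennreal c * (\<integral>\<^sup>+x\<in>S. ennreal (g x) \<partial>lborel)" by (intro nn_integral_cmult) measurable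
  finally show ?thesis unfolding average_def nn_integral_completion by (simp add: ennreal_times_divide)
qed

text \<open>The averages are required to be finite separately because box averages of product
  weights are split into real factors and recombined.\<close>

definition power_weight_bound :: "real \<Rightarrow> real \<Rightarrow> real \<Rightarrow> real \<Rightarrow> bool" where
  "power_weight_bound p q \<gamma> C \<longleftrightarrow> (\<forall>a b. a < b \<longrightarrow>
     average {a..b} (\<lambda>s. (\<bar>s\<bar> powr \<gamma>) powr q) < top \<and> average {a..b} (\<lambda>s. (\<bar>s\<bar> powr \<gamma>) powr - (p / (p - 1))) < top \<and>
     average {a..b} (\<lambda>s. (\<bar>s\<bar> powr \<gamma>) powr q) *
       ennreal_powr (average {a..b} (\<lambda>s. (\<bar>s\<bar> powr \<gamma>) powr - (p / (p - 1)))) (q / (p / (p - 1))) \<le> ennreal C)"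

lemma AE_components_nonzero: "AE x in (lebesgue :: (real^'n::finite) measure). \<forall>i. x $ i \<noteq> 0"
proof -
  have "AE x in (lebesgue :: (real^'n::finite) measure). x $ i \<noteq> 0" for i
  proof -
    have "negligible {x :: real^'n. x \<bullet> axis i 1 = 0}" by (rule negligible_standard_hyperplane) (auto simp: Basis_vec_def)
    then have "{x :: real^'n. x \<bullet> axis i 1 = 0} \<in> null_sets lebesgue" by (simp add: negligible_iff_null_sets)
    from AE_not_in[OF this] show ?thesis by (simp add: inner_axis)
  qed
  then show ?thesis by (simp add: AE_all_countable)
qed

context exponents
begin

context
  fixes \<gamma> C :: real and w :: "real^'n::finite \<Rightarrow> real"
  assumes bound: "power_weight_bound p q \<gamma> C" and C: "0 \<le> C"
  defines "w \<equiv> prod_fun (\<lambda>s. \<bar>s\<bar> powr \<gamma>)"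
begin

text \<open>Local integrability is inherited from that of the \<open>q\<close>-th power, since
  \<open>x \<le> 1 + x powr q\<close> for nonnegative \<open>x\<close>.\<close>

lemma weight_power_weight: "weight w"
  unfolding weight_def
proof (intro conjI allI impI)
  note basic = p_gt_1 q_gt_1 p'_gt_1
  let ?v = "\<lambda>s::real. \<bar>s\<bar> powr \<gamma>"
  have [measurable]: "w \<in> borel_measurable borel" unfolding w_def by measurable
  have w0: "0 \<le> w x" for x unfolding w_def by (intro prod_fun_nonneg) simp
  show "AE x in lebesgue. 0 < w x"
    using AE_components_nonzero by eventually_elim (auto simp: w_def prod_fun_def intro!: prod_pos)
  fix K :: "(real^'n) set" assume K: "compact K"
  obtain B :: "real^'n" where B: "K \<subseteq> cbox (- B) B"
    using bounded_subset_cbox_symmetric[OF compact_imp_bounded[OF K]] by blast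
  define a b where "a = (\<chi> i. - (\<bar>B $ i\<bar> + 1))" and "b = (\<chi> i. \<bar>B $ i\<bar> + 1)"
  have Kab: "K \<subseteq> cbox a b"
  proof
    fix x assume "x \<in> K"
    then have x: "- B $ i \<le> x $ i \<and> x $ i \<le> B $ i" for i using B by (auto simp: mem_box_cart)
    have "a $ i \<le> x $ i \<and> x $ i \<le> b $ i" for i using x[of i] by (simp add: a_def b_def)
    then show "x \<in> cbox a b" by (simp add: mem_box_cart)
  qed
  have ab: "a $ i < b $ i" for i by (simp add: a_def b_def)
  have slice: "(\<integral>\<^sup>+s\<in>{a $ i..b $ i}. ennreal (?v s) \<partial>lborel) < top" for i
  proof -
    have "average {a $ i..b $ i} (\<lambda>s. ?v s powr q) < top" using bound ab[of i] by (simp add: power_weight_bound_def)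
    then have fin: "(\<integral>\<^sup>+s\<in>{a $ i..b $ i}. ennreal (?v s powr q) \<partial>lborel) < top"
      using ab[of i] unfolding average_def nn_integral_completion
      by (cases "(\<integral>\<^sup>+s\<in>{a $ i..b $ i}. ennreal (?v s powr q) \<partial>lborel) = top") (auto simp: ennreal_top_divide less_top)
    have "(\<integral>\<^sup>+s\<in>{a $ i..b $ i}. ennreal (?v s) \<partial>lborel)
        \<le> (\<integral>\<^sup>+s. indicator {a $ i..b $ i} s + ennreal (?v s powr q) * indicator {a $ i..b $ i} s \<partial>lborel)"
    proof (rule nn_integral_mono)
      fix s
      have "?v s \<le> 1 + ?v s powr q"
      proof (cases "?v s \<le> 1")
        case True
        then show ?thesis by (rule add_increasing2[rotated]) simp
      next
        case False
        then have "?v s powr 1 \<le> ?v s powr q" using basic by (intro powr_mono) auto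
        then show ?thesis by simp
      qed
      then have "ennreal (?v s) \<le> ennreal (1 + ?v s powr q)" by (rule ennreal_leI)
      then show "ennreal (?v s) * indicator {a $ i..b $ i} s \<le> indicator {a $ i..b $ i} s + ennreal (?v s powr q) * indicator {a $ i..b $ i} s"
        by (auto simp: indicator_def)
    qed
    also have "\<dots> = emeasure lborel {a $ i..b $ i} + (\<integral>\<^sup>+s\<in>{a $ i..b $ i}. ennreal (?v s powr q) \<partial>lborel)"
      by (subst nn_integral_add) auto
    also have "\<dots> < top" using fin ab[of i] by simp
    finally show ?thesis .
  qed
  have "(\<integral>\<^sup>+x. ennreal (norm (indicator K x *\<^sub>R w x)) \<partial>lebesgue) \<le> (\<integral>\<^sup>+x\<in>cbox a b. ennreal (w x) \<partial>lebesgue)"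
    using Kab w0 by (intro nn_integral_mono) (auto simp: indicator_def)
  also have "\<dots> = (\<Prod>i\<in>UNIV. \<integral>\<^sup>+s\<in>{a $ i..b $ i}. ennreal (?v s) \<partial>lborel)"
    unfolding w_def by (rule nn_integral_box_prod_fun) auto
  also have "\<dots> < \<infinity>" using slice by (simp add: ennreal_prod_less_top)
  finally have fin: "(\<integral>\<^sup>+x. ennreal (norm (indicator K x *\<^sub>R w x)) \<partial>lebesgue) < \<infinity>" .
  have "w \<in> borel_measurable lebesgue" "K \<in> sets lebesgue"
    using K by (auto intro!: measurable_completion borel_compact)
  then show "w absolutely_integrable_on K"
    unfolding set_integrable_def using fin by (intro integrableI_bounded) auto
qed

lemma A_strong_power_weight: "w \<in> A_strong p q"
proof -
  note basic = p_gt_1 q_gt_1 p'_gt_1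
  let ?v = "\<lambda>s::real. \<bar>s\<bar> powr \<gamma>"
  have "(SUP P \<in> {cbox a b | a b :: real^'n. \<forall>i. a $ i < b $ i}.
        ennreal_powr (average P (\<lambda>x. w x powr q)) (1 / q) * ennreal_powr (average P (\<lambda>x. w x powr - p')) (1 / p'))
      \<le> ennreal (C powr (1 / q)) ^ CARD('n)"
  proof (rule SUP_least, clarify)
    fix a b :: "real^'n" assume ab: "\<forall>i. a $ i < b $ i"
    define A where "A e i = average {a $ i..b $ i} (\<lambda>s. ?v s powr e)" for e i
    have fin: "A q i < top" "A (- p') i < top" and le: "A q i * ennreal_powr (A (- p') i) (q / p') \<le> ennreal C" for i
      using bound ab by (auto simp: power_weight_bound_def A_def p'_eq)
    have av: "average (cbox a b) (\<lambda>x. w x powr e) = (\<Prod>i\<in>UNIV. A e i)" if "\<And>i. A e i < top" for e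
    proof -
      have "(\<lambda>x. w x powr e) = prod_fun (\<lambda>s. ?v s powr e)" by (simp add: w_def prod_fun_powr fun_eq_iff)
      then show ?thesis using that ab unfolding A_def by (simp only:) (intro average_box_prod_fun; auto)
    qed
    have "ennreal_powr (average (cbox a b) (\<lambda>x. w x powr q)) (1 / q) * ennreal_powr (average (cbox a b) (\<lambda>x. w x powr - p')) (1 / p')
        = (\<Prod>i\<in>UNIV. ennreal_powr (A q i * ennreal_powr (A (- p') i) (q / p')) (1 / q))"
      using basic by (simp add: av fin ennreal_powr_prod prod.distrib ennreal_powr_mult ennreal_powr_powr)
    also have "\<dots> \<le> (\<Prod>i\<in>(UNIV :: 'n set). ennreal_powr (ennreal C) (1 / q))"
      using le basic by (intro prod_mono_ennreal ennreal_powr_mono) auto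
    finally show "ennreal_powr (average (cbox a b) (\<lambda>x. w x powr q)) (1 / q) * ennreal_powr (average (cbox a b) (\<lambda>x. w x powr - p')) (1 / p')
        \<le> ennreal (C powr (1 / q)) ^ CARD('n)"
      using C by (simp add: ennreal_powr_ennreal)
  qed
  also have "\<dots> < \<infinity>" by (simp add: ennreal_power)
  finally show ?thesis using weight_power_weight by (simp add: A_strong_def p'_eq)
qed

text \<open>A slice of the product weight is a constant multiple of the one-dimensional weight, and
  the Muckenhoupt product is invariant under scaling. The explicit form of the slice characteristic
  also shows its measurability, on which the value of \<open>esssup\<close> depends.\<close>

lemma A_char_var_power_weight: "A_char_var p q i w \<le> ennreal C"
  unfolding A_char_var_def
proof (rule esssup_I)
  note basic = p_gt_1 q_gt_1 p'_gt_1
  let ?v = "\<lambda>s::real. \<bar>s\<bar> powr \<gamma>"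
  let ?S = "\<lambda>y :: 'n \<Rightarrow> real. A_slice_sup p q (\<lambda>s. w (\<chi> j. if j = i then s else y j))"
  have w_slice: "w (\<chi> j. if j = i then s else y j) = (\<Prod>j\<in>- {i}. ?v (y j)) * ?v s" for s y
  proof -
    have "UNIV = insert i (- {i})" by auto
    then have "w (\<chi> j. if j = i then s else y j) = (\<Prod>j\<in>insert i (- {i}). ?v (if j = i then s else y j))"
      by (simp add: w_def prod_fun_def)
    also have "\<dots> = ?v s * (\<Prod>j\<in>- {i}. ?v (if j = i then s else y j))" by simp
    also have "(\<Prod>j\<in>- {i}. ?v (if j = i then s else y j)) = (\<Prod>j\<in>- {i}. ?v (y j))" by (intro prod.cong) auto
    finally show ?thesis by (simp add: mult.commute)
  qed
  have "A_slice_sup p q (\<lambda>s. 0) \<le> 0"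
    unfolding A_slice_sup_def by (rule SUP_least) (simp add: average_def)
  then have zero: "A_slice_sup p q (\<lambda>s. 0) = 0" by simp
  have scale: "A_slice_sup p q (\<lambda>s. k * ?v s) = A_slice_sup p q ?v" if k: "0 < k" for k
    unfolding A_slice_sup_def
  proof (rule SUP_cong[OF refl])
    fix I :: "real set" assume "I \<in> {{a..b} | a b. a < b}"
    then have [measurable]: "I \<in> sets borel" by auto
    have av: "average I (\<lambda>s. (k * ?v s) powr e) = ennreal (k powr e) * average I (\<lambda>s. ?v s powr e)" for e
      by (subst average_cmult[symmetric]) (auto simp: powr_mult)
    have "ennreal (k powr q) * ennreal ((k powr - p') powr (q / p')) = 1"
    proof -
      have "- p' * (q / p') = - q" using basic by simp
      then have "k powr q * (k powr - p') powr (q / p') = 1"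
        using k unfolding powr_powr by (simp add: powr_add[symmetric])
      then show ?thesis by (simp flip: ennreal_mult)
    qed
    then have "ennreal (k powr q) * x * (ennreal ((k powr - p') powr (q / p')) * y) = x * y" for x y :: ennreal
      by (metis mult.assoc mult.commute mult.left_neutral)
    then show "average I (\<lambda>s. (k * ?v s) powr q) * ennreal_powr (average I (\<lambda>s. (k * ?v s) powr - (p / (p - 1)))) (q / (p / (p - 1)))
        = average I (\<lambda>s. ?v s powr q) * ennreal_powr (average I (\<lambda>s. ?v s powr - (p / (p - 1)))) (q / (p / (p - 1)))"
      unfolding p'_eq[symmetric] av by (simp add: ennreal_powr_mult ennreal_powr_ennreal)
  qed
  \<comment> \<open>If another coordinate is 0, the constant factor is 0, since
    \<open>0 powr \<gamma> = 0\<close> for either sign of \<open>\<gamma>\<close>. The slice then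
    vanishes and has characteristic 0, so the bound holds for every \<open>y\<close>.\<close>
  have S_eq: "?S y = (if \<exists>j\<in>- {i}. y j = 0 then 0 else A_slice_sup p q ?v)" for y
  proof (cases "\<exists>j\<in>- {i}. y j = 0")
    case True
    then have P0: "(\<Prod>j\<in>- {i}. ?v (y j)) = 0" by (intro prod_zero) auto
    show ?thesis using True unfolding w_slice P0 by (simp add: zero)
  next
    case False
    then have "0 < (\<Prod>j\<in>- {i}. ?v (y j))" by (intro prod_pos) auto
    then show ?thesis using False by (simp add: w_slice scale)
  qed
  have "?S \<in> borel_measurable (Pi\<^sub>M (- {i}) (\<lambda>_. lborel))" unfolding S_eq by measurable
  then show "?S \<in> borel_measurable (completion (Pi\<^sub>M (- {i}) (\<lambda>_. lborel)))" by (rule measurable_completion)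
  have "A_slice_sup p q ?v \<le> ennreal C"
    unfolding A_slice_sup_def using bound by (intro SUP_least) (auto simp: power_weight_bound_def)
  then show "AE y in completion (Pi\<^sub>M (- {i}) (\<lambda>_. lborel)). ?S y \<le> ennreal C" by (simp add: S_eq)
qed

lemma A_char_prod_power_weight:
  "1 \<le> enn2real (A_char_prod p q w)" "enn2real (A_char_prod p q w) \<le> C ^ CARD('n)"
proof -
  have "A_char_prod p q w \<le> (\<Prod>i\<in>(UNIV :: 'n set). ennreal C)"
    unfolding A_char_prod_def by (intro prod_mono_ennreal A_char_var_power_weight)
  then have le: "A_char_prod p q w \<le> ennreal (C ^ CARD('n))" using C by (simp add: ennreal_power)
  then have "A_char_prod p q w < top" by (rule le_less_trans) simp
  then have e: "A_char_prod p q w = ennreal (enn2real (A_char_prod p q w))" by simp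
  have ge: "1 \<le> A_char_prod p q w" by (rule A_char_prod_ge_1[OF weight_power_weight])
  show "1 \<le> enn2real (A_char_prod p q w)" using ge by (subst (asm) e) (simp add: ennreal_le_iff2)
  show "enn2real (A_char_prod p q w) \<le> C ^ CARD('n)" using le C by (subst (asm) e) simp
qed

text \<open>For product functions the norms and the potential factor, so the assumed inequality
  reduces to integrals over the line, with \<open>L\<close> a minorant of the one-dimensional
  potential. The integrability part of \<open>upper_bound\<close> ensures that the Bochner potential
  is the true integral for almost every \<open>x\<close>.\<close>

lemma sharp_inequality:
  fixes f1 L :: "real \<Rightarrow> real" and \<psi> :: "real \<Rightarrow> real" and N m :: real
  assumes [measurable]: "f1 \<in> borel_measurable borel" "L \<in> borel_measurable borel"
    and f1: "\<And>s. 0 \<le> f1 s" and L: "\<And>s. 0 \<le> L s"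
    and lower: "\<And>s. ennreal (L s) \<le> (\<integral>\<^sup>+t. ennreal (f1 t * \<bar>s - t\<bar> powr (\<alpha> - 1)) \<partial>lborel)"
    and N: "(\<integral>\<^sup>+s. ennreal ((\<bar>s\<bar> powr \<gamma> * f1 s) powr p) \<partial>lborel) = ennreal N" "0 \<le> N"
    and m: "(\<integral>\<^sup>+s. ennreal ((\<bar>s\<bar> powr \<gamma> * L s) powr q) \<partial>lborel) = ennreal m" "0 \<le> m"
    and psi: "\<forall>t\<ge>1. 0 < \<psi> t" "mono_on {1..} \<psi>"
    and ineq: "\<forall>w \<in> (A_strong p q :: (real^'n \<Rightarrow> real) set). \<forall>f \<in> weighted_Lp p w.
               Lp_norm q (\<lambda>x. w x * riesz_potential \<alpha> f x)
                 \<le> ennreal (\<psi> (enn2real (A_char_prod p q w))) * Lp_norm p (\<lambda>x. w x * f x)"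
  shows "m powr (CARD('n) / q) \<le> \<psi> (C ^ CARD('n)) * N powr (CARD('n) / p)"
proof -
  note basic = p_gt_1 q_gt_1 p'_gt_1
  let ?n = "CARD('n)"
  let ?v = "\<lambda>s::real. \<bar>s\<bar> powr \<gamma>"
  define f where "f = (prod_fun f1 :: real^'n \<Rightarrow> real)"
  have [measurable]: "f \<in> borel_measurable borel" unfolding f_def by measurable
  have f0: "0 \<le> f x" for x unfolding f_def using f1 by (rule prod_fun_nonneg)
  have w0: "0 \<le> w x" for x unfolding w_def by (rule prod_fun_nonneg) simp
  have norm_eq: "Lp_norm e (\<lambda>x. w x * prod_fun g x) = ennreal (M powr (?n / e))"
    if e: "1 < e" and [measurable]: "g \<in> borel_measurable borel" and g: "\<And>s. 0 \<le> g s"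
      and M: "(\<integral>\<^sup>+s. ennreal ((?v s * g s) powr e) \<partial>lborel) = ennreal M" "0 \<le> M" for e g M
  proof -
    have "\<bar>w x * prod_fun g x\<bar> powr e = prod_fun (\<lambda>s. (?v s * g s) powr e) x" for x :: "real^'n"
      using w0[of x] prod_fun_nonneg[of g x] g by (simp add: w_def prod_fun_mult prod_fun_powr prod_fun_nonneg)
    then have "(\<integral>\<^sup>+x. ennreal (\<bar>w x * prod_fun g x\<bar> powr e) \<partial>lebesgue) = ennreal M ^ ?n"
      using nn_integral_prod_fun[of "\<lambda>s. (?v s * g s) powr e", where ?'n = 'n] M by simp
    moreover have "(M ^ ?n) powr (1 / e) = M powr (?n / e)"
    proof (cases "M = 0")
      case False
      then have "M ^ ?n = M powr ?n" using M by (simp add: powr_realpow)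
      then show ?thesis by (simp add: powr_powr)
    qed simp
    ultimately show ?thesis using M by (simp add: Lp_norm_def ennreal_power ennreal_powr_ennreal)
  qed
  have normf: "Lp_norm p (\<lambda>x. w x * f x) = ennreal (N powr (?n / p))"
    unfolding f_def using basic f1 N by (intro norm_eq) auto
  have fLp: "f \<in> weighted_Lp p w"
    unfolding weighted_Lp_def by (simp add: normf measurable_completion)
  have "Lp_norm q (\<lambda>x. w x * prod_fun L x) \<le> Lp_norm q (\<lambda>x. w x * riesz_potential \<alpha> f x)"
    unfolding Lp_norm_def
  proof (rule ennreal_powr_mono[OF _ nn_integral_mono_AE])
    show "AE x in lebesgue. ennreal (\<bar>w x * prod_fun L x\<bar> powr q) \<le> ennreal (\<bar>w x * riesz_potential \<alpha> f x\<bar> powr q)"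
      using upper_bound(1)[OF A_strong_power_weight fLp]
    proof eventually_elim
      case (elim x)
      have nn: "0 \<le> riesz_integrand \<alpha> f x t" for t
        using f0 by (auto simp: riesz_integrand_def intro!: divide_nonneg_nonneg prod_nonneg)
      have int: "ennreal (riesz_integrand \<alpha> f x t) = (\<Prod>i\<in>UNIV. ennreal (f1 (t $ i) * \<bar>x $ i - t $ i\<bar> powr (\<alpha> - 1)))" for t
      proof -
        have "riesz_integrand \<alpha> f x t = (\<Prod>i\<in>UNIV. f1 (t $ i) * \<bar>x $ i - t $ i\<bar> powr (\<alpha> - 1))"
          using riesz_integrand_abs[of \<alpha> f x t] nn[of t] f0[of t] by (simp add: f_def prod_fun_def prod.distrib)
        then show ?thesis using f1 by (simp add: prod_ennreal)
      qed
      have "ennreal (prod_fun L x) = (\<Prod>i\<in>UNIV. ennreal (L (x $ i)))" using L by (simp add: prod_fun_def prod_ennreal)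
      also have "\<dots> \<le> (\<Prod>i\<in>UNIV. \<integral>\<^sup>+t. ennreal (f1 t * \<bar>x $ i - t\<bar> powr (\<alpha> - 1)) \<partial>lborel)"
        by (intro prod_mono_ennreal lower)
      also have "\<dots> = (\<integral>\<^sup>+t. ennreal (riesz_integrand \<alpha> f x t) \<partial>lebesgue)"
        unfolding int by (rule nn_integral_prod_components[symmetric]) measurable
      also have "\<dots> = ennreal (riesz_potential \<alpha> f x)"
        unfolding riesz_potential_def using elim nn by (intro nn_integral_eq_integral) auto
      finally have le: "prod_fun L x \<le> riesz_potential \<alpha> f x"
        using integral_nonneg_AE[of "riesz_integrand \<alpha> f x" lebesgue] nn by (simp add: riesz_potential_def)
      have "\<bar>w x * prod_fun L x\<bar> \<le> \<bar>w x * riesz_potential \<alpha> f x\<bar>"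
        using le w0[of x] prod_fun_nonneg[of L x] L by (simp add: abs_mult mult_left_mono)
      then show ?case using basic by (intro ennreal_leI powr_mono2) auto
    qed
  qed (use basic in simp)
  also have "Lp_norm q (\<lambda>x. w x * prod_fun L x) = ennreal (m powr (?n / q))"
    using basic L m by (intro norm_eq) auto
  also have "Lp_norm q (\<lambda>x. w x * riesz_potential \<alpha> f x)
      \<le> ennreal (\<psi> (enn2real (A_char_prod p q w))) * Lp_norm p (\<lambda>x. w x * f x)"
    using ineq A_strong_power_weight fLp by blast
  also have "\<dots> \<le> ennreal (\<psi> (C ^ ?n)) * ennreal (N powr (?n / p))"
    unfolding normf using A_char_prod_power_weight psi(2)
    by (intro mult_right_mono ennreal_leI) (auto simp: mono_on_def)
  also have "\<dots> = ennreal (\<psi> (C ^ ?n) * N powr (?n / p))" by (rule ennreal_mult''[symmetric]) simp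
  finally have le: "ennreal (m powr (?n / q)) \<le> ennreal (\<psi> (C ^ ?n) * N powr (?n / p))" .
  have "1 \<le> C ^ ?n" using A_char_prod_power_weight by linarith
  then have "0 \<le> \<psi> (C ^ ?n)" using psi(1) by (simp add: less_imp_le)
  then show ?thesis using le by (subst (asm) ennreal_le_iff) auto
qed

end

end

section \<open>The two extremal families of power weights\<close>

text \<open>For a given \<open>t\<close> take \<open>\<delta> = 4 / u\<close> with
  \<open>u powr k = t\<close>. The lower bound becomes a fixed multiple of
  \<open>u powr s = t powr \<beta>\<close>, which contradicts the limit 0.\<close>

lemma asymptotic_contradiction:
  fixes \<psi> :: "real \<Rightarrow> real"
  assumes lim: "((\<lambda>t. \<psi> t / t powr \<beta>) \<longlongrightarrow> 0) at_top"
    and c: "0 < c" and k: "0 < k" and s: "k * \<beta> = s"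
    and ineq: "\<And>\<delta>. 0 < \<delta> \<Longrightarrow> \<delta> < 1 \<Longrightarrow> c * \<delta> powr - s \<le> \<psi> ((4 / \<delta>) powr k)"
  shows False
proof -
  have "eventually (\<lambda>t. \<psi> t / t powr \<beta> < c * 4 powr - s) at_top"
    using lim c by (intro order_tendstoD) auto
  \<comment> \<open>The requirement \<open>4 powr k < t\<close> gives \<open>u > 4\<close> and hence
    \<open>\<delta> < 1\<close>.\<close>
  then obtain t where t: "\<psi> t / t powr \<beta> < c * 4 powr - s" "4 powr k < t"
    using eventually_conj[OF _ eventually_gt_at_top[of "4 powr k"]] eventually_happens'[OF trivial_limit_at_top_linorder]
    by (metis (mono_tags, lifting))
  have t0: "0 < t" using t(2) by (smt (verit) powr_ge_zero)
  define u where "u = t powr (1 / k)"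
  have "(4 powr k) powr (1 / k) < u" unfolding u_def using t k by (intro powr_less_mono2) auto
  then have u: "4 < u" using k by (simp add: powr_powr)
  have uk: "u powr k = t" using t0 k by (simp add: u_def powr_powr)
  have "c * (4 / u) powr - s \<le> \<psi> ((4 / (4 / u)) powr k)" using u by (intro ineq) auto
  also have "(4 / (4 / u)) powr k = t" using u uk by simp
  also have "(4 / u) powr - s = 4 powr - s * u powr s"
    using powr_minus_divide[of u s] by (simp add: powr_divide)
  also have "u powr s = t powr \<beta>" using uk by (simp add: s[symmetric] powr_powr[symmetric])
  finally have "c * 4 powr - s \<le> \<psi> t / t powr \<beta>"
    using t0 by (simp add: le_divide_eq mult_ac)
  then show False using t(1) by simp
qed

text \<open>The integral over the whole unit interval is \<open>1 / \<delta>\<close>, and the part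
  up to \<open>s\<close> is at most half of it.\<close>

lemma nn_integral_power_tail:
  fixes s \<delta> :: real
  assumes "0 < \<delta>" "0 \<le> s" "s \<le> 1" "s powr \<delta> \<le> 1 / 2"
  shows "ennreal (1 / (2 * \<delta>)) \<le> (\<integral>\<^sup>+t. ennreal (t powr (\<delta> - 1)) * indicator {s<..1} t \<partial>lborel)"
proof (rule ccontr)
  let ?I = "\<integral>\<^sup>+t. ennreal (t powr (\<delta> - 1)) * indicator {s<..1} t \<partial>lborel"
  assume "\<not> ?thesis"
  then have lt: "?I < ennreal (1 / (2 * \<delta>))" by simp
  then have "?I < top" by (rule less_trans) simp
  then obtain x where x: "?I = ennreal x" "0 \<le> x" by (cases ?I) auto
  have "ennreal (1 powr \<delta> / \<delta>) = (\<integral>\<^sup>+t. ennreal (t powr (\<delta> - 1)) * indicator {0..1} t \<partial>lborel)"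
    using assms by (intro nn_integral_powr_from_0[symmetric]) auto
  also have "\<dots> = (\<integral>\<^sup>+t. ennreal (t powr (\<delta> - 1)) * indicator {0..s} t + ennreal (t powr (\<delta> - 1)) * indicator {s<..1} t \<partial>lborel)"
    using assms by (intro nn_integral_cong) (auto simp: indicator_def)
  also have "\<dots> = (\<integral>\<^sup>+t. ennreal (t powr (\<delta> - 1)) * indicator {0..s} t \<partial>lborel) + ?I"
    by (intro nn_integral_add) measurable
  also have "(\<integral>\<^sup>+t. ennreal (t powr (\<delta> - 1)) * indicator {0..s} t \<partial>lborel) = ennreal (s powr \<delta> / \<delta>)"
    using assms by (intro nn_integral_powr_from_0) auto
  also have "ennreal (s powr \<delta> / \<delta>) + ?I = ennreal (s powr \<delta> / \<delta> + x)" using x assms by simp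
  finally have "1 / \<delta> = s powr \<delta> / \<delta> + x" using x assms by (subst (asm) ennreal_inj) auto
  moreover have "s powr \<delta> / \<delta> \<le> 1 / 2 / \<delta>" using assms by (intro divide_right_mono) auto
  moreover have "x < 1 / (2 * \<delta>)" using lt x by (simp add: ennreal_less_iff)
  ultimately show False using assms by (simp add: field_simps)
qed

context exponents
begin

text \<open>The weight is chosen so that \<open>w powr - p'\<close> is nearly non-integrable at 0.
  The weighted norm of \<open>f1\<close> is \<open>\<delta> powr - (1 / p)\<close>, that of its
  potential at least of order \<open>\<delta> powr - (1 + 1 / q)\<close>, so their quotient has
  order \<open>\<delta> powr (\<alpha> - 1)\<close>, while the characteristic is at most
  \<open>(4 / \<delta>) powr (q / p')\<close>. This tests the exponent
  \<open>p' / q * (1 - \<alpha>)\<close>.\<close>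

lemma psi_lower_bound_p':
  assumes \<delta>: "0 < \<delta>" "\<delta> < 1"
    and psi: "\<forall>t\<ge>1. 0 < \<psi> t" "mono_on {1..} \<psi>"
    and ineq: "\<forall>w \<in> (A_strong p q :: (real^'n::finite \<Rightarrow> real) set). \<forall>f \<in> weighted_Lp p w.
               Lp_norm q (\<lambda>x. w x * riesz_potential \<alpha> f x)
                 \<le> ennreal (\<psi> (enn2real (A_char_prod p q w))) * Lp_norm p (\<lambda>x. w x * f x)"
  shows "(p / q) powr (CARD('n) / q) * \<delta> powr - (CARD('n) * (1 - \<alpha>)) \<le> \<psi> ((4 / \<delta>) powr (q / p' * CARD('n)))"
proof -
  note basic = p_gt_1 q_gt_1 p'_gt_1 q'_gt_1 alpha_pos alpha_less_1 p_less_q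
  let ?n = "real CARD('n)"
  define \<gamma> where "\<gamma> = (1 - \<delta>) / p'"
  define C where "C = (4 / \<delta>) powr (q / p')"
  have gp: "\<gamma> * - p' = \<delta> - 1" using basic by (simp add: \<gamma>_def)
  have gq: "\<gamma> * q = (1 - \<delta>) * (q / p')" by (simp add: \<gamma>_def)
  have bound: "power_weight_bound p q \<gamma> C"
    unfolding power_weight_bound_def p'_eq[symmetric] powr_powr gp gq
  proof (intro allI impI)
    fix a b :: real assume ab: "a < b"
    define M where "M = max \<bar>a\<bar> \<bar>b\<bar>"
    have M: "0 < M" using ab by (auto simp: M_def)
    have 1: "average {a..b} (\<lambda>s. \<bar>s\<bar> powr ((1 - \<delta>) * (q / p'))) \<le> ennreal (M powr ((1 - \<delta>) * (q / p')))"
      unfolding M_def using \<delta> basic by (intro average_abs_powr_pos ab) auto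
    have 2: "average {a..b} (\<lambda>s. \<bar>s\<bar> powr (\<delta> - 1)) \<le> ennreal (4 / \<delta> * M powr (\<delta> - 1))"
      unfolding M_def by (rule average_abs_powr_neg[OF ab \<delta>])
    have "average {a..b} (\<lambda>s. \<bar>s\<bar> powr ((1 - \<delta>) * (q / p'))) * ennreal_powr (average {a..b} (\<lambda>s. \<bar>s\<bar> powr (\<delta> - 1))) (q / p')
        \<le> ennreal (M powr ((1 - \<delta>) * (q / p'))) * ennreal_powr (ennreal (4 / \<delta> * M powr (\<delta> - 1))) (q / p')"
      using 1 2 basic by (intro mult_mono ennreal_powr_mono) auto
    also have "\<dots> = ennreal (M powr ((1 - \<delta>) * (q / p')) * (4 / \<delta> * M powr (\<delta> - 1)) powr (q / p'))"
    proof -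
      have "0 \<le> 4 / \<delta> * M powr (\<delta> - 1)" using \<delta> by simp
      then show ?thesis by (simp only: ennreal_powr_ennreal ennreal_mult powr_ge_zero)
    qed
    also have "M powr ((1 - \<delta>) * (q / p')) * (4 / \<delta> * M powr (\<delta> - 1)) powr (q / p') = C * M powr ((1 - \<delta>) * (q / p') + (\<delta> - 1) * (q / p'))"
      unfolding powr_mult powr_powr powr_add C_def by (simp only: mult_ac)
    also have "(1 - \<delta>) * (q / p') + (\<delta> - 1) * (q / p') = 0"
      unfolding distrib_right[symmetric] by simp
    also have "C * M powr 0 = C" using M by simp
    finally have 3: "average {a..b} (\<lambda>s. \<bar>s\<bar> powr ((1 - \<delta>) * (q / p'))) * ennreal_powr (average {a..b} (\<lambda>s. \<bar>s\<bar> powr (\<delta> - 1))) (q / p') \<le> ennreal C" .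
    show "average {a..b} (\<lambda>s. \<bar>s\<bar> powr ((1 - \<delta>) * (q / p'))) < top \<and> average {a..b} (\<lambda>s. \<bar>s\<bar> powr (\<delta> - 1)) < top \<and>
        average {a..b} (\<lambda>s. \<bar>s\<bar> powr ((1 - \<delta>) * (q / p'))) * ennreal_powr (average {a..b} (\<lambda>s. \<bar>s\<bar> powr (\<delta> - 1))) (q / p') \<le> ennreal C"
      using le_less_trans[OF 1 ennreal_less_top] le_less_trans[OF 2 ennreal_less_top] 3 by blast
  qed
  \<comment> \<open>On the unit interval this is \<open>w powr - p'\<close>, because
    \<open>\<gamma> * - p' = \<delta> - 1\<close>.\<close>
  define f1 where "f1 t = t powr (\<delta> - 1) * indicator {0..1} t" for t :: real
  \<comment> \<open>Only \<open>t \<le> s\<close> is kept in the potential, where the kernel is at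
    least \<open>s powr (\<alpha> - 1)\<close>.\<close>
  define L where "L s = s powr (\<delta> + \<alpha> - 1) / \<delta> * indicator {0..1} s" for s :: real
  have lower: "ennreal (L s) \<le> (\<integral>\<^sup>+t. ennreal (f1 t * \<bar>s - t\<bar> powr (\<alpha> - 1)) \<partial>lborel)" for s
  proof (cases "0 < s \<and> s \<le> 1")
    case True
    have "ennreal (L s) = ennreal (s powr (\<alpha> - 1)) * ennreal (s powr \<delta> / \<delta>)"
    proof -
      have "\<delta> + \<alpha> - 1 = (\<alpha> - 1) + \<delta>" by simp
      then have "s powr (\<delta> + \<alpha> - 1) = s powr (\<alpha> - 1) * s powr \<delta>" by (simp only: powr_add)
      then have "L s = s powr (\<alpha> - 1) * (s powr \<delta> / \<delta>)" using True by (simp add: L_def)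
      then show ?thesis using \<delta> by (simp only: ennreal_mult powr_ge_zero divide_nonneg_pos)
    qed
    also have "\<dots> = (\<integral>\<^sup>+t. ennreal (s powr (\<alpha> - 1)) * (ennreal (t powr (\<delta> - 1)) * indicator {0..s} t) \<partial>lborel)"
      using \<delta> True by (subst nn_integral_cmult) (simp_all add: nn_integral_powr_from_0)
    also have "\<dots> \<le> (\<integral>\<^sup>+t. ennreal (f1 t * \<bar>s - t\<bar> powr (\<alpha> - 1)) \<partial>lborel)"
    proof (rule nn_integral_mono_AE, use AE_lborel_singleton[of s] in eventually_elim)
      case (elim t)
      show ?case
      proof (cases "t \<in> {0..s}")
        case t: True
        have "s powr (\<alpha> - 1) \<le> \<bar>s - t\<bar> powr (\<alpha> - 1)"
          using t elim basic by (intro powr_mono2') auto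
        then have "t powr (\<delta> - 1) * s powr (\<alpha> - 1) \<le> t powr (\<delta> - 1) * \<bar>s - t\<bar> powr (\<alpha> - 1)"
          by (rule mult_left_mono) simp
        moreover have "f1 t = t powr (\<delta> - 1)" using t True by (simp add: f1_def)
        ultimately have "s powr (\<alpha> - 1) * t powr (\<delta> - 1) \<le> f1 t * \<bar>s - t\<bar> powr (\<alpha> - 1)"
          by (simp only: mult.commute)
        then have "ennreal (s powr (\<alpha> - 1) * t powr (\<delta> - 1)) \<le> ennreal (f1 t * \<bar>s - t\<bar> powr (\<alpha> - 1))" by (rule ennreal_leI)
        then show ?thesis using t by (simp add: ennreal_mult)
      qed simp
    qed
    finally show ?thesis .
  next
    case False
    then have "L s = 0" by (auto simp: L_def indicator_def)
    then show ?thesis by simp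
  qed
  have N: "(\<integral>\<^sup>+s. ennreal ((\<bar>s\<bar> powr \<gamma> * f1 s) powr p) \<partial>lborel) = ennreal (1 / \<delta>)"
  proof -
    have e: "(\<gamma> + (\<delta> - 1)) * p = \<delta> - 1"
    proof -
      have "\<gamma> + (\<delta> - 1) = (1 - \<delta>) * (1 / p' - 1)" by (simp add: \<gamma>_def algebra_simps)
      also have "1 / p' - 1 = - (1 / p)" using conj_p by linarith
      finally show ?thesis using basic by simp
    qed
    have "ennreal ((\<bar>s\<bar> powr \<gamma> * f1 s) powr p) = ennreal (s powr (\<delta> - 1)) * indicator {0..1} s" for s
    proof (cases "s \<in> {0..1}")
      case True
      then have "(\<bar>s\<bar> powr \<gamma> * f1 s) powr p = s powr ((\<gamma> + (\<delta> - 1)) * p)"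
        by (simp add: f1_def powr_add[symmetric] powr_powr)
      then show ?thesis using True by (simp add: e)
    qed (simp add: f1_def)
    then show ?thesis using \<delta> nn_integral_powr_from_0[of \<delta> 1] by simp
  qed
  define m where "m = \<delta> powr - q * (1 / (\<delta> * q / p))"
  have m: "(\<integral>\<^sup>+s. ennreal ((\<bar>s\<bar> powr \<gamma> * L s) powr q) \<partial>lborel) = ennreal m"
  proof -
    have e: "(\<gamma> + (\<delta> + \<alpha> - 1)) * q = \<delta> * q / p - 1"
    proof -
      have "1 / p' = 1 - 1 / p" using conj_p by linarith
      then have "\<gamma> + (\<delta> + \<alpha> - 1) = (1 - \<delta>) * (1 - 1 / p) + (\<delta> + \<alpha> - 1)" by (metis \<gamma>_def mult.right_neutral times_divide_eq_right)
      also have "\<dots> = \<delta> / p - 1 / q" by (simp add: gap[symmetric] left_diff_distrib right_diff_distrib diff_divide_distrib)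
      finally show ?thesis using q_gt_1 by (simp add: left_diff_distrib)
    qed
    have "ennreal ((\<bar>s\<bar> powr \<gamma> * L s) powr q) = ennreal (\<delta> powr - q) * (ennreal (s powr (\<delta> * q / p - 1)) * indicator {0..1} s)" for s
    proof (cases "s \<in> {0..1}")
      case True
      then have "(\<bar>s\<bar> powr \<gamma> * L s) powr q = ((s powr (\<gamma> + (\<delta> + \<alpha> - 1))) / \<delta>) powr q"
        unfolding powr_add by (simp add: L_def)
      also have "\<dots> = \<delta> powr - q * s powr (\<delta> * q / p - 1)"
        unfolding powr_divide powr_powr e powr_minus_divide by simp
      finally show ?thesis using True by (simp add: ennreal_mult)
    qed (simp add: L_def)
    then have "(\<integral>\<^sup>+s. ennreal ((\<bar>s\<bar> powr \<gamma> * L s) powr q) \<partial>lborel)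
        = ennreal (\<delta> powr - q) * (\<integral>\<^sup>+s. ennreal (s powr (\<delta> * q / p - 1)) * indicator {0..1} s \<partial>lborel)"
      by (simp add: nn_integral_cmult)
    also have "(\<integral>\<^sup>+s. ennreal (s powr (\<delta> * q / p - 1)) * indicator {0..1} s \<partial>lborel) = ennreal (1 powr (\<delta> * q / p) / (\<delta> * q / p))"
      using \<delta> basic by (intro nn_integral_powr_from_0) auto
    also have "ennreal (\<delta> powr - q) * ennreal (1 powr (\<delta> * q / p) / (\<delta> * q / p)) = ennreal m"
      unfolding m_def using \<delta> q_gt_1 p_gt_1 by (subst ennreal_mult[symmetric]) auto
    finally show ?thesis .
  qed
  have main: "m powr (?n / q) \<le> \<psi> (C ^ CARD('n)) * (1 / \<delta>) powr (?n / p)"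
  proof (rule sharp_inequality[OF bound _ _ _ _ _ lower N _ m _ psi ineq])
    show "f1 \<in> borel_measurable borel" "L \<in> borel_measurable borel"
      unfolding f1_def[abs_def] L_def[abs_def] by measurable
    show "0 \<le> m" using \<delta> basic by (simp add: m_def)
  qed (use \<delta> in \<open>auto simp: C_def f1_def L_def\<close>)
  have "m powr (?n / q) * \<delta> powr (?n / p) \<le> \<psi> (C ^ CARD('n)) * ((1 / \<delta>) powr (?n / p) * \<delta> powr (?n / p))"
    using mult_right_mono[OF main, of "\<delta> powr (?n / p)"] by (simp only: mult.assoc powr_ge_zero)
  also have "(1 / \<delta>) powr (?n / p) * \<delta> powr (?n / p) = 1" using \<delta> by (simp add: powr_divide)
  also have "m powr (?n / q) * \<delta> powr (?n / p) = (p / q) powr (?n / q) * \<delta> powr - (?n * (1 - \<alpha>))"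
  proof -
    have m_eq: "m = (p / q) * \<delta> powr (- q - 1)" using \<delta> basic by (simp add: m_def powr_diff field_simps)
    have "m powr (?n / q) * \<delta> powr (?n / p) = (p / q) powr (?n / q) * (\<delta> powr ((- q - 1) * (?n / q)) * \<delta> powr (?n / p))"
      unfolding m_eq powr_mult powr_powr by (simp only: mult.assoc)
    also have "\<delta> powr ((- q - 1) * (?n / q)) * \<delta> powr (?n / p) = \<delta> powr ((- q - 1) * (?n / q) + ?n / p)" by (rule powr_add[symmetric])
    also have "(- q - 1) * (?n / q) + ?n / p = - (?n * (1 - \<alpha>))"
    proof -
      have "(- q - 1) * (?n / q) + ?n / p = ?n * (1 / p - 1 / q - 1)" using basic by (simp add: field_simps)
      then show ?thesis by (simp add: gap algebra_simps)
    qed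
    finally show ?thesis .
  qed
  also have "C ^ CARD('n) = (4 / \<delta>) powr (q / p' * CARD('n))"
    using \<delta> by (simp add: C_def powr_realpow[symmetric] powr_powr)
  finally show ?thesis by simp
qed

text \<open>Now \<open>w powr q\<close> is nearly non-integrable at 0 and the characteristic is at
  most \<open>4 / \<delta>\<close>. The quotient of the norms again has order
  \<open>\<delta> powr (\<alpha> - 1)\<close>: the potential is at least
  \<open>1 / (2 * \<delta>)\<close> near 0, and the singular weight still has mass of order
  \<open>1 / \<delta>\<close> there. This tests the exponent \<open>1 - \<alpha>\<close>.\<close>

lemma psi_lower_bound_q:
  assumes \<delta>: "0 < \<delta>" "\<delta> < 1"
    and psi: "\<forall>t\<ge>1. 0 < \<psi> t" "mono_on {1..} \<psi>"
    and ineq: "\<forall>w \<in> (A_strong p q :: (real^'n::finite \<Rightarrow> real) set). \<forall>f \<in> weighted_Lp p w.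
               Lp_norm q (\<lambda>x. w x * riesz_potential \<alpha> f x)
                 \<le> ennreal (\<psi> (enn2real (A_char_prod p q w))) * Lp_norm p (\<lambda>x. w x * f x)"
  shows "2 powr - (CARD('n) * (1 + 1 / q)) * (p * (1 + 1 / q)) powr (CARD('n) / p) * \<delta> powr - (CARD('n) * (1 - \<alpha>))
    \<le> \<psi> ((4 / \<delta>) powr CARD('n))"
proof -
  note basic = p_gt_1 q_gt_1 p'_gt_1 q'_gt_1 alpha_pos alpha_less_1 p_less_q
  let ?n = "real CARD('n)"
  define \<gamma> where "\<gamma> = (\<delta> - 1) / q"
  define C where "C = 4 / \<delta>"
  have gq: "\<gamma> * q = \<delta> - 1" using basic by (simp add: \<gamma>_def)
  have gp: "\<gamma> * - p' = (1 - \<delta>) * (p' / q)" by (simp add: \<gamma>_def algebra_simps diff_divide_distrib)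
  have bound: "power_weight_bound p q \<gamma> C"
    unfolding power_weight_bound_def p'_eq[symmetric] powr_powr gp gq
  proof (intro allI impI)
    fix a b :: real assume ab: "a < b"
    define M where "M = max \<bar>a\<bar> \<bar>b\<bar>"
    have M: "0 < M" using ab by (auto simp: M_def)
    have 1: "average {a..b} (\<lambda>s. \<bar>s\<bar> powr ((1 - \<delta>) * (p' / q))) \<le> ennreal (M powr ((1 - \<delta>) * (p' / q)))"
      unfolding M_def using \<delta> basic by (intro average_abs_powr_pos ab) auto
    have 2: "average {a..b} (\<lambda>s. \<bar>s\<bar> powr (\<delta> - 1)) \<le> ennreal (4 / \<delta> * M powr (\<delta> - 1))"
      unfolding M_def by (rule average_abs_powr_neg[OF ab \<delta>])
    have "average {a..b} (\<lambda>s. \<bar>s\<bar> powr (\<delta> - 1)) * ennreal_powr (average {a..b} (\<lambda>s. \<bar>s\<bar> powr ((1 - \<delta>) * (p' / q)))) (q / p')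
        \<le> ennreal (4 / \<delta> * M powr (\<delta> - 1)) * ennreal_powr (ennreal (M powr ((1 - \<delta>) * (p' / q)))) (q / p')"
      using 1 2 basic by (intro mult_mono ennreal_powr_mono) auto
    also have "\<dots> = ennreal (4 / \<delta> * M powr (\<delta> - 1) * M powr (1 - \<delta>))"
    proof -
      have "0 \<le> 4 / \<delta> * M powr (\<delta> - 1)" using \<delta> by simp
      moreover have "(1 - \<delta>) * (p' / q) * (q / p') = 1 - \<delta>" using q_gt_1 p'_gt_1 by simp
      then have "ennreal_powr (ennreal (M powr ((1 - \<delta>) * (p' / q)))) (q / p') = ennreal (M powr (1 - \<delta>))"
        by (simp only: ennreal_powr_ennreal powr_ge_zero powr_powr)
      ultimately show ?thesis by (simp only: ennreal_mult powr_ge_zero)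
    qed
    also have "4 / \<delta> * M powr (\<delta> - 1) * M powr (1 - \<delta>) = C"
      using M by (simp add: C_def powr_add[symmetric])
    finally have 3: "average {a..b} (\<lambda>s. \<bar>s\<bar> powr (\<delta> - 1)) * ennreal_powr (average {a..b} (\<lambda>s. \<bar>s\<bar> powr ((1 - \<delta>) * (p' / q)))) (q / p') \<le> ennreal C" .
    show "average {a..b} (\<lambda>s. \<bar>s\<bar> powr (\<delta> - 1)) < top \<and> average {a..b} (\<lambda>s. \<bar>s\<bar> powr ((1 - \<delta>) * (p' / q))) < top \<and>
        average {a..b} (\<lambda>s. \<bar>s\<bar> powr (\<delta> - 1)) * ennreal_powr (average {a..b} (\<lambda>s. \<bar>s\<bar> powr ((1 - \<delta>) * (p' / q)))) (q / p') \<le> ennreal C"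
      using le_less_trans[OF 1 ennreal_less_top] le_less_trans[OF 2 ennreal_less_top] 3 by blast
  qed
  \<comment> \<open>The condition \<open>s powr \<delta> \<le> 1 / 2\<close> of the tail bound holds
    exactly up to \<open>h\<close>. Although \<open>h\<close> is exponentially small,
    \<open>{0..h}\<close> carries half of the mass of \<open>w powr q\<close> on the unit
    interval.\<close>
  define h where "h = (1 / 2) powr (1 / \<delta>)"
  have h: "0 \<le> h" "h \<le> 1" "h powr \<delta> = 1 / 2"
    using \<delta> by (auto simp: h_def powr_powr intro!: powr_le1)
  \<comment> \<open>For \<open>t > s\<close> the kernel is at least
    \<open>t powr (\<alpha> - 1)\<close>, so the integrand dominates
    \<open>t powr (\<delta> - 1)\<close> independently of \<open>s\<close>.\<close>
  define f1 where "f1 t = t powr (\<delta> - \<alpha>) * indicator {0..1} t" for t :: real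
  define L where "L s = 1 / (2 * \<delta>) * indicator {0..h} s" for s :: real
  have lower: "ennreal (L s) \<le> (\<integral>\<^sup>+t. ennreal (f1 t * \<bar>s - t\<bar> powr (\<alpha> - 1)) \<partial>lborel)" for s
  proof (cases "s \<in> {0..h}")
    case True
    have "s powr \<delta> \<le> h powr \<delta>" using True \<delta> by (intro powr_mono2) auto
    then have "ennreal (L s) \<le> (\<integral>\<^sup>+t. ennreal (t powr (\<delta> - 1)) * indicator {s<..1} t \<partial>lborel)"
      using nn_integral_power_tail[of \<delta> s] True \<delta> h by (simp add: L_def)
    also have "\<dots> \<le> (\<integral>\<^sup>+t. ennreal (f1 t * \<bar>s - t\<bar> powr (\<alpha> - 1)) \<partial>lborel)"
    proof (rule nn_integral_mono)
      fix t
      show "ennreal (t powr (\<delta> - 1)) * indicator {s<..1} t \<le> ennreal (f1 t * \<bar>s - t\<bar> powr (\<alpha> - 1))"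
      proof (cases "t \<in> {s<..1}")
        case t: True
        have "t powr (\<alpha> - 1) \<le> \<bar>s - t\<bar> powr (\<alpha> - 1)"
          using t True basic by (intro powr_mono2') auto
        then have "t powr (\<delta> - \<alpha>) * t powr (\<alpha> - 1) \<le> t powr (\<delta> - \<alpha>) * \<bar>s - t\<bar> powr (\<alpha> - 1)"
          by (intro mult_left_mono) auto
        then have "t powr (\<delta> - 1) \<le> f1 t * \<bar>s - t\<bar> powr (\<alpha> - 1)"
          using t True by (simp add: f1_def powr_add[symmetric])
        then show ?thesis using t by (simp add: ennreal_leI)
      qed simp
    qed
    finally show ?thesis .
  qed (simp add: L_def)
  define k where "k = p * (1 + 1 / q)"
  have k: "0 < k" using basic by (simp add: k_def add_pos_nonneg)
  have N: "(\<integral>\<^sup>+s. ennreal ((\<bar>s\<bar> powr \<gamma> * f1 s) powr p) \<partial>lborel) = ennreal (1 / (\<delta> * k))"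
  proof -
    have e: "(\<gamma> + (\<delta> - \<alpha>)) * p = \<delta> * k - 1"
    proof -
      have "\<gamma> + (\<delta> - \<alpha>) = \<delta> * (1 + 1 / q) - 1 / p" using gap by (simp add: \<gamma>_def algebra_simps diff_divide_distrib)
      then show ?thesis using p_gt_1 by (simp add: k_def left_diff_distrib right_diff_distrib mult_ac)
    qed
    have "ennreal ((\<bar>s\<bar> powr \<gamma> * f1 s) powr p) = ennreal (s powr (\<delta> * k - 1)) * indicator {0..1} s" for s
    proof (cases "s \<in> {0..1}")
      case True
      then have "(\<bar>s\<bar> powr \<gamma> * f1 s) powr p = s powr ((\<gamma> + (\<delta> - \<alpha>)) * p)"
        by (simp add: f1_def powr_add[symmetric] powr_powr)
      then show ?thesis using True by (simp add: e)
    qed (simp add: f1_def)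
    then show ?thesis using \<delta> k nn_integral_powr_from_0[of "\<delta> * k" 1] by simp
  qed
  define m where "m = (2 * \<delta>) powr (- q - 1)"
  have m: "(\<integral>\<^sup>+s. ennreal ((\<bar>s\<bar> powr \<gamma> * L s) powr q) \<partial>lborel) = ennreal m"
  proof -
    have "ennreal ((\<bar>s\<bar> powr \<gamma> * L s) powr q) = ennreal ((2 * \<delta>) powr - q) * (ennreal (s powr (\<delta> - 1)) * indicator {0..h} s)" for s
    proof (cases "s \<in> {0..h}")
      case True
      then have "(\<bar>s\<bar> powr \<gamma> * L s) powr q = (s powr \<gamma> / (2 * \<delta>)) powr q" by (simp add: L_def)
      also have "\<dots> = (2 * \<delta>) powr - q * s powr (\<delta> - 1)"
        unfolding powr_divide powr_powr gq powr_minus_divide by simp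
      finally show ?thesis using True by (simp add: ennreal_mult)
    qed (simp add: L_def)
    then have "(\<integral>\<^sup>+s. ennreal ((\<bar>s\<bar> powr \<gamma> * L s) powr q) \<partial>lborel)
        = ennreal ((2 * \<delta>) powr - q) * (\<integral>\<^sup>+s. ennreal (s powr (\<delta> - 1)) * indicator {0..h} s \<partial>lborel)"
      by (simp add: nn_integral_cmult)
    also have "(\<integral>\<^sup>+s. ennreal (s powr (\<delta> - 1)) * indicator {0..h} s \<partial>lborel) = ennreal (h powr \<delta> / \<delta>)"
      by (rule nn_integral_powr_from_0[OF \<delta>(1) h(1)])
    also have "ennreal ((2 * \<delta>) powr - q) * ennreal (h powr \<delta> / \<delta>) = ennreal ((2 * \<delta>) powr - q * (h powr \<delta> / \<delta>))"
      using \<delta> by (intro ennreal_mult[symmetric]) simp_all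
    also have "(2 * \<delta>) powr - q * (h powr \<delta> / \<delta>) = m" using \<delta> by (simp add: m_def h(3) powr_diff)
    finally show ?thesis .
  qed
  have main: "m powr (?n / q) \<le> \<psi> (C ^ CARD('n)) * (1 / (\<delta> * k)) powr (?n / p)"
  proof (rule sharp_inequality[OF bound _ _ _ _ _ lower N _ m _ psi ineq])
    show "f1 \<in> borel_measurable borel" "L \<in> borel_measurable borel"
      unfolding f1_def[abs_def] L_def[abs_def] by measurable
  qed (use \<delta> k in \<open>auto simp: C_def f1_def L_def m_def\<close>)
  have "m powr (?n / q) * (\<delta> * k) powr (?n / p) \<le> \<psi> (C ^ CARD('n)) * ((1 / (\<delta> * k)) powr (?n / p) * (\<delta> * k) powr (?n / p))"
    using mult_right_mono[OF main, of "(\<delta> * k) powr (?n / p)"] by (simp only: mult.assoc powr_ge_zero)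
  also have "(1 / (\<delta> * k)) powr (?n / p) * (\<delta> * k) powr (?n / p) = 1" using \<delta> k by (simp add: powr_divide)
  also have "m powr (?n / q) * (\<delta> * k) powr (?n / p) = 2 powr - (?n * (1 + 1 / q)) * k powr (?n / p) * \<delta> powr - (?n * (1 - \<alpha>))"
  proof -
    have e: "(- q - 1) * (?n / q) = - (?n * (1 + 1 / q))" using basic by (simp add: field_simps)
    have "m powr (?n / q) * (\<delta> * k) powr (?n / p)
        = 2 powr - (?n * (1 + 1 / q)) * k powr (?n / p) * (\<delta> powr - (?n * (1 + 1 / q)) * \<delta> powr (?n / p))"
      unfolding m_def powr_powr e powr_mult by (simp only: mult_ac)
    also have "\<delta> powr - (?n * (1 + 1 / q)) * \<delta> powr (?n / p) = \<delta> powr (- (?n * (1 + 1 / q)) + ?n / p)" by (rule powr_add[symmetric])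
    also have "- (?n * (1 + 1 / q)) + ?n / p = - (?n * (1 - \<alpha>))"
      using arg_cong[OF gap, of "\<lambda>x. ?n * x"] by (simp add: algebra_simps)
    finally show ?thesis .
  qed
  also have "C ^ CARD('n) = (4 / \<delta>) powr CARD('n)"
    using \<delta> by (simp add: C_def powr_realpow)
  finally show ?thesis by (simp add: k_def)
qed

end

theorem theorem4p14:
  fixes \<alpha> p q p' \<beta> :: real
  assumes "0 < \<alpha>" and "\<alpha> < 1"
    and "1 < p" and "p < 1 / \<alpha>"
    and "q = p / (1 - \<alpha> * p)"
    and "p' = p / (p - 1)"
    and "\<beta> = max 1 (p' / q) * (1 - \<alpha>)"
  shows "(\<exists>c>0. \<forall>w \<in> (A_strong p q :: (real^'n \<Rightarrow> real) set). \<forall>f \<in> weighted_Lp p w.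
            (AE x in lebesgue. integrable lebesgue (riesz_integrand \<alpha> f x)) \<and>
            Lp_norm q (\<lambda>x. w x * riesz_potential \<alpha> f x)
              \<le> ennreal c * ennreal_powr (A_char_prod p q w) \<beta> * Lp_norm p (\<lambda>x. w x * f x)) \<and>
         \<not> (\<exists>\<psi> :: real \<Rightarrow> real.
            (\<forall>t\<ge>1. 0 < \<psi> t) \<and> mono_on {1..} \<psi> \<and>
            ((\<lambda>t. \<psi> t / t powr \<beta>) \<longlongrightarrow> 0) at_top \<and>
            (\<forall>w \<in> (A_strong p q :: (real^'n \<Rightarrow> real) set). \<forall>f \<in> weighted_Lp p w.
               Lp_norm q (\<lambda>x. w x * riesz_potential \<alpha> f x)
                 \<le> ennreal (\<psi> (enn2real (A_char_prod p q w))) * Lp_norm p (\<lambda>x. w x * f x)))"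
proof -
  have ap: "0 < 1 - \<alpha> * p" "1 - \<alpha> * p < 1" using assms(1,3,4) by (auto simp: field_simps)
  have pq: "p < q"
  proof -
    have "p * (1 - \<alpha> * p) < p * 1" using ap assms(3) by (intro mult_strict_left_mono) auto
    then show ?thesis using ap by (simp add: assms(5) less_divide_eq)
  qed
  define q' where "q' = q / (q - 1)"
  interpret exponents \<alpha> p q p' q'
  proof
    show "1 / p - 1 / q = \<alpha>" using assms(3) by (simp add: assms(5) diff_divide_distrib)
    show "1 / p + 1 / p' = 1" using assms(3) by (simp add: assms(6) add_divide_distrib[symmetric])
    show "1 / q + 1 / q' = 1" using pq assms(3) by (simp add: q'_def add_divide_distrib[symmetric])
  qed (use assms pq in auto)
  have first: "\<exists>c>0. \<forall>w \<in> (A_strong p q :: (real^'n \<Rightarrow> real) set). \<forall>f \<in> weighted_Lp p w.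
            (AE x in lebesgue. integrable lebesgue (riesz_integrand \<alpha> f x)) \<and>
            Lp_norm q (\<lambda>x. w x * riesz_potential \<alpha> f x)
              \<le> ennreal c * ennreal_powr (A_char_prod p q w) \<beta> * Lp_norm p (\<lambda>x. w x * f x)"
    unfolding assms(7) using one_dim_const_pos upper_bound
    by (intro exI[of _ "one_dim_const ^ CARD('n)"] conjI ballI) auto
  have second: False
    if psi: "\<forall>t\<ge>1. 0 < \<psi> t" "mono_on {1..} \<psi>" and lim: "((\<lambda>t. \<psi> t / t powr \<beta>) \<longlongrightarrow> 0) at_top"
      and ineq: "\<forall>w \<in> (A_strong p q :: (real^'n \<Rightarrow> real) set). \<forall>f \<in> weighted_Lp p w.
               Lp_norm q (\<lambda>x. w x * riesz_potential \<alpha> f x)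
                 \<le> ennreal (\<psi> (enn2real (A_char_prod p q w))) * Lp_norm p (\<lambda>x. w x * f x)" for \<psi>
  \<comment> \<open>The case decides which entry of the maximum is
    \<open>\<beta> / (1 - \<alpha>)\<close>. The family is matched to it so that the exponent of
    \<open>4 / \<delta>\<close> times \<open>\<beta>\<close> is
    \<open>CARD('n) * (1 - \<alpha>)\<close>, the order of growth in the lower bound.\<close>
  proof (cases "1 \<le> p' / q")
    case True
    show False
    proof (rule asymptotic_contradiction[OF lim _ _ _ psi_lower_bound_p'[OF _ _ psi ineq]])
      show "q / p' * real CARD('n) * \<beta> = real CARD('n) * (1 - \<alpha>)"
        using True q_gt_1 p'_gt_1 by (simp add: assms(7) max_def)
    qed (use q_gt_1 p'_gt_1 p_gt_1 in auto)
  next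
    case False
    show False
    proof (rule asymptotic_contradiction[OF lim _ _ _ psi_lower_bound_q[OF _ _ psi ineq]])
      show "real CARD('n) * \<beta> = real CARD('n) * (1 - \<alpha>)"
        using False by (simp add: assms(7) max_def)
      have "0 < p * (1 + 1 / q)" using q_gt_1 p_gt_1 by (intro mult_pos_pos add_pos_pos) auto
      then have "0 < (p * (1 + 1 / q)) powr (real CARD('n) / p)" unfolding powr_gt_zero by linarith
      then show "0 < 2 powr - (real CARD('n) * (1 + 1 / q)) * (p * (1 + 1 / q)) powr (real CARD('n) / p)"
        by (intro mult_pos_pos) (simp_all only: powr_gt_zero, simp)
    qed simp
  qed
  show ?thesis using first second by blast
qed

end
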